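(* Let $\varphi$ be a hyperbolic automorphism of the unit disc $\mathbb{D}$ and $C_\varphi f = f\circ\varphi$ the induced composition operator. Then $C_\varphi$ does not have the single-valued extension property on $H^p(\mathbb{D})$ for any $1 \le p < \infty$, and for every $1 < p < \infty$ the adjoint $C_\varphi^*$ acting on $H^p(\mathbb{D})^*$ has Dunford's property $(C)$.
   Context: $H^p(\mathbb{D})$ ($1\le p<\infty$) is the Hardy space of analytic $f$ on $\mathbb{D}$ with $\sup_{r<1}\frac{1}{2\pi}\int_0^{2\pi}|f(re^{i\theta})|^p\,d\theta<\infty$. A hyperbolic automorphism of $\mathbb{D}$ is a conformal automorphism of $\mathbb{D}$ (a linear fractional map) having two distinct fixed points, both on the unit circle $\mathbb{T}$; every such map is conjugate by an automorphism to $\varphi_r(z) = \frac{z+r}{1+rz}$ for some $0<r<1$. $C_\varphi^*$ denotes the Banach-space adjoint. An operator $T$ on a Banach space $X$ has the single-valued extension property (SVEP) if for every open $U\subseteq\mathbb{C}$ and analytic $f:U\to X$ with $(T-zI)f(z)=0$ on $U$, $f\equiv 0$. The local spectrum $\sigma_T(x)$ is the complement of the union of all open $U$ on which there is an analytic $f:U\to X$ with $(T-zI)f(z)=x$; $X_T(F)=\{x:\sigma_T(x)\subseteq F\}$; $T$ has Dunford's property $(C)$ if $X_T(F)$ is closed for every closed $F\subseteq\mathbb{C}$. *)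

theory Defs
  imports "HOL-Analysis.Analysis"
begin

text \<open>Elements of H^p are represented as functions complex => complex that are
holomorphic on the unit disc and normalized to be 0 outside it, so that the
H^p norm separates points.\<close>

definition integral_mean :: "real \<Rightarrow> (complex \<Rightarrow> complex) \<Rightarrow> real \<Rightarrow> real" where
  "integral_mean p f r =
     (1 / (2 * pi)) * integral {0..2*pi} (\<lambda>\<theta>. cmod (f (complex_of_real r * cis \<theta>)) powr p)"

definition hardy :: "real \<Rightarrow> (complex \<Rightarrow> complex) set" where
  "hardy p = {f. f holomorphic_on ball 0 1 \<and> (\<forall>z. z \<notin> ball 0 1 \<longrightarrow> f z = 0) \<and>
                 bdd_above (integral_mean p f ` {0..<1})}"

definition hp_norm :: "real \<Rightarrow> (complex \<Rightarrow> complex) \<Rightarrow> real" where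
  "hp_norm p f = (SUP r\<in>{0..<1}. integral_mean p f r) powr (1 / p)"

definition hyperbolic_automorphism :: "(complex \<Rightarrow> complex) \<Rightarrow> bool" where
  "hyperbolic_automorphism \<phi> \<longleftrightarrow>
     (\<exists>a b c d. a * d - b * c \<noteq> 0 \<and> (\<forall>z. \<phi> z = (a * z + b) / (c * z + d)) \<and>
        (\<forall>z\<in>ball 0 1. c * z + d \<noteq> 0) \<and> \<phi> ` ball 0 1 = ball 0 1 \<and>
        (\<exists>\<zeta>1 \<zeta>2. \<zeta>1 \<noteq> \<zeta>2 \<and> cmod \<zeta>1 = 1 \<and> cmod \<zeta>2 = 1 \<and>
           {\<zeta>. c * \<zeta> + d \<noteq> 0 \<and> (a * \<zeta> + b) / (c * \<zeta> + d) = \<zeta>} = {\<zeta>1, \<zeta>2}))"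

definition comp_op :: "(complex \<Rightarrow> complex) \<Rightarrow> (complex \<Rightarrow> complex) \<Rightarrow> (complex \<Rightarrow> complex)" where
  "comp_op \<phi> f = (\<lambda>z. if z \<in> ball 0 1 then f (\<phi> z) else 0)"

definition hp_dual :: "real \<Rightarrow> ((complex \<Rightarrow> complex) \<Rightarrow> complex) set" where
  "hp_dual p = {\<Lambda>.
     (\<forall>f\<in>hardy p. \<forall>g\<in>hardy p. \<Lambda> (\<lambda>t. f t + g t) = \<Lambda> f + \<Lambda> g) \<and>
     (\<forall>c. \<forall>f\<in>hardy p. \<Lambda> (\<lambda>t. c * f t) = c * \<Lambda> f) \<and>
     (\<exists>C. \<forall>f\<in>hardy p. cmod (\<Lambda> f) \<le> C * hp_norm p f) \<and>
     (\<forall>f. f \<notin> hardy p \<longrightarrow> \<Lambda> f = 0)}"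

definition dual_norm :: "real \<Rightarrow> ((complex \<Rightarrow> complex) \<Rightarrow> complex) \<Rightarrow> real" where
  "dual_norm p \<Lambda> = (SUP f\<in>{f\<in>hardy p. hp_norm p f \<le> 1}. cmod (\<Lambda> f))"

definition adjoint_comp_op ::
  "real \<Rightarrow> (complex \<Rightarrow> complex) \<Rightarrow> ((complex \<Rightarrow> complex) \<Rightarrow> complex) \<Rightarrow> ((complex \<Rightarrow> complex) \<Rightarrow> complex)" where
  "adjoint_comp_op p \<phi> \<Lambda> = (\<lambda>g. if g \<in> hardy p then \<Lambda> (comp_op \<phi> g) else 0)"

text \<open>The space X is a set of functions 'a => complex with pointwise vector
operations and norm N.  Vector-valued analyticity = complex differentiability in norm.\<close>

definition vanalytic :: "(('a \<Rightarrow> complex) \<Rightarrow> real) \<Rightarrow> ('a \<Rightarrow> complex) set \<Rightarrow> complex set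
     \<Rightarrow> (complex \<Rightarrow> 'a \<Rightarrow> complex) \<Rightarrow> bool" where
  "vanalytic N X U F \<longleftrightarrow> open U \<and> (\<forall>z\<in>U. F z \<in> X) \<and>
     (\<forall>z\<in>U. \<exists>G\<in>X. ((\<lambda>w. N (\<lambda>t. (F w t - F z t) / (w - z) - G t)) \<longlongrightarrow> 0) (at z))"

definition svep :: "('a \<Rightarrow> complex) set \<Rightarrow> (('a \<Rightarrow> complex) \<Rightarrow> real)
     \<Rightarrow> (('a \<Rightarrow> complex) \<Rightarrow> ('a \<Rightarrow> complex)) \<Rightarrow> bool" where
  "svep X N T \<longleftrightarrow> (\<forall>U F. vanalytic N X U F \<longrightarrow>
      (\<forall>z\<in>U. (\<lambda>t. T (F z) t - z * F z t) = (\<lambda>t. 0)) \<longrightarrow> (\<forall>z\<in>U. F z = (\<lambda>t. 0)))"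

definition local_spectrum :: "('a \<Rightarrow> complex) set \<Rightarrow> (('a \<Rightarrow> complex) \<Rightarrow> real)
     \<Rightarrow> (('a \<Rightarrow> complex) \<Rightarrow> ('a \<Rightarrow> complex)) \<Rightarrow> ('a \<Rightarrow> complex) \<Rightarrow> complex set" where
  "local_spectrum X N T x = - \<Union>{U. \<exists>F. vanalytic N X U F \<and>
      (\<forall>z\<in>U. (\<lambda>t. T (F z) t - z * F z t) = x)}"

definition local_spectral_subspace :: "('a \<Rightarrow> complex) set \<Rightarrow> (('a \<Rightarrow> complex) \<Rightarrow> real)
     \<Rightarrow> (('a \<Rightarrow> complex) \<Rightarrow> ('a \<Rightarrow> complex)) \<Rightarrow> complex set \<Rightarrow> ('a \<Rightarrow> complex) set" where
  "local_spectral_subspace X N T S = {x\<in>X. local_spectrum X N T x \<subseteq> S}"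

definition dunford_C :: "('a \<Rightarrow> complex) set \<Rightarrow> (('a \<Rightarrow> complex) \<Rightarrow> real)
     \<Rightarrow> (('a \<Rightarrow> complex) \<Rightarrow> ('a \<Rightarrow> complex)) \<Rightarrow> bool" where
  "dunford_C X N T \<longleftrightarrow> (\<forall>S. closed S \<longrightarrow>
     (\<forall>xs x. (\<forall>n. xs n \<in> local_spectral_subspace X N T S) \<longrightarrow> x \<in> X \<longrightarrow>
        (\<lambda>n. N (\<lambda>t. xs n t - x t)) \<longlonglongrightarrow> 0 \<longrightarrow> x \<in> local_spectral_subspace X N T S))"

end

theory Submission
  imports Defs "HOL-Complex_Analysis.Complex_Analysis"
begin

text \<open>Carry the disc to the right half-plane by a coordinate \<open>u\<close> sending the two fixed points to
  \<open>0\<close> and infinity; then \<open>\<phi>\<close> becomes multiplication by \<open>e^\<tau>\<close>, and \<open>u^s\<close> is an eigenfunction with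
  eigenvalue \<open>e^(s \<tau>)\<close>, belonging to \<open>H^p\<close> for \<open>|Re s| < 1/p\<close>. Since \<open>s \<mapsto> u^s\<close> is analytic, the
  single-valued extension property fails.

  For the adjoint, if a functional \<open>\<Lambda>\<close> has a local resolvent near a point of the annulus
  \<open>{e^(s \<tau>). |Re s| < 1/p}\<close>, evaluation at the eigenfunctions gives \<open>\<Lambda> (u^s) = 0\<close> on an open set of
  \<open>s\<close>, hence on the strip. This forces \<open>\<Lambda> = 0\<close>: with \<open>q = 1/(u + a)\<close>, a linear polynomial in \<open>z\<close>,
  the functions \<open>E_n(s) = \<Lambda> (u^s q^n)\<close> satisfy \<open>E_(n+1)(s+1) = E_n(s) - a E_(n+1)(s)\<close>, so inductively
  each is quasi-periodic of exponential type too small to be nonzero; therefore \<open>\<Lambda>\<close> kills all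
  polynomials. Off the closed annulus the resolvent is given by Neumann series, because the norm of
  composition with \<open>\<phi>^n\<close> is \<open>O(e^(|n \<tau>| / p))\<close>. So every nonzero functional has the closed annulus
  as its local spectrum, and each local spectral subspace is \<open>0\<close> or everything.\<close>

text \<open>The number 1/p enters twice, for different reasons, and property (C) rests on the
  agreement of the two values. For the eigenfunctions: |u|^x is dominated by a harmonic function
  when |x| < 1, so u^s lies in H^p once |Re s| < 1/p. For the norms: subordination bounds
  composition with psi by ((1 + |psi(0)|) / (1 - |psi(0)|))^(1/p), and flowing for time x moves 0 no
  closer to the circle than a constant times e^(-|x|). Hence the annulus of eigenvalues is dense in
  the complement of the region where the Neumann series converge.

  The delicate point is that a functional killing every u^s vanishes. A shift of s by 1 generally
  leaves the strip of width 2/p. Each factor q cancels one power of u at zeta2, so u^s q^n is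
  admissible up to Re s < n + 1/p and the shift becomes available. Nonzero quasi-periodic functions
  are then excluded by comparing angles: |arg u| < pi/2 limits the growth in Im s to type pi/2, and
  Re a = 1/2 gives |arg a| < pi/2; together these stay strictly within one period of exp(2 pi i
  s).\<close>

section \<open>Poisson integrals and circle means\<close>

text \<open>The constant depends only on the bound and the radius, so the estimate is uniform over
  families with a common bound. This is what turns pointwise derivatives into derivatives in the
  norms of H^p and of its dual.\<close>

lemma holomorphic_difference_quotient_bound:
  fixes f :: "complex \<Rightarrow> complex"
  assumes hol: "f holomorphic_on ball z0 r" and r: "r > 0"
    and B: "\<And>z. z \<in> ball z0 r \<Longrightarrow> cmod (f z) \<le> B"
    and D: "(f has_field_derivative D) (at z0)"
    and w: "dist z0 w < r / 2" "w \<noteq> z0"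
  shows "cmod ((f w - f z0) / (w - z0) - D) \<le> 32 * B / r\<^sup>2 * dist z0 w"
proof -
  define S where "S = ball z0 (r/2)"
  have sub: "cball x (r/4) \<subseteq> ball z0 r" if "x \<in> S" for x
  proof
    fix y assume "y \<in> cball x (r/4)"
    then show "y \<in> ball z0 r" using that r dist_triangle[of z0 y x] by (auto simp: S_def)
  qed
  have b2: "cmod ((deriv ^^ 2) f x) \<le> 32 * B / r\<^sup>2" if "x \<in> S" for x
  proof -
    \<comment> \<open>Discs of radius r/4 around points of the half ball stay in the ball, and 2! /
      (r/4)^2 = 32 / r^2.\<close>
    have "cmod ((deriv ^^ 2) f x) \<le> fact 2 * B / (r/4)^2"
    proof (rule Cauchy_inequality)
      show "f holomorphic_on ball x (r/4)"
        using sub[OF that] hol by (meson ball_subset_cball holomorphic_on_subset order_trans)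
      show "continuous_on (cball x (r/4)) f"
        using sub[OF that] hol by (meson holomorphic_on_imp_continuous_on holomorphic_on_subset)
      show "0 < r/4" using r by simp
      fix y assume "cmod (x - y) = r/4"
      then have "y \<in> cball x (r/4)" by (simp add: dist_norm)
      then show "cmod (f y) \<le> B" using sub[OF that] B by auto
    qed
    then show ?thesis by (simp add: power_divide fact_numeral field_simps)
  qed
  have der: "((deriv ^^ i) f has_field_derivative (deriv ^^ Suc i) f x) (at x within S)" if "x \<in> S" for i x
  proof -
    have "(deriv ^^ i) f holomorphic_on ball z0 r" using hol by (intro holomorphic_higher_deriv) auto
    moreover have "x \<in> ball z0 r" using that r by (auto simp: S_def)
    ultimately show ?thesis
      using holomorphic_derivI[of "(deriv ^^ i) f" "ball z0 r" x S] by simp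
  qed
  have "cmod ((deriv ^^ 0) f w - (\<Sum>i\<le>1. (deriv ^^ i) f z0 * (w - z0) ^ i / fact i))
      \<le> 32 * B / r\<^sup>2 * cmod (w - z0)^Suc 1 / fact 1"
  proof (rule complex_Taylor[of S])
    show "convex S" by (simp add: S_def)
    show "w \<in> S" "z0 \<in> S" using w r by (auto simp: S_def)
    show "cmod ((deriv ^^ Suc 1) f x) \<le> 32 * B / r\<^sup>2" if "x \<in> S" for x
      using b2[OF that] by (simp add: numeral_2_eq_2)
  qed (use der in auto)
  then have "cmod (f w - f z0 - D * (w - z0)) \<le> 32 * B / r\<^sup>2 * (cmod (w - z0))\<^sup>2"
    using DERIV_imp_deriv[OF D] by (simp add: power2_eq_square algebra_simps)
  moreover have "(f w - f z0) / (w - z0) - D = (f w - f z0 - D * (w - z0)) / (w - z0)"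
    using w by (simp add: field_simps)
  ultimately show ?thesis using w
    by (simp add: norm_divide divide_le_eq power2_eq_square dist_norm norm_minus_commute mult.assoc)
qed

section \<open>The Poisson kernel: reproduction, mass and harmonicity\<close>

definition poisson_kernel :: "real \<Rightarrow> complex \<Rightarrow> real \<Rightarrow> real" where
  "poisson_kernel R z \<theta> = (R\<^sup>2 - (cmod z)\<^sup>2) / (cmod (of_real R * cis \<theta> - z))\<^sup>2"

lemma circle_neq: "cmod z < R \<Longrightarrow> of_real R * cis \<theta> \<noteq> z"
  by (auto simp: norm_mult)

lemma poisson_kernel_pos: "cmod z < R \<Longrightarrow> poisson_kernel R z \<theta> > 0"
  using circle_neq[of z R \<theta>] power_strict_mono[of "cmod z" R 2]
  by (auto simp: poisson_kernel_def intro!: divide_pos_pos)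

lemma poisson_kernel_le:
  assumes "cmod z < R"
  shows "poisson_kernel R z \<theta> \<le> (R + cmod z) / (R - cmod z)"
proof -
  have "R - cmod z \<le> cmod (of_real R * cis \<theta> - z)"
    using norm_triangle_ineq2[of "of_real R * cis \<theta>" z] assms norm_ge_zero[of z]
    by (simp add: norm_mult)
  then have "(R - cmod z)\<^sup>2 \<le> (cmod (of_real R * cis \<theta> - z))\<^sup>2"
    using assms by (intro power_mono) auto
  then have "poisson_kernel R z \<theta> \<le> (R\<^sup>2 - (cmod z)\<^sup>2) / (R - cmod z)\<^sup>2"
    unfolding poisson_kernel_def using assms power_strict_mono[of "cmod z" R 2]
    by (intro divide_left_mono mult_pos_pos) (auto simp: circle_neq)
  also have "\<dots> = (R + cmod z) / (R - cmod z)"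
  proof -
    have "R\<^sup>2 - (cmod z)\<^sup>2 = (R - cmod z) * (R + cmod z)"
      by (simp add: power2_eq_square algebra_simps)
    then show ?thesis using assms by (simp add: power2_eq_square)
  qed
  finally show ?thesis .
qed

lemma continuous_on_poisson_kernel:
  assumes "continuous_on A f" "continuous_on A g" "\<And>x. x \<in> A \<Longrightarrow> cmod (f x) < R"
  shows "continuous_on A (\<lambda>x. poisson_kernel R (f x) (g x))"
  unfolding poisson_kernel_def
  using assms circle_neq by (intro continuous_intros) (auto simp: cis_conv_exp intro!: continuous_intros)

text \<open>The kernel appears on applying Cauchy's formula to
  \<open>w \<mapsto> f w (R\<^sup>2 - |z|\<^sup>2) / (R\<^sup>2 - cnj z w)\<close>, which agrees with \<open>f\<close> at \<open>z\<close>.\<close>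

lemma poisson_integral:
  fixes f :: "complex \<Rightarrow> complex"
  assumes hol: "f holomorphic_on cball 0 R" and z: "cmod z < R"
  shows "((\<lambda>\<theta>. of_real (poisson_kernel R z \<theta>) * f (of_real R * cis \<theta>)) has_integral 2 * pi * f z) {0..2*pi}"
proof -
  have R: "R > 0" using z norm_ge_zero[of z] by linarith
  have nz: "of_real (R\<^sup>2) - cnj z * w \<noteq> 0" if "w \<in> cball 0 R" for w
  proof
    assume "of_real (R\<^sup>2) - cnj z * w = 0"
    then have "cmod (cnj z * w) = cmod (of_real (R\<^sup>2))" by simp
    then have "cmod z * cmod w = R\<^sup>2" by (simp only: norm_mult complex_mod_cnj norm_of_real) simp
    moreover have "cmod z * cmod w \<le> cmod z * R" using that by (intro mult_left_mono) auto
    moreover have "cmod z * R < R * R" using z R by simp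
    ultimately show False by (simp add: power2_eq_square)
  qed
  define h where "h = (\<lambda>w. f w * of_real (R\<^sup>2 - (cmod z)\<^sup>2) / (of_real (R\<^sup>2) - cnj z * w))"
  have "h holomorphic_on cball 0 R"
    unfolding h_def using nz by (intro holomorphic_intros hol) auto
  then have "((\<lambda>u. h u / (u - z)) has_contour_integral (2 * of_real pi * \<i> * h z)) (circlepath 0 R)"
    using z by (intro Cauchy_integral_circlepath_simple) auto
  then have I: "((\<lambda>t. h (of_real R * cis t) / (of_real R * cis t - z) * R * \<i> * cis t) has_integral
      (2 * of_real pi * \<i> * h z)) {0..2*pi}"
    unfolding circlepath_def by (subst (asm) has_contour_integral_part_circlepath_iff) auto
  have zz: "of_real (R\<^sup>2) - cnj z * z = of_real (R\<^sup>2 - (cmod z)\<^sup>2)"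
    by (simp add: complex_norm_square[symmetric] mult.commute[of "cnj z"] del: of_real_power)
  have hz: "h z = f z"
    using nz[of z] z unfolding h_def zz by (simp del: of_real_diff of_real_power)
  have "h (of_real R * cis t) / (of_real R * cis t - z) * R * \<i> * cis t
      = \<i> * (of_real (poisson_kernel R z t) * f (of_real R * cis t))" for t
  proof -
    define w where "w = of_real R * cis t"
    have w0: "w \<noteq> z" "w \<in> cball 0 R" using circle_neq[OF z] R by (auto simp: w_def norm_mult)
    have "cmod w = R" using R by (simp add: w_def norm_mult)
    then have "of_real (R\<^sup>2) = w * cnj w" by (metis complex_norm_square)
    then have e: "of_real (R\<^sup>2) - cnj z * w = w * cnj (w - z)" by (simp add: algebra_simps)
    have "w \<noteq> 0" using R by (simp add: w_def)
    have "h w / (w - z) * w = f w * of_real (R\<^sup>2 - (cmod z)\<^sup>2) / ((w - z) * cnj (w - z))"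
    proof -
      have "x / (w * c) / d * w = x / (d * c)" for x c d :: complex
        using \<open>w \<noteq> 0\<close> by (simp add: divide_simps)
      then show ?thesis unfolding h_def e .
    qed
    also have "\<dots> = of_real (poisson_kernel R z t) * f w"
      unfolding poisson_kernel_def w_def[symmetric] of_real_divide complex_norm_square[of "w - z"] by simp
    finally have "h w / (w - z) * w = of_real (poisson_kernel R z t) * f w" .
    moreover have "h w / (w - z) * R * \<i> * cis t = \<i> * (h w / (w - z) * w)"
      by (simp add: w_def)
    ultimately show ?thesis by (simp only: w_def)
  qed
  then have "((\<lambda>t. \<i> * (of_real (poisson_kernel R z t) * f (of_real R * cis t))) has_integral
      \<i> * (2 * pi * f z)) {0..2*pi}" using I hz by (simp add: mult_ac)
  from has_integral_mult_right[OF this, of "-\<i>"] show ?thesis by (simp add: mult.assoc[symmetric])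
qed

lemma mean_value_circle:
  fixes f :: "complex \<Rightarrow> complex"
  assumes hol: "f holomorphic_on cball 0 R" and R: "R \<ge> 0"
  shows "((\<lambda>\<theta>. f (of_real R * cis \<theta>)) has_integral 2 * pi * f 0) {0..2*pi}"
proof (cases "R = 0")
  case True
  then show ?thesis using has_integral_const_real[of "f 0" 0 "2*pi"] by (simp add: scaleR_conv_of_real)
next
  case False
  have "poisson_kernel R 0 \<theta> = 1" for \<theta> using False R by (simp add: poisson_kernel_def norm_mult)
  then show ?thesis using poisson_integral[OF hol, of 0] False R by simp
qed

lemma poisson_kernel_mass:
  assumes "cmod z < R"
  shows "(poisson_kernel R z has_integral 2 * pi) {0..2*pi}"
proof -
  from has_integral_linear[OF poisson_integral[of "\<lambda>_. 1", OF _ assms] bounded_linear_Re]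
  show ?thesis by (simp add: o_def)
qed

text \<open>Harmonicity of the kernel in \<open>z\<close>: as the real part of a holomorphic
  function it keeps the mean value property after composition with a holomorphic map, which
  \<open>poisson_kernel_mean\<close> uses.\<close>

lemma poisson_kernel_eq_Re:
  assumes "cmod z < R"
  shows "poisson_kernel R z \<theta> = Re ((of_real R * cis \<theta> + z) / (of_real R * cis \<theta> - z))"
proof -
  define w where "w = of_real R * cis \<theta>"
  have R: "R > 0" using assms norm_ge_zero[of z] by linarith
  have cw: "R\<^sup>2 = (cmod w)\<^sup>2" using R by (simp add: w_def norm_mult)
  show ?thesis unfolding poisson_kernel_def w_def[symmetric] cw
    by (simp add: Re_divide cmod_power2)
       (simp add: power2_eq_square algebra_simps)
qed

lemma Re_complex_of_real_times: "Re (of_real c * z) = c * Re z"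
  by simp

lemma poisson_kernel_mean:
  assumes hol: "\<psi> holomorphic_on cball 0 r" and r: "r \<ge> 0"
    and lt: "\<And>z. z \<in> cball 0 r \<Longrightarrow> cmod (\<psi> z) < R"
  shows "((\<lambda>t. poisson_kernel R (\<psi> (of_real r * cis t)) \<theta>) has_integral 2 * pi * poisson_kernel R (\<psi> 0) \<theta>) {0..2*pi}"
proof -
  define w where "w = of_real R * cis \<theta>"
  have "(\<lambda>z. (w + \<psi> z) / (w - \<psi> z)) holomorphic_on cball 0 r"
    using circle_neq[OF lt] by (intro holomorphic_intros hol) (auto simp: w_def)
  from has_integral_linear[OF mean_value_circle[OF this r] bounded_linear_Re]
  have "((\<lambda>t. Re ((w + \<psi> (of_real r * cis t)) / (w - \<psi> (of_real r * cis t)))) has_integral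
       2 * pi * Re ((w + \<psi> 0) / (w - \<psi> 0))) {0..2*pi}"
    unfolding o_def of_real_mult[symmetric] Re_complex_of_real_times by simp
  then show ?thesis
    using r by (simp add: w_def poisson_kernel_eq_Re[OF lt] norm_mult)
qed

section \<open>Convexity of powers and Jensen's inequality for Poisson integrals\<close>

lemma powr_above_tangent_strict:
  fixes p a t :: real
  assumes p: "1 < p" and a: "0 < a" and t: "0 \<le> t" "t \<noteq> a"
  shows "a powr p + p * a powr (p - 1) * (t - a) < t powr p"
\<comment> \<open>The derivative of \<open>powr\<close> is used only at positive arguments, so the
  endpoint is computed directly and the mean value theorem handles the rest.\<close>
proof (cases "t = 0")
  case True
  have "a powr (p - 1) * a = a powr p" using a by (simp add: powr_diff)
  then have "a powr p + p * a powr (p - 1) * (t - a) = a powr p * (1 - p)"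
    using True by (simp add: algebra_simps)
  then show ?thesis using True p a by (simp add: mult_pos_neg)
next
  case False
  then have t0: "t > 0" using t by simp
  have der: "((\<lambda>x. x powr p) has_real_derivative p * x powr (p - 1)) (at x)" if "x > 0" for x
    using that by (auto intro!: derivative_eq_intros)
  show ?thesis
  proof (cases "t < a")
    case True
    obtain c where c: "t < c" "c < a" "a powr p - t powr p = (a - t) * (p * c powr (p - 1))"
      using MVT2[of t a "\<lambda>x. x powr p" "\<lambda>x. p * x powr (p - 1)"] True der t0 by force
    have "c powr (p - 1) < a powr (p - 1)" using c t0 p by (intro powr_less_mono2) auto
    then have "(a - t) * (p * c powr (p - 1)) < (a - t) * (p * a powr (p - 1))"
      using p True by simp
    then show ?thesis using c(3) by (simp add: algebra_simps)
  next
    case False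
    then have "a < t" using t by simp
    then obtain c where c: "a < c" "c < t" "t powr p - a powr p = (t - a) * (p * c powr (p - 1))"
      using MVT2[of a t "\<lambda>x. x powr p" "\<lambda>x. p * x powr (p - 1)"] der a by force
    have "a powr (p - 1) < c powr (p - 1)" using c a p by (intro powr_less_mono2) auto
    then have "(t - a) * (p * a powr (p - 1)) < (t - a) * (p * c powr (p - 1))"
      using p \<open>a < t\<close> by simp
    then show ?thesis using c(3) by (simp add: algebra_simps)
  qed
qed

lemma powr_above_tangent:
  fixes p a t :: real
  assumes "1 \<le> p" "0 < a" "0 \<le> t"
  shows "a powr p + p * a powr (p - 1) * (t - a) \<le> t powr p"
proof (cases "p = 1 \<or> t = a")
  case True
  then show ?thesis using assms by auto
next
  case False
  then show ?thesis using powr_above_tangent_strict[of p a t] assms by simp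
qed

lemma continuous_on_circle:
  assumes "continuous_on (cball 0 R) f" "R \<ge> 0"
  shows "continuous_on S (\<lambda>\<theta>. f (of_real R * cis \<theta>))"
  using assms by (intro continuous_on_compose2[OF assms(1)])
    (auto simp: cis_conv_exp norm_mult intro!: continuous_intros)

lemma continuous_on_circle_powr:
  assumes "continuous_on (cball 0 R) f" "R \<ge> 0" "0 < p"
  shows "continuous_on S (\<lambda>\<theta>. cmod (f (of_real R * cis \<theta>)) powr p)"
  using assms by (intro continuous_on_powr' continuous_intros continuous_on_circle) auto

text \<open>Jensen's inequality with the kernel as probability density: the tangent line of t^p at
  |f z| is integrated against it. The slope is nonnegative, so |f z| may be replaced by the larger
  Poisson integral of |f|.\<close>

lemma poisson_integral_powr:
  fixes f :: "complex \<Rightarrow> complex"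
  assumes p: "1 \<le> p" and hol: "f holomorphic_on cball 0 R" and z: "cmod z < R"
  shows "2 * pi * cmod (f z) powr p \<le>
    integral {0..2*pi} (\<lambda>\<theta>. poisson_kernel R z \<theta> * cmod (f (of_real R * cis \<theta>)) powr p)"
proof -
  have R: "R \<ge> 0" using z norm_ge_zero[of z] by linarith
  let ?P = "poisson_kernel R z" and ?f = "\<lambda>\<theta>. f (of_real R * cis \<theta>)"
  have cf: "continuous_on (cball 0 R) f" using hol holomorphic_on_imp_continuous_on by blast
  have Pc: "continuous_on {0..2*pi} ?P"
    using z by (intro continuous_on_poisson_kernel continuous_intros)
  have P0: "?P \<theta> \<ge> 0" for \<theta> using poisson_kernel_pos[OF z, of \<theta>] by simp
  have c1: "continuous_on {0..2*pi} (\<lambda>\<theta>. ?P \<theta> * cmod (?f \<theta>))"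
    by (intro continuous_intros Pc continuous_on_circle cf R)
  have c2: "continuous_on {0..2*pi} (\<lambda>\<theta>. ?P \<theta> * cmod (?f \<theta>) powr p)"
    using p by (intro continuous_intros Pc continuous_on_circle_powr cf R) auto
  show ?thesis
  proof (cases "f z = 0")
    case True
    then show ?thesis using c2 P0
      by (auto intro!: integral_nonneg integrable_continuous_real)
  next
    case False
    define a where "a = cmod (f z)"
    have a: "a > 0" using False by (simp add: a_def)
    note I = poisson_integral[OF hol z]
    have "cmod (integral {0..2*pi} (\<lambda>\<theta>. of_real (?P \<theta>) * ?f \<theta>)) \<le> integral {0..2*pi} (\<lambda>\<theta>. ?P \<theta> * cmod (?f \<theta>))"
      using P0 by (intro integral_norm_bound_integral integrable_continuous_real[OF c1] has_integral_integrable[OF I])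
        (auto simp: norm_mult)
    then have l: "2 * pi * a \<le> integral {0..2*pi} (\<lambda>\<theta>. ?P \<theta> * cmod (?f \<theta>))"
      using integral_unique[OF I] by (simp add: a_def norm_mult)
    \<comment> \<open>Intercept and slope of the tangent line to t^p at \<open>a\<close>.\<close>
    define A where "A = a powr p - p * a powr (p - 1) * a"
    define B where "B = p * a powr (p - 1)"
    have B0: "B \<ge> 0" using p by (simp add: B_def)
    have J: "((\<lambda>\<theta>. A * ?P \<theta> + B * (?P \<theta> * cmod (?f \<theta>))) has_integral
       A * (2*pi) + B * integral {0..2*pi} (\<lambda>\<theta>. ?P \<theta> * cmod (?f \<theta>))) {0..2*pi}"
      by (intro has_integral_add has_integral_mult_right poisson_kernel_mass z integrable_integral
        integrable_continuous_real c1)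
    have "2 * pi * a powr p = A * (2*pi) + B * (2 * pi * a)" by (simp add: A_def B_def algebra_simps)
    also have "\<dots> \<le> A * (2*pi) + B * integral {0..2*pi} (\<lambda>\<theta>. ?P \<theta> * cmod (?f \<theta>))"
      using l B0 by (intro add_left_mono mult_left_mono)
    also have "\<dots> \<le> integral {0..2*pi} (\<lambda>\<theta>. ?P \<theta> * cmod (?f \<theta>) powr p)"
    proof (rule has_integral_le[OF J integrable_integral[OF integrable_continuous_real[OF c2]]])
      fix \<theta>
      have "A + B * cmod (?f \<theta>) \<le> cmod (?f \<theta>) powr p"
        using powr_above_tangent[OF p a, of "cmod (?f \<theta>)"] by (simp add: A_def B_def algebra_simps)
      from mult_left_mono[OF this P0[of \<theta>]]
      show "A * ?P \<theta> + B * (?P \<theta> * cmod (?f \<theta>)) \<le> ?P \<theta> * cmod (?f \<theta>) powr p"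
        by (simp add: algebra_simps)
    qed
    finally show ?thesis by (simp add: a_def)
  qed
qed

text \<open>Littlewood subordination, quantitatively: \<open>|f|^p\<close> lies below its Poisson integral, and the
  Poisson kernel composed with \<open>\<psi>\<close> is harmonic, so its circle mean is its value at \<open>\<psi> 0\<close>.\<close>

lemma integral_mean_compose_le:
  assumes p: "1 \<le> p" and holf: "f holomorphic_on cball 0 R"
    and hol: "\<psi> holomorphic_on cball 0 r" and r: "r \<ge> 0"
    and lt: "\<And>z. z \<in> cball 0 r \<Longrightarrow> cmod (\<psi> z) < R"
  shows "integral_mean p (\<lambda>z. f (\<psi> z)) r \<le> (R + cmod (\<psi> 0)) / (R - cmod (\<psi> 0)) * integral_mean p f R"
proof -
  have R: "R \<ge> 0" using order.strict_trans1[OF norm_ge_zero lt[of 0]] r by simp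
  let ?I = "{0..2*pi}"
  define g where "g = (\<lambda>\<theta>. cmod (f (of_real R * cis \<theta>)) powr p)"
  define v where "v = (\<lambda>t. \<psi> (of_real r * cis t))"
  have v: "cmod (v t) < R" for t using lt r by (simp add: v_def norm_mult)
  have cf: "continuous_on (cball 0 R) f" using holf holomorphic_on_imp_continuous_on by blast
  have cpsi: "continuous_on (cball 0 r) \<psi>" using hol holomorphic_on_imp_continuous_on by blast
  have gc: "continuous_on S g" for S
    unfolding g_def using p R cf by (intro continuous_on_circle_powr) auto
  have vc: "continuous_on S v" for S
    unfolding v_def by (intro continuous_on_circle cpsi r)
  have c2: "continuous_on (cbox (0,0) (2*pi,2*pi)) (\<lambda>(t,\<theta>). poisson_kernel R (v t) \<theta> * g \<theta>)"
    unfolding split_def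
    by (intro continuous_intros continuous_on_poisson_kernel v
         continuous_on_compose2[OF gc[of UNIV]] continuous_on_compose2[OF vc[of UNIV]]) auto
  have g0: "g \<theta> \<ge> 0" for \<theta> by (simp add: g_def)
  define K where "K = (R + cmod (\<psi> 0)) / (R - cmod (\<psi> 0))"
  have cfv: "continuous_on ?I (\<lambda>t. cmod (f (v t)) powr p)"
    using p less_imp_le[OF v] by (intro continuous_on_powr' continuous_intros continuous_on_compose2[OF cf vc]) auto
  have c3: "continuous_on ?I (\<lambda>t. integral ?I (\<lambda>\<theta>. poisson_kernel R (v t) \<theta> * g \<theta>))"
    using integral_continuous_on_param[of ?I 0 "2*pi" "\<lambda>t \<theta>. poisson_kernel R (v t) \<theta> * g \<theta>"]
    c2 by (simp add: cbox_Pair_eq)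
  have "2 * pi * integral ?I (\<lambda>t. cmod (f (v t)) powr p) = integral ?I (\<lambda>t. 2 * pi * cmod (f (v t)) powr p)"
    by simp
  also have "\<dots> \<le> integral ?I (\<lambda>t. integral ?I (\<lambda>\<theta>. poisson_kernel R (v t) \<theta> * g \<theta>))"
    using cfv c3 poisson_integral_powr[OF p holf v]
    by (intro integral_le integrable_continuous_real continuous_on_mult_left) (auto simp: g_def)
  also have "\<dots> = integral ?I (\<lambda>\<theta>. integral ?I (\<lambda>t. poisson_kernel R (v t) \<theta> * g \<theta>))"
    using integral_swap_continuous[OF c2] by simp
  also have "\<dots> = integral ?I (\<lambda>\<theta>. 2 * pi * poisson_kernel R (\<psi> 0) \<theta> * g \<theta>)"
    using has_integral_mult_left[OF poisson_kernel_mean[OF hol r lt]]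
    unfolding v_def by (intro integral_cong integral_unique) blast
  also have "\<dots> \<le> integral ?I (\<lambda>\<theta>. 2 * pi * K * g \<theta>)"
    using g0 poisson_kernel_le[OF lt[of 0]] r lt[of 0]
    by (intro integral_le integrable_continuous_real mult_right_mono mult_left_mono
         continuous_intros gc continuous_on_poisson_kernel) (auto simp: K_def)
  also have "\<dots> = 2 * pi * K * integral ?I g" by simp
  finally have "integral ?I (\<lambda>t. cmod (f (v t)) powr p) \<le> K * integral ?I g"
    by simp
  from divide_right_mono[OF this, of "2*pi"] show ?thesis
    unfolding K_def[symmetric] by (simp add: integral_mean_def g_def v_def)
qed

text \<open>Subordination by the identity, whose constant is 1 because it fixes 0. Equal radii are
  separate because subordination asks for a strictly larger outer radius.\<close>

lemma integral_mean_mono: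
  assumes "1 \<le> p" "f holomorphic_on cball 0 R" "0 \<le> r" "r \<le> R"
  shows "integral_mean p f r \<le> integral_mean p f R"
proof (cases "r = R")
  case False
  then show ?thesis using integral_mean_compose_le[of p f R "\<lambda>z. z" r] assms by auto
qed auto

section \<open>The Hardy space\<close>

lemma hardy_holomorphic: "f \<in> hardy p \<Longrightarrow> f holomorphic_on ball 0 1"
  and hardy_outside: "f \<in> hardy p \<Longrightarrow> z \<notin> ball 0 1 \<Longrightarrow> f z = 0"
  and hardy_bdd_above: "f \<in> hardy p \<Longrightarrow> bdd_above (integral_mean p f ` {0..<1})"
  by (auto simp: hardy_def)

lemma continuous_on_circle_disc:
  assumes "f holomorphic_on ball 0 1" "r \<in> {0..<1}" "0 < p"
  shows "continuous_on S (\<lambda>\<theta>. cmod (f (of_real r * cis \<theta>)) powr p)"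
  using assms holomorphic_on_imp_continuous_on[of f "ball 0 1"]
  by (intro continuous_on_circle_powr) (auto intro: continuous_on_subset)

lemma integral_mean_le_mean:
  assumes "f holomorphic_on ball 0 1" "r \<in> {0..<1}" "0 < p"
    and "(g has_integral 2 * pi * B) {0..2*pi}"
    and "\<And>\<theta>. cmod (f (of_real r * cis \<theta>)) powr p \<le> g \<theta>"
  shows "integral_mean p f r \<le> B"
proof -
  have "integral {0..2*pi} (\<lambda>\<theta>. cmod (f (of_real r * cis \<theta>)) powr p) \<le> 2 * pi * B"
    by (rule has_integral_le[OF integrable_integral[OF integrable_continuous_real] assms(4)])
       (use assms continuous_on_circle_disc in auto)
  then show ?thesis by (simp add: integral_mean_def field_simps)
qed

lemma has_integral_integral_mean:
  assumes "f holomorphic_on ball 0 1" "r \<in> {0..<1}" "0 < p"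
  shows "((\<lambda>\<theta>. cmod (f (of_real r * cis \<theta>)) powr p) has_integral 2 * pi * integral_mean p f r) {0..2*pi}"
  using integrable_integral[OF integrable_continuous_real[OF continuous_on_circle_disc[OF assms]]]
  by (simp add: integral_mean_def)

text \<open>True for every \<open>f\<close>: an integral that does not exist has the value
  0.\<close>

lemma integral_mean_nonneg: "integral_mean p f r \<ge> 0"
  by (cases "(\<lambda>\<theta>. cmod (f (of_real r * cis \<theta>)) powr p) integrable_on {0..2*pi}")
     (auto simp: integral_mean_def not_integrable_integral intro!: divide_nonneg_nonneg integral_nonneg)

lemma hp_norm_nonneg: "hp_norm p f \<ge> 0"
  by (simp add: hp_norm_def)

lemma integral_mean_le_hp_norm:
  assumes "0 < p" "f \<in> hardy p" "r \<in> {0..<1}"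
  shows "integral_mean p f r \<le> hp_norm p f powr p"
proof -
  have "integral_mean p f r \<le> (SUP r\<in>{0..<1}. integral_mean p f r)"
    using assms hardy_bdd_above by (intro cSUP_upper) auto
  moreover from this have "(SUP r\<in>{0..<1}. integral_mean p f r) \<ge> 0"
    using integral_mean_nonneg order_trans by blast
  ultimately show ?thesis using assms by (simp add: hp_norm_def powr_powr)
qed

lemma hp_norm_le:
  assumes "0 < p" "0 \<le> B" "\<And>r. r \<in> {0..<1} \<Longrightarrow> integral_mean p f r \<le> B powr p"
  shows "hp_norm p f \<le> B"
proof -
  let ?S = "SUP r\<in>{0..<1}. integral_mean p f r"
  have "?S \<le> B powr p" using assms by (intro cSUP_least) auto
  moreover have "integral_mean p f 0 \<le> ?S"
    by (intro cSUP_upper bdd_aboveI2[of _ _ "B powr p"]) (use assms in auto)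
  then have "0 \<le> ?S" using integral_mean_nonneg order_trans by blast
  ultimately have "?S powr (1/p) \<le> (B powr p) powr (1/p)"
    using assms by (intro powr_mono2) auto
  then show ?thesis using assms by (simp add: hp_norm_def powr_powr)
qed

lemma hardyI:
  assumes "f holomorphic_on ball 0 1" "\<And>z. z \<notin> ball 0 1 \<Longrightarrow> f z = 0"
    and "\<And>r. r \<in> {0..<1} \<Longrightarrow> integral_mean p f r \<le> B"
  shows "f \<in> hardy p"
  using assms unfolding hardy_def by (auto intro!: bdd_aboveI2[of _ _ B])

lemma hardy_cmult_le:
  assumes p: "0 < p" and f: "f \<in> hardy p"
  shows "(\<lambda>t. c * f t) \<in> hardy p \<and> hp_norm p (\<lambda>t. c * f t) \<le> cmod c * hp_norm p f"
proof -
  have m: "integral_mean p (\<lambda>t. c * f t) r \<le> (cmod c * hp_norm p f) powr p" if "r \<in> {0..<1}" for r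
  proof -
    have "integral_mean p (\<lambda>t. c * f t) r = cmod c powr p * integral_mean p f r"
      by (simp add: integral_mean_def norm_mult powr_mult)
    also have "\<dots> \<le> cmod c powr p * hp_norm p f powr p"
      using integral_mean_le_hp_norm[OF p f that] by (intro mult_left_mono) auto
    finally show ?thesis by (simp add: powr_mult hp_norm_nonneg)
  qed
  show ?thesis
  proof
    show "(\<lambda>t. c * f t) \<in> hardy p"
      using m by (intro hardyI) (auto intro!: holomorphic_intros hardy_holomorphic[OF f] hardy_outside[OF f])
    show "hp_norm p (\<lambda>t. c * f t) \<le> cmod c * hp_norm p f"
      using m p by (intro hp_norm_le) (auto simp: hp_norm_nonneg)
  qed
qed

lemma hardy_cmult: "0 < p \<Longrightarrow> f \<in> hardy p \<Longrightarrow> (\<lambda>t. c * f t) \<in> hardy p"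
  using hardy_cmult_le by blast

lemma powr_add_le:
  fixes x y p :: real
  assumes "0 \<le> x" "0 \<le> y" "0 < p"
  shows "(x + y) powr p \<le> 2 powr p * (x powr p + y powr p)"
proof -
  have "(x + y) powr p \<le> (2 * max x y) powr p" using assms by (intro powr_mono2) auto
  also have "\<dots> = 2 powr p * max x y powr p" using assms by (simp add: powr_mult)
  also have "max x y powr p \<le> x powr p + y powr p" by (simp add: max_def)
  finally show ?thesis by simp
qed

lemma hardy_add:
  assumes p: "0 < p" and f: "f \<in> hardy p" and g: "g \<in> hardy p"
  shows "(\<lambda>t. f t + g t) \<in> hardy p"
proof (rule hardyI)
  show "(\<lambda>t. f t + g t) holomorphic_on ball 0 1"
    by (intro holomorphic_intros hardy_holomorphic[OF f] hardy_holomorphic[OF g])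
  fix r :: real assume r: "r \<in> {0..<1}"
  show "integral_mean p (\<lambda>t. f t + g t) r \<le> 2 powr p * (hp_norm p f powr p + hp_norm p g powr p)"
  proof (rule order_trans[OF integral_mean_le_mean])
    show "((\<lambda>\<theta>. 2 powr p * (cmod (f (of_real r * cis \<theta>)) powr p + cmod (g (of_real r * cis \<theta>)) powr p))
      has_integral 2 * pi * (2 powr p * (integral_mean p f r + integral_mean p g r))) {0..2*pi}"
      using has_integral_mult_right[OF has_integral_add[OF has_integral_integral_mean[OF hardy_holomorphic[OF f] r p]
          has_integral_integral_mean[OF hardy_holomorphic[OF g] r p]], of "2 powr p"]
      by (simp add: algebra_simps)
    show "cmod (f (of_real r * cis \<theta>) + g (of_real r * cis \<theta>)) powr p \<le>
        2 powr p * (cmod (f (of_real r * cis \<theta>)) powr p + cmod (g (of_real r * cis \<theta>)) powr p)" for \<theta>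
      using p by (intro order_trans[OF powr_mono2 powr_add_le]) (auto simp: norm_triangle_ineq)
    show "2 powr p * (integral_mean p f r + integral_mean p g r) \<le> 2 powr p * (hp_norm p f powr p + hp_norm p g powr p)"
      using integral_mean_le_hp_norm[OF p f r] integral_mean_le_hp_norm[OF p g r] by simp
  qed (use p r in \<open>auto intro!: holomorphic_intros hardy_holomorphic[OF f] hardy_holomorphic[OF g]\<close>)
qed (use hardy_outside[OF f] hardy_outside[OF g] in auto)

lemma hardy_diff:
  assumes p: "0 < p" and f: "f \<in> hardy p" and g: "g \<in> hardy p"
  shows "(\<lambda>t. f t - g t) \<in> hardy p"
  using hardy_add[OF p f hardy_cmult[OF p g, of "-1"]] by simp

section \<open>Extension by zero, bounded functions and composition\<close>

definition on_disc :: "(complex \<Rightarrow> complex) \<Rightarrow> complex \<Rightarrow> complex" where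
  "on_disc f = (\<lambda>z. if z \<in> ball 0 1 then f z else 0)"

lemma on_disc_simps [simp]:
  "z \<in> ball 0 1 \<Longrightarrow> on_disc f z = f z" "z \<notin> ball 0 1 \<Longrightarrow> on_disc f z = 0"
  by (auto simp: on_disc_def)

lemma on_disc_hardy: "f \<in> hardy p \<Longrightarrow> on_disc f = f"
  using hardy_outside[of f p] by (auto simp: on_disc_def)

lemma holomorphic_on_disc: "f holomorphic_on ball 0 1 \<Longrightarrow> on_disc f holomorphic_on ball 0 1"
  by (rule holomorphic_transform) auto

lemma comp_op_eq_on_disc: "comp_op \<phi> f = on_disc (\<lambda>z. f (\<phi> z))"
  by (auto simp: comp_op_def on_disc_def)

lemma circle_in_disc: "r \<in> {0..<1} \<Longrightarrow> of_real r * cis \<theta> \<in> ball 0 1"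
  by (simp add: norm_mult)

lemma integral_mean_on_disc: "r \<in> {0..<1} \<Longrightarrow> integral_mean p (on_disc f) r = integral_mean p f r"
  using circle_in_disc[of r] by (simp add: integral_mean_def on_disc_def)

lemma hardy_bounded:
  assumes p: "0 < p" and hol: "f holomorphic_on ball 0 1" and B: "\<And>z. z \<in> ball 0 1 \<Longrightarrow> cmod (f z) \<le> B"
  shows "on_disc f \<in> hardy p \<and> hp_norm p (on_disc f) \<le> B"
proof -
  have B0: "B \<ge> 0" using order_trans[OF norm_ge_zero B[of 0]] by simp
  have m: "integral_mean p (on_disc f) r \<le> B powr p" if r: "r \<in> {0..<1}" for r
  proof (rule integral_mean_le_mean[OF holomorphic_on_disc[OF hol] r p])
    show "((\<lambda>_. B powr p) has_integral 2 * pi * B powr p) {0..2 * pi}"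
      using has_integral_const_real[of "B powr p" 0 "2*pi"] by simp
    show "cmod (on_disc f (complex_of_real r * cis \<theta>)) powr p \<le> B powr p" for \<theta>
      using circle_in_disc[OF r, of \<theta>] B p by (intro powr_mono2) auto
  qed
  show ?thesis
    using m p B0 by (auto intro!: hardyI[OF holomorphic_on_disc[OF hol], of p "B powr p"] hp_norm_le)
qed

text \<open>The exponent 1/p on the distortion constant is the source of the radii e^(|tau|/p) and
  e^(-|tau|/p) of the spectral annulus.\<close>

lemma hardy_compose:
  assumes p: "1 \<le> p" and f: "f \<in> hardy p" and hol: "\<psi> holomorphic_on ball 0 1"
    and into: "\<And>z. z \<in> ball 0 1 \<Longrightarrow> \<psi> z \<in> ball 0 1"
  shows "comp_op \<psi> f \<in> hardy p \<and>
    hp_norm p (comp_op \<psi> f) \<le> ((1 + cmod (\<psi> 0)) / (1 - cmod (\<psi> 0))) powr (1 / p) * hp_norm p f"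
proof -
  let ?g = "\<lambda>z. f (\<psi> z)"
  have holg: "?g holomorphic_on ball 0 1"
    using holomorphic_on_compose_gen[OF hol hardy_holomorphic[OF f]] into by (force simp: o_def)
  let ?d = "cmod (\<psi> 0)"
  have d: "?d < 1" using into[of 0] by simp
  have m: "integral_mean p (comp_op \<psi> f) r \<le> (1 + ?d) / (1 - ?d) * hp_norm p f powr p" if r: "r \<in> {0..<1}" for r
  proof -
    have "continuous_on (cball 0 r) (\<lambda>z. cmod (\<psi> z))"
      using hol r by (intro continuous_intros holomorphic_on_imp_continuous_on) (auto elim!: holomorphic_on_subset)
    then obtain z0 where z0: "z0 \<in> cball 0 r" "\<And>z. z \<in> cball 0 r \<Longrightarrow> cmod (\<psi> z) \<le> cmod (\<psi> z0)"
      using continuous_attains_sup[of "cball 0 r" "\<lambda>z. cmod (\<psi> z)"] r by auto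
    \<comment> \<open>The image of the closed disc of radius \<open>r\<close> has maximal modulus
      \<open>R0\<close> < 1, so subordination applies for each R between \<open>R0\<close> and 1;
      letting R tend to 1 gives the constant.\<close>
    define R0 where "R0 = cmod (\<psi> z0)"
    have "z0 \<in> ball 0 1" using z0 r by auto
    then have R0: "R0 < 1" using into[of z0] by (simp add: R0_def)
    have le: "integral_mean p (comp_op \<psi> f) r \<le> (R + ?d) / (R - ?d) * hp_norm p f powr p" if R: "R0 < R" "R < 1" for R
    proof -
      have lt: "\<And>z. z \<in> cball 0 r \<Longrightarrow> cmod (\<psi> z) < R" using z0 R by (auto simp: R0_def intro: le_less_trans)
      have "?d < R" using lt[of 0] r by simp
      have "integral_mean p (comp_op \<psi> f) r = integral_mean p ?g r"
        using r by (simp add: comp_op_eq_on_disc integral_mean_on_disc)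
      also have "\<dots> \<le> (R + ?d) / (R - ?d) * integral_mean p f R"
        using hol hardy_holomorphic[OF f] R r
        by (intro integral_mean_compose_le p lt) (auto elim!: holomorphic_on_subset)
      also have "\<dots> \<le> (R + ?d) / (R - ?d) * hp_norm p f powr p"
        using \<open>?d < R\<close> order.trans[OF norm_ge_zero[of "\<psi> z0"]] R p f unfolding R0_def
        by (intro mult_left_mono integral_mean_le_hp_norm divide_nonneg_pos add_nonneg_nonneg)
          (auto intro: order.strict_implies_order le_less_trans)
      finally show ?thesis .
    qed
    have "((\<lambda>R. (R + ?d) / (R - ?d) * hp_norm p f powr p) \<longlongrightarrow> (1 + ?d) / (1 - ?d) * hp_norm p f powr p) (at_left 1)"
      using d by (intro tendsto_intros) auto
    moreover have "\<forall>\<^sub>F R in at_left 1. integral_mean p (comp_op \<psi> f) r \<le> (R + ?d) / (R - ?d) * hp_norm p f powr p"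
      using eventually_at_left_real[OF R0] by eventually_elim (use le in auto)
    ultimately show ?thesis by (intro tendsto_lowerbound[of _ _ "at_left 1"]) auto
  qed
  have e: "(((1 + ?d) / (1 - ?d)) powr (1/p) * hp_norm p f) powr p = (1 + ?d) / (1 - ?d) * hp_norm p f powr p"
    using p d by (simp add: powr_mult powr_powr hp_norm_nonneg)
  show ?thesis
  proof
    show "comp_op \<psi> f \<in> hardy p"
      using m unfolding comp_op_eq_on_disc by (intro hardyI holomorphic_on_disc holg) auto
    show "hp_norm p (comp_op \<psi> f) \<le> ((1 + ?d) / (1 - ?d)) powr (1 / p) * hp_norm p f"
      using m e p by (intro hp_norm_le) (auto simp: hp_norm_nonneg)
  qed
qed

text \<open>On one fixed circle the integrand is jointly continuous up to s = 1. The midpoint of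
  \<open>f\<close> and its dilate is the quantity on which uniform convexity acts.\<close>

lemma integral_mean_tendsto_dilation:
  assumes hol: "f holomorphic_on ball 0 1" and r: "r \<in> {0..<1}" and p: "0 < p"
  shows "((\<lambda>s. integral_mean p (\<lambda>z. (f z + f (of_real s * z)) / 2) r) \<longlongrightarrow> integral_mean p f r) (at_left 1)"
proof -
  have cf: "continuous_on (ball 0 1) f" using hol holomorphic_on_imp_continuous_on by blast
  let ?h = "\<lambda>s \<theta>. cmod ((f (of_real r * cis \<theta>) + f (of_real s * (of_real r * cis \<theta>))) / 2) powr p"
  have in1: "of_real s * (of_real r * cis \<theta>) \<in> ball 0 1" if "s \<in> {0..1}" for s \<theta>
    using that r mult_left_le_one_le[of r s] by (auto simp: norm_mult abs_mult)
  have c: "continuous_on (cbox 0 1 \<times> cbox 0 (2*pi)) (\<lambda>(s,\<theta>). ?h s \<theta>)"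
  proof -
    let ?X = "cbox (0::real) 1 \<times> cbox 0 (2*pi)"
    have k1: "continuous_on ?X (\<lambda>x. of_real r * cis (snd x))"
      by (intro continuous_intros)
    have k2: "continuous_on ?X (\<lambda>x. of_real (fst x) * (of_real r * cis (snd x)))"
      by (intro continuous_intros)
    have "continuous_on ?X (\<lambda>x. (f (of_real r * cis (snd x)) + f (of_real (fst x) * (of_real r * cis (snd x)))) / 2)"
      using in1 circle_in_disc[OF r]
      by (intro continuous_on_divide continuous_on_add continuous_on_compose2[OF cf k1]
         continuous_on_compose2[OF cf k2] continuous_on_const) auto
    then show ?thesis
      unfolding split_def using p by (intro continuous_on_powr' continuous_on_norm continuous_on_const) auto
  qed
  have "continuous_on (cbox 0 1) (\<lambda>s. integral (cbox 0 (2*pi)) (?h s))"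
    by (rule integral_continuous_on_param) (rule c)
  then have "((\<lambda>s. integral {0..2*pi} (?h s)) \<longlongrightarrow> integral {0..2*pi} (?h 1)) (at 1 within {0..1})"
    unfolding continuous_on_def box_real by (rule bspec) auto
  then have "((\<lambda>s. integral {0..2*pi} (?h s)) \<longlongrightarrow> integral {0..2*pi} (?h 1)) (at_left 1)"
    by (simp add: at_within_Icc_at_left)
  from tendsto_mult_left[OF this, of "1 / (2 * pi)"] show ?thesis
    by (simp add: integral_mean_def)
qed

section \<open>Density of polynomials\<close>

text \<open>Strictness has two sources: for different moduli the strict convexity of t^p, for equal
  moduli the parallelogram law.\<close>

lemma cmod_midpoint_powr_less:
  fixes a b :: complex
  assumes p: "1 < p" and ne: "a \<noteq> b"
  shows "cmod ((a + b) / 2) powr p < (cmod a powr p + cmod b powr p) / 2"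
proof -
  define m where "m = (cmod a + cmod b) / 2"
  have m0: "m > 0" using ne norm_ge_zero[of a] norm_ge_zero[of b]
    by (cases "a = 0"; cases "b = 0") (auto simp: m_def add_pos_nonneg add_nonneg_pos)
  have le: "cmod ((a + b) / 2) \<le> m" using norm_triangle_ineq[of a b] by (simp add: m_def norm_divide)
  show ?thesis
  proof (cases "cmod a = cmod b")
    case False
    then have "cmod a \<noteq> m" "cmod b \<noteq> m" by (auto simp: m_def)
    then have "m powr p + p * m powr (p - 1) * (cmod a - m) < cmod a powr p"
      "m powr p + p * m powr (p - 1) * (cmod b - m) < cmod b powr p"
      using powr_above_tangent_strict[OF p m0] by auto
    then have "2 * m powr p + p * m powr (p - 1) * (cmod a - m + (cmod b - m)) < cmod a powr p + cmod b powr p"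
      by (simp only: distrib_left)
    then have "m powr p < (cmod a powr p + cmod b powr p) / 2" by (simp add: m_def)
    moreover have "cmod ((a + b) / 2) powr p \<le> m powr p" using le p by (intro powr_mono2) auto
    ultimately show ?thesis by simp
  next
    case True
    have "(cmod (a + b))\<^sup>2 + (cmod (a - b))\<^sup>2 = 2 * (cmod a)\<^sup>2 + 2 * (cmod b)\<^sup>2"
      unfolding cmod_power2 by (simp add: power2_eq_square algebra_simps)
    moreover have "(cmod (a - b))\<^sup>2 > 0" using ne by simp
    ultimately have "(cmod (a + b))\<^sup>2 < 2 * (cmod a)\<^sup>2 + 2 * (cmod b)\<^sup>2" by linarith
    then have "(cmod (a + b))\<^sup>2 < (2 * cmod a)\<^sup>2" using True by (simp add: power_mult_distrib)
    then have "cmod (a + b) < 2 * cmod a" by (rule power_less_imp_less_base) simp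
    then have "cmod ((a + b) / 2) powr p < cmod a powr p"
      using p by (intro powr_less_mono2) (auto simp: norm_divide)
    then show ?thesis using True by simp
  qed
qed

text \<open>A form of uniform convexity that can be integrated: the p-th power of the distance is
  paid for by a small multiple of the sizes plus a multiple of the midpoint defect. All terms are
  homogeneous of degree p, so compactness of the unit sphere N = 1 yields the constant.\<close>

lemma uniform_convexity_pointwise:
  fixes p e :: real
  assumes p: "1 < p" and e: "0 < e"
  obtains C where "0 \<le> C" "\<And>a b :: complex. cmod (a - b) powr p \<le> e * (cmod a powr p + cmod b powr p)
      + C * ((cmod a powr p + cmod b powr p) / 2 - cmod ((a + b) / 2) powr p)"
proof -
  define G where "G = (\<lambda>x::complex \<times> complex. (cmod (fst x) powr p + cmod (snd x) powr p) / 2 - cmod ((fst x + snd x) / 2) powr p)"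
  define N where "N = (\<lambda>x::complex \<times> complex. cmod (fst x) powr p + cmod (snd x) powr p)"
  define H where "H = (\<lambda>x::complex \<times> complex. cmod (fst x - snd x) powr p)"
  define K where "K = {x. N x = 1} \<inter> {x. e \<le> H x}"
  have cG: "continuous_on UNIV G" and cN: "continuous_on UNIV N" and cH: "continuous_on UNIV H"
    using p unfolding G_def N_def H_def by (auto intro!: continuous_intros continuous_on_powr')
  have G0: "G x \<ge> 0" for x
    using cmod_midpoint_powr_less[OF p, of "fst x" "snd x"] by (cases "fst x = snd x") (auto simp: G_def)
  have Gpos: "G x > 0" if "x \<in> K" for x
  proof -
    have "fst x \<noteq> snd x" using that e p by (auto simp: K_def H_def)
    then show ?thesis using cmod_midpoint_powr_less[OF p, of "fst x" "snd x"] by (simp add: G_def)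
  qed
  have small: "cmod (fst x) \<le> 1 \<and> cmod (snd x) \<le> 1" if "N x = 1" for x
  proof -
    have "cmod (fst x) powr p \<le> 1 powr p" "cmod (snd x) powr p \<le> 1 powr p"
      using that powr_ge_zero[of "cmod (fst x)" p] powr_ge_zero[of "cmod (snd x)" p]
      unfolding N_def powr_one_eq_one by linarith+
    then show ?thesis using p powr_less_mono2[of p 1] by (smt (verit) norm_ge_zero)
  qed
  have "K \<subseteq> cball 0 1 \<times> cball 0 1"
    using small by (force simp: K_def)
  then have "bounded K" using bounded_Times bounded_cball bounded_subset by metis
  moreover have "closed K"
    unfolding K_def using cN cH by (intro closed_Int closed_Collect_eq closed_Collect_le continuous_on_const)
  ultimately have cK: "compact K" by (simp add: compact_eq_bounded_closed)
  obtain m where m: "m > 0" "\<And>x. x \<in> K \<Longrightarrow> m \<le> G x"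
  proof (cases "K = {}")
    case True
    then show ?thesis using that[of 1] by auto
  next
    case False
    then obtain x0 where "x0 \<in> K" "\<And>x. x \<in> K \<Longrightarrow> G x0 \<le> G x"
      using continuous_attains_inf[OF cK, of G] continuous_on_subset[OF cG] by blast
    then show ?thesis using that[of "G x0"] Gpos by auto
  qed
  \<comment> \<open>On \<open>K\<close> the defect is at least \<open>m\<close>, and
    \<open>H\<close> is at most 2^p because both entries have modulus at most 1.\<close>
  define C where "C = 2 powr p / m"
  have C0: "C \<ge> 0" using m by (simp add: C_def)
  have unit: "H x \<le> e + C * G x" if "N x = 1" for x
  proof (cases "x \<in> K")
    case True
    have "H x \<le> 2 powr p" unfolding H_def
      using small[OF that] norm_triangle_ineq4[of "fst x" "snd x"] p by (intro powr_mono2) auto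
    also have "\<dots> = C * m" using m by (simp add: C_def)
    also have "\<dots> \<le> C * G x" using m(2)[OF True] C0 by (rule mult_left_mono)
    finally show ?thesis using e by simp
  next
    case False
    then have "H x \<le> e" using that by (auto simp: K_def)
    then show ?thesis using C0 G0[of x] by (smt (verit) mult_nonneg_nonneg)
  qed
  have "H x \<le> e * N x + C * G x" for x
  proof (cases "N x = 0")
    case True
    then have "cmod (fst x) powr p = 0" "cmod (snd x) powr p = 0"
      using powr_ge_zero[of "cmod (fst x)" p] powr_ge_zero[of "cmod (snd x)" p] unfolding N_def by linarith+
    then have "fst x = 0" "snd x = 0" by auto
    then show ?thesis by (simp add: H_def N_def G_def)
  next
    case False
    then have Npos: "N x > 0"
      using powr_ge_zero[of "cmod (fst x)" p] powr_ge_zero[of "cmod (snd x)" p] unfolding N_def by linarith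
    \<comment> \<open>Scaling by \<open>t\<close> divides every term by \<open>N x\<close> and
      brings the pair to the unit sphere.\<close>
    define t where "t = N x powr (-1/p)"
    have "t powr p = N x powr (- 1)" using p by (simp only: t_def powr_powr) simp
    then have t: "t > 0" "t powr p = 1 / N x" using Npos by (simp_all add: t_def powr_minus_divide)
    define y where "y = (of_real t * fst x, of_real t * snd x)"
    have sc: "cmod (of_real t * z) powr p = cmod z powr p / N x" for z
      using t by (simp add: norm_mult powr_mult)
    have Ny: "N y = 1" using Npos by (simp add: N_def y_def sc add_divide_distrib[symmetric])
    have Hy: "H y = H x / N x"
      unfolding H_def y_def fst_conv snd_conv right_diff_distrib[symmetric] sc ..
    have Gy: "G y = G x / N x"
      unfolding G_def y_def fst_conv snd_conv distrib_left[symmetric] times_divide_eq_right[symmetric] sc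
      using Npos by (simp add: field_simps)
    have "H x / N x \<le> e + C * (G x / N x)" using unit[OF Ny] unfolding Hy Gy .
    then show ?thesis using Npos by (simp add: field_simps)
  qed
  from this[of "(a, b)" for a b] show ?thesis
    using that[OF C0] by (simp add: H_def N_def G_def)
qed

lemma hp_norm_powr:
  assumes "0 < p" "f \<in> hardy p"
  shows "hp_norm p f powr p = (SUP r\<in>{0..<1}. integral_mean p f r)"
proof -
  have "integral_mean p f 0 \<le> (SUP r\<in>{0..<1}. integral_mean p f r)"
    using assms hardy_bdd_above by (intro cSUP_upper) auto
  then have "(SUP r\<in>{0..<1}. integral_mean p f r) \<ge> 0" using integral_mean_nonneg order_trans by blast
  then show ?thesis using assms by (simp add: hp_norm_def powr_powr)
qed

text \<open>Uniform convexity replaces boundary values here: \<open>f\<close> and its dilation have norm at most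
  \<open>\<parallel>f\<parallel>\<close>, while on a fixed circle their midpoint already has mean close to \<open>\<parallel>f\<parallel>^p\<close>.\<close>

lemma dilation_approximates:
  assumes p: "1 < p" and f: "f \<in> hardy p" and e: "0 < e"
  obtains s where "s \<in> {0<..<1}" "comp_op (\<lambda>z. of_real s * z) f \<in> hardy p"
    "hp_norm p (\<lambda>t. f t - comp_op (\<lambda>z. of_real s * z) f t) \<le> e"
proof -
  have p0: "0 < p" and p1: "1 \<le> p" using p by auto
  define N where "N = hp_norm p f powr p"
  have N0: "N \<ge> 0" by (simp add: N_def)
  define h where "h = e powr p"
  have h0: "h > 0" using e by (simp add: h_def)
  \<comment> \<open>Both p-means are at most \<open>N\<close>, so this coefficient contributes at
    most h/2; the 1 added to \<open>N\<close> avoids division by zero.\<close>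
  obtain C where C0: "0 \<le> C" and C: "\<And>a b :: complex. cmod (a - b) powr p \<le> h / (4 * (N + 1)) * (cmod a powr p + cmod b powr p)
      + C * ((cmod a powr p + cmod b powr p) / 2 - cmod ((a + b) / 2) powr p)"
    using uniform_convexity_pointwise[OF p, of "h / (4 * (N + 1))"] h0 N0 by auto
  \<comment> \<open>Makes the midpoint defect contribute at most h/2 after multiplication by
    \<open>C\<close>.\<close>
  define d where "d = h / (4 * (C + 1))"
  have d0: "d > 0" using h0 C0 by (simp add: d_def)
  have "N - d < (SUP r\<in>{0..<1}. integral_mean p f r)" using d0 hp_norm_powr[OF p0 f] by (simp add: N_def)
  then obtain r0 where r0: "r0 \<in> {0..<1}" "N - d < integral_mean p f r0"
    using less_cSUP_iff[of "{0..<1}" "integral_mean p f"] hardy_bdd_above[OF f] by auto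
  have "\<forall>\<^sub>F s in at_left (1::real). N - d < integral_mean p (\<lambda>z. (f z + f (of_real s * z)) / 2) r0"
    using order_tendstoD(1)[OF integral_mean_tendsto_dilation[OF hardy_holomorphic[OF f] r0(1) p0] r0(2)] .
  moreover have "\<forall>\<^sub>F s in at_left (1::real). s \<in> {0<..<1}"
    by (rule eventually_at_left_real) simp
  ultimately have "\<forall>\<^sub>F s in at_left (1::real). s \<in> {0<..<1} \<and> N - d < integral_mean p (\<lambda>z. (f z + f (of_real s * z)) / 2) r0"
    by eventually_elim simp
  then obtain s where s: "s \<in> {0<..<1}" "N - d < integral_mean p (\<lambda>z. (f z + f (of_real s * z)) / 2) r0"
    using eventually_happens[of _ "at_left (1::real)"] by auto
  define g where "g = comp_op (\<lambda>z. of_real s * z) f"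
  have "of_real s * z \<in> ball 0 1" if "z \<in> ball 0 1" for z :: complex
    using that s mult_strict_mono[of s 1 "cmod z" 1] by (simp add: norm_mult)
  then have g: "g \<in> hardy p" "hp_norm p g \<le> hp_norm p f"
    using hardy_compose[OF p1 f, of "\<lambda>z. of_real s * z"] by (auto simp: g_def intro!: holomorphic_intros)
  have gN: "hp_norm p g powr p \<le> N" unfolding N_def using g p0 by (intro powr_mono2) (auto simp: hp_norm_nonneg)
  note holf = hardy_holomorphic[OF f] and holg = hardy_holomorphic[OF g(1)]
  have avg: "integral_mean p (\<lambda>z. (f z + f (of_real s * z)) / 2) r = integral_mean p (\<lambda>z. (f z + g z) / 2) r"
    if "r \<in> {0..<1}" for r
    unfolding integral_mean_def g_def comp_op_def using circle_in_disc[OF that] by simp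
  \<comment> \<open>Means grow with the radius, so the lower bound for the midpoint on the circle
    \<open>r0\<close> persists on all larger circles, while the means of \<open>f\<close> and
    \<open>g\<close> never exceed \<open>N\<close>. Smaller circles then follow by monotonicity of
    the mean of \<open>f - g\<close>.\<close>
  have big: "integral_mean p (\<lambda>t. f t - g t) r \<le> h" if r: "r \<in> {0..<1}" "r0 \<le> r" for r
  proof -
    have sub: "cball 0 r \<subseteq> ball (0::complex) 1" using r by auto
    have Mf: "integral_mean p f r \<le> N" unfolding N_def by (rule integral_mean_le_hp_norm[OF p0 f r(1)])
    have Mg: "integral_mean p g r \<le> N" using integral_mean_le_hp_norm[OF p0 g(1) r(1)] gN by simp
    have hola: "(\<lambda>z. (f z + g z) / 2) holomorphic_on ball 0 1" by (intro holomorphic_intros holf holg) auto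
    have "N - d < integral_mean p (\<lambda>z. (f z + g z) / 2) r0" using s avg[OF r0(1)] by simp
    also have "\<dots> \<le> integral_mean p (\<lambda>z. (f z + g z) / 2) r"
      using r r0 hola sub by (intro integral_mean_mono p1) (auto intro: holomorphic_on_subset)
    finally have Ma: "N - d < integral_mean p (\<lambda>z. (f z + g z) / 2) r" .
    have "integral_mean p (\<lambda>t. f t - g t) r \<le> h / (4 * (N + 1)) * (integral_mean p f r + integral_mean p g r)
       + C * ((integral_mean p f r + integral_mean p g r) / 2 - integral_mean p (\<lambda>z. (f z + g z) / 2) r)"
      (is "_ \<le> ?R")
    proof (rule integral_mean_le_mean[OF _ r(1) p0])
      let ?c = "\<lambda>\<theta>. of_real r * cis \<theta>"
      note I = has_integral_integral_mean[OF holf r(1) p0] has_integral_integral_mean[OF holg r(1) p0]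
        has_integral_integral_mean[OF hola r(1) p0]
      have "2 * pi * ?R = h / (4 * (N + 1)) * (2 * pi * integral_mean p f r + 2 * pi * integral_mean p g r)
       + C * ((2 * pi * integral_mean p f r + 2 * pi * integral_mean p g r) / 2 - 2 * pi * integral_mean p (\<lambda>z. (f z + g z) / 2) r)"
        by (simp add: algebra_simps add_divide_distrib)
      then show "((\<lambda>\<theta>. h / (4 * (N + 1)) * (cmod (f (?c \<theta>)) powr p + cmod (g (?c \<theta>)) powr p)
          + C * ((cmod (f (?c \<theta>)) powr p + cmod (g (?c \<theta>)) powr p) / 2 - cmod ((f (?c \<theta>) + g (?c \<theta>)) / 2) powr p)) has_integral
          2 * pi * ?R) {0..2 * pi}"
        by (simp only:)
          (intro has_integral_add has_integral_mult_right has_integral_diff has_integral_divide I)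
    qed (use C in \<open>auto intro!: holomorphic_intros holf holg\<close>)
    also have "\<dots> \<le> h / (4 * (N + 1)) * (2 * N) + C * d"
    proof (intro add_mono mult_left_mono)
      show "(integral_mean p f r + integral_mean p g r) / 2 - integral_mean p (\<lambda>z. (f z + g z) / 2) r \<le> d"
        using Mf Mg Ma by argo
    qed (use Mf Mg h0 N0 C0 in auto)
    also have "\<dots> \<le> h / 2 + h / 2"
    proof (rule add_mono)
      show "h / (4 * (N + 1)) * (2 * N) \<le> h / 2" using h0 N0 by (simp add: field_simps)
      show "C * d \<le> h / 2" using h0 C0 by (simp add: d_def field_simps)
    qed
    finally show ?thesis by simp
  qed
  have all: "integral_mean p (\<lambda>t. f t - g t) r \<le> h" if r: "r \<in> {0..<1}" for r
  proof (cases "r0 \<le> r")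
    case False
    have "cball 0 r0 \<subseteq> ball (0::complex) 1" using r0 by auto
    then have "integral_mean p (\<lambda>t. f t - g t) r \<le> integral_mean p (\<lambda>t. f t - g t) r0"
      using False r r0 holf holg
      by (intro integral_mean_mono p1 holomorphic_intros) (auto intro: holomorphic_on_subset)
    also have "\<dots> \<le> h" using big[of r0] r0 by simp
    finally show ?thesis .
  qed (use big r in auto)
  have "hp_norm p (\<lambda>t. f t - g t) \<le> e"
    using all e p0 by (intro hp_norm_le) (auto simp: h_def)
  then show ?thesis using that[OF s(1)] g(1) by (simp add: g_def)
qed

section \<open>Bounded functionals and their vanishing on polynomials\<close>

lemma hp_dual_add: "\<Lambda> \<in> hp_dual p \<Longrightarrow> f \<in> hardy p \<Longrightarrow> g \<in> hardy p \<Longrightarrow> \<Lambda> (\<lambda>t. f t + g t) = \<Lambda> f + \<Lambda> g"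
  and hp_dual_cmult: "\<Lambda> \<in> hp_dual p \<Longrightarrow> f \<in> hardy p \<Longrightarrow> \<Lambda> (\<lambda>t. c * f t) = c * \<Lambda> f"
  and hp_dual_outside: "\<Lambda> \<in> hp_dual p \<Longrightarrow> f \<notin> hardy p \<Longrightarrow> \<Lambda> f = 0"
  by (auto simp: hp_dual_def)

lemma hp_dual_diff:
  assumes "0 < p" "\<Lambda> \<in> hp_dual p" "f \<in> hardy p" "g \<in> hardy p"
  shows "\<Lambda> (\<lambda>t. f t - g t) = \<Lambda> f - \<Lambda> g"
  using hp_dual_add[OF assms(2,3) hardy_cmult[OF assms(1,4), of "-1"]] hp_dual_cmult[OF assms(2,4), of "-1"]
  by simp

lemma hp_dual_bounded:
  assumes "\<Lambda> \<in> hp_dual p"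
  obtains C where "0 \<le> C" "\<And>f. f \<in> hardy p \<Longrightarrow> cmod (\<Lambda> f) \<le> C * hp_norm p f"
proof -
  obtain C where C: "\<And>f. f \<in> hardy p \<Longrightarrow> cmod (\<Lambda> f) \<le> C * hp_norm p f"
    using assms unfolding hp_dual_def by blast
  show ?thesis
  proof (rule that[of "\<bar>C\<bar>"])
    fix f assume "f \<in> hardy p"
    then have "cmod (\<Lambda> f) \<le> C * hp_norm p f" by (rule C)
    also have "\<dots> \<le> \<bar>C\<bar> * hp_norm p f" by (intro mult_right_mono) (auto simp: hp_norm_nonneg)
    finally show "cmod (\<Lambda> f) \<le> \<bar>C\<bar> * hp_norm p f" .
  qed simp
qed

lemma power_series_tail_uniform:
  assumes hol: "f holomorphic_on ball 0 1" and s: "s \<in> {0<..<1}" and e: "0 < e"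
  obtains c n where "\<And>z. z \<in> ball 0 1 \<Longrightarrow> cmod (f (of_real s * z) - (\<Sum>k<n. c k * z ^ k)) \<le> e"
proof -
  define a where "a = (\<lambda>k. (deriv ^^ k) f 0 / fact k)"
  have S: "(\<lambda>k. a k * w ^ k) sums f w" if "w \<in> ball 0 1" for w
    using holomorphic_power_series[OF hol that] by (simp add: a_def)
  \<comment> \<open>A radius strictly between \<open>s\<close> and 1: convergence there gives
    absolute convergence at \<open>s\<close>, and this numerical series dominates the dilated one on
    the whole disc.\<close>
  define s1 where "s1 = (s + 1) / 2"
  have "summable (\<lambda>k. norm (a k * of_real s ^ k))"
    by (rule powser_insidea[of a "of_real s1"]) (use S[of "of_real s1"] s in \<open>auto simp: s1_def sums_iff\<close>)
  then have sn: "summable (\<lambda>k. cmod (a k * of_real s ^ k))" .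
  obtain n where n: "\<And>m. m \<ge> n \<Longrightarrow> norm (\<Sum>i. cmod (a (i + m) * of_real s ^ (i + m))) < e"
    using suminf_exist_split[OF e sn] by blast
  show ?thesis
  proof (rule that)
    fix z :: complex assume z: "z \<in> ball 0 1"
    have le: "cmod (a k * (of_real s * z) ^ k) \<le> cmod (a k * of_real s ^ k)" for k
    proof -
      have "cmod z ^ k \<le> 1" using z by (intro power_le_one) auto
      then show ?thesis
        using mult_left_mono[of "cmod z ^ k" 1 "cmod (a k * of_real s ^ k)"]
        by (simp add: norm_mult norm_power power_mult_distrib mult.assoc)
    qed
    have "of_real s * z \<in> ball 0 1"
      using z s mult_strict_mono[of s 1 "cmod z" 1] by (simp add: norm_mult)
    from S[OF this] have Sz: "(\<lambda>k. a k * (of_real s * z) ^ k) sums f (of_real s * z)" .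
    have "f (of_real s * z) - (\<Sum>k<n. a k * (of_real s * z) ^ k) = (\<Sum>i. a (i + n) * (of_real s * z) ^ (i + n))"
      using suminf_minus_initial_segment[OF sums_summable[OF Sz], of n] sums_unique[OF Sz] by simp
    also have "cmod \<dots> \<le> (\<Sum>i. cmod (a (i + n) * of_real s ^ (i + n)))"
      using le by (intro norm_suminf_le) (auto intro!: summable_ignore_initial_segment[OF sn])
    also have "\<dots> \<le> e" using n[of n] by auto
    finally show "cmod (f (of_real s * z) - (\<Sum>k<n. (a k * of_real s ^ k) * z ^ k)) \<le> e"
      by (simp add: power_mult_distrib mult.assoc)
  qed
qed

text \<open>Density of polynomials in two stages: \<open>f\<close> is close in norm to a dilate, and
  a dilate is uniformly close on the disc to a section of its power series.\<close>

lemma hp_dual_eq_zero: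
  assumes p: "1 < p" and L: "\<Lambda> \<in> hp_dual p"
    and z: "\<And>k::nat. \<Lambda> (on_disc (\<lambda>z. z ^ k)) = 0"
  shows "\<Lambda> f = 0"
proof (cases "f \<in> hardy p")
  case f: True
  have p0: "0 < p" using p by simp
  obtain C where C: "0 \<le> C" "\<And>f. f \<in> hardy p \<Longrightarrow> cmod (\<Lambda> f) \<le> C * hp_norm p f"
    using hp_dual_bounded[OF L] by blast
  have mono: "on_disc (\<lambda>z. z ^ k) \<in> hardy p" for k :: nat
  proof -
    have "(\<lambda>z::complex. z ^ k) holomorphic_on ball 0 1" by (intro holomorphic_intros)
    then show ?thesis
      using hardy_bounded[OF p0, of "\<lambda>z. z ^ k" 1] by (simp add: norm_power power_le_one)
  qed
  have poly: "on_disc (\<lambda>z. \<Sum>k<n. c k * z ^ k) \<in> hardy p \<and> \<Lambda> (on_disc (\<lambda>z. \<Sum>k<n. c k * z ^ k)) = 0" for c :: "nat \<Rightarrow> complex" and n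
  proof (induction n)
    case 0
    have "on_disc (\<lambda>z. 0) = (\<lambda>t. 0 * on_disc (\<lambda>z. z ^ 0) t)" by (auto simp: on_disc_def)
    then show ?case using hardy_cmult[OF p0 mono[of 0], of 0] hp_dual_cmult[OF L mono[of 0], of 0] by simp
  next
    case (Suc n)
    have e: "on_disc (\<lambda>z. \<Sum>k<Suc n. c k * z ^ k) = (\<lambda>t. on_disc (\<lambda>z. \<Sum>k<n. c k * z ^ k) t + c n * on_disc (\<lambda>z. z ^ n) t)"
      by (auto simp: on_disc_def)
    show ?case unfolding e
      using Suc hardy_add[OF p0 _ hardy_cmult[OF p0 mono]] hp_dual_add[OF L _ hardy_cmult[OF p0 mono]]
        hp_dual_cmult[OF L mono] z by simp
  qed
  have "cmod (\<Lambda> f) \<le> C * (2 * e)" if e: "e > 0" for e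
  proof -
    obtain s where s: "s \<in> {0<..<1}" "comp_op (\<lambda>z. of_real s * z) f \<in> hardy p"
      "hp_norm p (\<lambda>t. f t - comp_op (\<lambda>z. of_real s * z) f t) \<le> e"
      using dilation_approximates[OF p f e] by blast
    define g where "g = comp_op (\<lambda>z. of_real s * z) f"
    obtain c n where cn: "\<And>z. z \<in> ball 0 1 \<Longrightarrow> cmod (f (of_real s * z) - (\<Sum>k<n. c k * z ^ k)) \<le> e"
      using power_series_tail_uniform[OF hardy_holomorphic[OF f] s(1) e] by blast
    define P where "P = on_disc (\<lambda>z. \<Sum>k<n. c k * z ^ k)"
    have P: "P \<in> hardy p" "\<Lambda> P = 0" using poly by (auto simp: P_def)
    have g: "g \<in> hardy p" using s by (simp add: g_def)
    have eq: "on_disc (\<lambda>t. g t - P t) = (\<lambda>t. g t - P t)" by (rule on_disc_hardy[OF hardy_diff[OF p0 g P(1)]])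
    have gP: "hp_norm p (\<lambda>t. g t - P t) \<le> e"
      using hardy_bounded[OF p0 hardy_holomorphic[OF hardy_diff[OF p0 g P(1)]], of e] cn
      unfolding eq by (auto simp: g_def P_def comp_op_def)
    have "\<Lambda> f = \<Lambda> (\<lambda>t. f t - g t) + \<Lambda> (\<lambda>t. g t - P t)"
      using hp_dual_diff[OF p0 L f g] hp_dual_diff[OF p0 L g P(1)] P(2) by simp
    also have "cmod \<dots> \<le> C * e + C * e"
    proof (rule norm_triangle_mono)
      show "cmod (\<Lambda> (\<lambda>t. f t - g t)) \<le> C * e"
        using C(2)[OF hardy_diff[OF p0 f g]] mult_left_mono[OF s(3) C(1)] by (simp add: g_def)
      show "cmod (\<Lambda> (\<lambda>t. g t - P t)) \<le> C * e"
        using C(2)[OF hardy_diff[OF p0 g P(1)]] mult_left_mono[OF gP C(1)] by simp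
    qed
    finally show ?thesis by simp
  qed
  from this[of "e / (2 * (C + 1))" for e] have "cmod (\<Lambda> f) \<le> 0 + e" if "e > 0" for e
  proof -
    have "C * (2 * (e / (2 * (C + 1)))) \<le> e" using that C by (simp add: field_simps)
    then show ?thesis using \<open>\<And>e. 0 < e / (2 * (C + 1)) \<Longrightarrow> cmod (\<Lambda> f) \<le> C * (2 * (e / (2 * (C + 1))))\<close>[of e] that C by simp
  qed
  then have "cmod (\<Lambda> f) \<le> 0" by (rule field_le_epsilon)
  then show ?thesis by simp
qed (rule hp_dual_outside[OF L])

section \<open>The half-plane coordinate and the eigenfunctions\<close>

text \<open>Reduces norm-analytic families to scalar functions, to which the identity theorem and
  Liouville's theorem apply.\<close>

lemma hp_dual_holomorphic:
  assumes p: "0 < p" and L: "\<Lambda> \<in> hp_dual p" and F: "vanalytic (hp_norm p) (hardy p) S F"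
  shows "(\<lambda>s. \<Lambda> (F s)) holomorphic_on S"
proof -
  have S: "open S" and FX: "\<And>z. z \<in> S \<Longrightarrow> F z \<in> hardy p"
    and lim: "\<And>z. z \<in> S \<Longrightarrow> \<exists>G\<in>hardy p. ((\<lambda>w. hp_norm p (\<lambda>t. (F w t - F z t) / (w - z) - G t)) \<longlongrightarrow> 0) (at z)"
    using F by (auto simp: vanalytic_def)
  obtain C where C: "0 \<le> C" "\<And>f. f \<in> hardy p \<Longrightarrow> cmod (\<Lambda> f) \<le> C * hp_norm p f"
    using hp_dual_bounded[OF L] by blast
  have "\<exists>D. ((\<lambda>s. \<Lambda> (F s)) has_field_derivative D) (at z)" if z: "z \<in> S" for z
  proof -
    obtain G where G: "G \<in> hardy p" "((\<lambda>w. hp_norm p (\<lambda>t. (F w t - F z t) / (w - z) - G t)) \<longlongrightarrow> 0) (at z)"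
      using lim[OF z] by blast
    have le: "cmod ((\<Lambda> (F w) - \<Lambda> (F z)) / (w - z) - \<Lambda> G) \<le> C * hp_norm p (\<lambda>t. (F w t - F z t) / (w - z) - G t)"
      if w: "w \<in> S" for w
    proof -
      let ?d = "\<lambda>t. F w t - F z t"
      have d: "?d \<in> hardy p" by (rule hardy_diff[OF p FX[OF w] FX[OF z]])
      have e: "(\<lambda>t. (F w t - F z t) / (w - z)) = (\<lambda>t. inverse (w - z) * ?d t)"
        by (simp add: field_simps)
      have dd: "(\<lambda>t. (F w t - F z t) / (w - z)) \<in> hardy p" unfolding e by (rule hardy_cmult[OF p d])
      have "(\<Lambda> (F w) - \<Lambda> (F z)) / (w - z) = \<Lambda> (\<lambda>t. (F w t - F z t) / (w - z))"
        unfolding e hp_dual_cmult[OF L d] hp_dual_diff[OF p L FX[OF w] FX[OF z]] by (simp add: field_simps)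
      then have "(\<Lambda> (F w) - \<Lambda> (F z)) / (w - z) - \<Lambda> G = \<Lambda> (\<lambda>t. (F w t - F z t) / (w - z) - G t)"
        using hp_dual_diff[OF p L dd G(1)] by simp
      then show ?thesis using C(2)[OF hardy_diff[OF p dd G(1)]] by simp
    qed
    have "((\<lambda>w. (\<Lambda> (F w) - \<Lambda> (F z)) / (w - z) - \<Lambda> G) \<longlongrightarrow> 0) (at z)"
    proof (rule Lim_null_comparison)
      show "\<forall>\<^sub>F w in at z. cmod ((\<Lambda> (F w) - \<Lambda> (F z)) / (w - z) - \<Lambda> G) \<le> C * hp_norm p (\<lambda>t. (F w t - F z t) / (w - z) - G t)"
        using eventually_at_in_open'[OF S z] by eventually_elim (rule le)
      show "((\<lambda>w. C * hp_norm p (\<lambda>t. (F w t - F z t) / (w - z) - G t)) \<longlongrightarrow> 0) (at z)"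
        using tendsto_mult_left[OF G(2), of C] by simp
    qed
    then have "((\<lambda>w. (\<Lambda> (F w) - \<Lambda> (F z)) / (w - z)) \<longlongrightarrow> \<Lambda> G) (at z)" by (simp add: LIM_zero_iff)
    then show ?thesis unfolding has_field_derivative_iff by blast
  qed
  then show ?thesis using S by (auto simp: holomorphic_on_open)
qed

locale two_circle_points =
  fixes \<zeta>1 \<zeta>2 :: complex
  assumes norm_zeta: "cmod \<zeta>1 = 1" "cmod \<zeta>2 = 1" and zeta_neq: "\<zeta>1 \<noteq> \<zeta>2"
begin

text \<open>The factor is chosen so that u = 1/q - a on the disc. The function 1/q maps the disc
  onto Re > 1/2, and \<open>a\<close> is its value at \<open>\<zeta>1\<close>, on the boundary line;
  subtracting it gives the right half-plane.\<close>

definition u :: "complex \<Rightarrow> complex" where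
  "u z = \<zeta>2 * (\<zeta>1 - z) / ((\<zeta>1 - \<zeta>2) * (\<zeta>2 - z))"

definition a :: complex where
  "a = \<zeta>2 / (\<zeta>2 - \<zeta>1)"

definition q :: "complex \<Rightarrow> complex" where
  "q z = 1 - z / \<zeta>2"

definition u_inv :: "complex \<Rightarrow> complex" where
  "u_inv v = \<zeta>2 * (1 - 1 / (v + a))"

lemma zeta_nz: "\<zeta>1 \<noteq> 0" "\<zeta>2 \<noteq> 0"
  using norm_zeta by auto

text \<open>With q' = 1 - z/zeta2 one has |1 - q'| = |z|. The second term vanishes for z on the
  circle, which gives Re a = 1/2, and is positive in the disc, which gives Re u > 0.\<close>

lemma Re_inverse_eq: "q' \<noteq> 0 \<Longrightarrow> Re (1 / q') = 1 / 2 + (1 - (cmod (1 - q'))\<^sup>2) / (2 * (cmod q')\<^sup>2)"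
proof -
  assume n: "q' \<noteq> 0"
  have "(cmod (1 - q'))\<^sup>2 = (cmod q')\<^sup>2 - 2 * Re q' + 1"
    unfolding cmod_power2 by (simp add: power2_eq_square algebra_simps)
  moreover have "Re (1 / q') = Re q' / (cmod q')\<^sup>2"
    by (simp add: Re_divide cmod_power2)
  ultimately show ?thesis using n by (simp add: field_simps)
qed

lemma Re_a: "Re a = 1 / 2"
proof -
  have n: "1 - \<zeta>1 / \<zeta>2 \<noteq> 0" using zeta_nz zeta_neq by simp
  have "a = 1 / (1 - \<zeta>1 / \<zeta>2)" using zeta_nz zeta_neq by (simp add: a_def field_simps)
  moreover have "cmod (1 - (1 - \<zeta>1 / \<zeta>2)) = 1" using norm_zeta by (simp add: norm_divide)
  ultimately show ?thesis using Re_inverse_eq[OF n] by simp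
qed

lemma q_nz: "z \<in> ball 0 1 \<Longrightarrow> q z \<noteq> 0"
  using zeta_nz norm_zeta by (auto simp: q_def)

lemma norm_q_le: "z \<in> ball 0 1 \<Longrightarrow> cmod (q z) \<le> 2"
  using norm_triangle_ineq4[of 1 "z / \<zeta>2"] norm_zeta by (simp add: q_def norm_divide)

lemma u_eq: "z \<in> ball 0 1 \<Longrightarrow> u z = 1 / q z - a"
proof -
  assume z: "z \<in> ball 0 1"
  then have "\<zeta>2 - z \<noteq> 0" using norm_zeta by auto
  moreover have "\<zeta>1 - \<zeta>2 \<noteq> 0" "\<zeta>2 - \<zeta>1 \<noteq> 0" using zeta_neq by auto
  ultimately have "u z = \<zeta>2 / (\<zeta>2 - z) - a"
    by (simp add: u_def a_def divide_simps) (simp add: algebra_simps)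
  moreover have "1 / q z = \<zeta>2 / (\<zeta>2 - z)" using zeta_nz by (simp add: q_def field_simps)
  ultimately show ?thesis by simp
qed

lemma Re_u: "z \<in> ball 0 1 \<Longrightarrow> Re (u z) = (1 - (cmod z)\<^sup>2) / (2 * (cmod (q z))\<^sup>2)"
  using Re_inverse_eq[OF q_nz] Re_a norm_zeta by (simp add: u_eq q_def norm_divide)

lemma Re_u_pos: "z \<in> ball 0 1 \<Longrightarrow> Re (u z) > 0"
  using Re_u[of z] q_nz[of z] by (simp add: abs_square_less_1 zero_less_mult_iff)

lemma u_nz: "z \<in> ball 0 1 \<Longrightarrow> u z \<noteq> 0"
  using Re_u_pos[of z] by auto

lemma holomorphic_u: "u holomorphic_on ball 0 1"
  unfolding u_def using zeta_neq norm_zeta by (intro holomorphic_intros) auto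

lemma holomorphic_q: "q holomorphic_on S"
  unfolding q_def using zeta_nz by (intro holomorphic_intros) auto

lemma u_plus_a_nz: "Re v > 0 \<Longrightarrow> v + a \<noteq> 0"
  using Re_a by (auto simp: complex_eq_iff)

text \<open>The third fact measures the distance from a point to the circle in half-plane terms; it
  later controls where the flow sends 0.\<close>

lemma u_inv:
  assumes "Re v > 0"
  shows "u_inv v \<in> ball 0 1" "u (u_inv v) = v" "1 - (cmod (u_inv v))\<^sup>2 = 2 * Re v / (cmod (v + a))\<^sup>2"
proof -
  have nz: "1 / (v + a) \<noteq> 0" using u_plus_a_nz[OF assms] by simp
  have c: "cmod (u_inv v) = cmod (1 - 1 / (v + a))" using norm_zeta by (simp add: u_inv_def norm_mult)
  show e: "1 - (cmod (u_inv v))\<^sup>2 = 2 * Re v / (cmod (v + a))\<^sup>2"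
    using Re_inverse_eq[OF nz] Re_a nz unfolding c by (simp add: norm_divide field_simps)
  then have "(cmod (u_inv v))\<^sup>2 < 1" using assms nz
    by (smt (verit) divide_pos_pos norm_eq_zero zero_less_power2 nz divide_eq_0_iff)
  then show b: "u_inv v \<in> ball 0 1" by (simp add: abs_square_less_1)
  have "q (u_inv v) = 1 / (v + a)" using zeta_nz by (simp add: q_def u_inv_def)
  then show "u (u_inv v) = v" using u_eq[OF b] by simp
qed

lemma u_inv_u: "z \<in> ball 0 1 \<Longrightarrow> u_inv (u z) = z"
  using zeta_nz by (simp add: u_inv_def u_eq q_def)

lemma holomorphic_u_inv: "u_inv holomorphic_on {v. Re v > 0}"
  unfolding u_inv_def using u_plus_a_nz by (intro holomorphic_intros) auto

text \<open>Source of the recurrence \<open>pw_shift\<close>. It also shows that u q is bounded, so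
  each factor of \<open>q\<close> cancels one power of \<open>u\<close> near zeta2.\<close>

lemma u_q: "z \<in> ball 0 1 \<Longrightarrow> u z * q z = 1 - a * q z"
  using q_nz[of z] by (simp add: u_eq field_simps)

lemma u_0: "u 0 = 1 - a"
  by (simp add: u_eq q_def)

section \<open>Powers of the coordinate and their domination in H^p\<close>

lemma holomorphic_Ln_u: "(\<lambda>z. Ln (u z)) holomorphic_on ball 0 1"
  using Re_u_pos by (intro holomorphic_intros holomorphic_u) (auto simp: complex_nonpos_Reals_iff not_le)

lemma Im_Ln_u: "z \<in> ball 0 1 \<Longrightarrow> \<bar>Im (Ln (u z))\<bar> < pi / 2"
  using Re_Ln_pos_lt u_nz Re_u_pos by blast

lemma Re_Ln_u: "z \<in> ball 0 1 \<Longrightarrow> Re (Ln (u z)) = ln (cmod (u z))"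
  using u_nz by simp

text \<open>Since |arg u| < pi/2, the argument of u^x stays within pi |x| / 2 < pi/2, where the
  cosine is at least cos(pi x / 2). The right-hand side is harmonic, so its circle means are
  explicit.\<close>

lemma norm_u_powr_le_Re:
  assumes z: "z \<in> ball 0 1" and x: "\<bar>x\<bar> < 1"
  shows "cos (pi / 2 * x) > 0"
    "cmod (u z) powr x \<le> Re (exp (of_real x * Ln (u z))) / cos (pi / 2 * x)"
proof -
  have ax: "pi / 2 * \<bar>x\<bar> < pi / 2" using mult_strict_left_mono[OF x, of "pi/2"] by simp
  then have "\<bar>pi / 2 * x\<bar> < pi / 2" by (simp add: abs_mult)
  then show c: "cos (pi / 2 * x) > 0" by (intro cos_gt_zero_pi) linarith+
  have "\<bar>x * Im (Ln (u z))\<bar> \<le> \<bar>pi / 2 * x\<bar>"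
    using mult_left_mono[of "\<bar>Im (Ln (u z))\<bar>" "pi/2" "\<bar>x\<bar>"] Im_Ln_u[OF z] by (simp add: abs_mult mult.commute)
  then have "cos \<bar>pi / 2 * x\<bar> \<le> cos \<bar>x * Im (Ln (u z))\<bar>"
    using ax by (intro cos_monotone_0_pi_le) (auto simp: abs_mult)
  then have "cos (pi / 2 * x) \<le> cos (x * Im (Ln (u z)))" by (simp only: cos_abs_real)
  then have "cmod (u z) powr x * cos (pi / 2 * x) \<le> cmod (u z) powr x * cos (x * Im (Ln (u z)))"
    by (intro mult_left_mono) auto
  also have "\<dots> = Re (exp (of_real x * Ln (u z)))"
    using u_nz[OF z] by (simp add: Re_exp powr_def)
  finally show "cmod (u z) powr x \<le> Re (exp (of_real x * Ln (u z))) / cos (pi / 2 * x)"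
    using c by (simp add: field_simps)
qed

text \<open>One weight for all |u|^x with |x| <= d: the two terms cover the pole of \<open>u\<close>
  at zeta2 and its zero at zeta1.\<close>

definition W :: "real \<Rightarrow> complex \<Rightarrow> real" where
  "W d z = cmod (u z) powr d + cmod (u z) powr (- d)"

lemma W_pos: "z \<in> ball 0 1 \<Longrightarrow> W d z > 0"
  using u_nz by (auto simp: W_def intro!: add_pos_pos)

text \<open>The p-th power of the weight is controlled by |u|^(dp) + |u|^(-dp), hence by harmonic
  functions because d p < 1. One \<open>K\<close> serves all \<open>f\<close> and \<open>C\<close>,
  as limits of difference quotients require.\<close>

lemma dominated_hardy:
  assumes p: "0 < p" and d: "0 \<le> d" "d * p < 1"
  obtains K where "0 \<le> K"
    "\<And>f C. f holomorphic_on ball 0 1 \<Longrightarrow> 0 \<le> C \<Longrightarrow> (\<And>z. z \<in> ball 0 1 \<Longrightarrow> cmod (f z) \<le> C * W d z)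
      \<Longrightarrow> on_disc f \<in> hardy p \<and> hp_norm p (on_disc f) \<le> C * K"
proof -
  define x where "x = d * p"
  have x: "\<bar>x\<bar> < 1" "\<bar>-x\<bar> < 1" using d p by (auto simp: x_def)
  define E where "E = (\<lambda>x z. Re (exp (of_real x * Ln (u z))) / cos (pi / 2 * x))"
  have E: "cmod (u z) powr x \<le> E x z" "cmod (u z) powr (-x) \<le> E (-x) z" if "z \<in> ball 0 1" for z
    using norm_u_powr_le_Re[OF that] x unfolding E_def by blast+
  define B where "B = E x 0 + E (-x) 0"
  have "B \<ge> 0" using E[of 0] by (simp add: B_def) (smt (verit) powr_ge_zero)
  define K where "K = (2 powr p * B) powr (1/p)"
  have K0: "K \<ge> 0" by (simp add: K_def)
  have Kp: "K powr p = 2 powr p * B" using p \<open>B \<ge> 0\<close> by (simp add: K_def powr_powr)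
  have IE: "((\<lambda>\<theta>. E y (of_real r * cis \<theta>)) has_integral 2 * pi * E y 0) {0..2*pi}" if r: "r \<in> {0..<1}" for y r
  proof -
    have "(\<lambda>z. exp (of_real y * Ln (u z))) holomorphic_on ball 0 1"
      by (intro holomorphic_intros holomorphic_Ln_u)
    then have h: "(\<lambda>z. exp (of_real y * Ln (u z))) holomorphic_on cball 0 r"
      by (rule holomorphic_on_subset) (use r in auto)
    have "((\<lambda>\<theta>. Re (exp (of_real y * Ln (u (of_real r * cis \<theta>))))) has_integral 2 * pi * Re (exp (of_real y * Ln (u 0)))) {0..2*pi}"
      using has_integral_linear[OF mean_value_circle[OF h] bounded_linear_Re] r
      unfolding o_def of_real_mult[symmetric] Re_complex_of_real_times by simp
    from has_integral_divide[OF this, of "cos (pi / 2 * y)"] show ?thesis by (simp add: E_def)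
  qed
  have main: "integral_mean p (on_disc f) r \<le> (C * K) powr p"
    if f: "f holomorphic_on ball 0 1" and C: "0 \<le> C" and le: "\<And>z. z \<in> ball 0 1 \<Longrightarrow> cmod (f z) \<le> C * W d z"
      and r: "r \<in> {0..<1}" for f C r
  proof -
    have "integral_mean p (on_disc f) r \<le> C powr p * (2 powr p * B)"
    proof (rule integral_mean_le_mean[OF holomorphic_on_disc[OF f] r p])
      show "((\<lambda>\<theta>. C powr p * (2 powr p * (E x (of_real r * cis \<theta>) + E (-x) (of_real r * cis \<theta>)))) has_integral
         2 * pi * (C powr p * (2 powr p * B))) {0..2*pi}"
        using has_integral_mult_right[OF has_integral_mult_right[OF has_integral_add[OF IE[OF r, of x] IE[OF r, of "-x"]], of "2 powr p"], of "C powr p"]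
        by (simp add: B_def algebra_simps)
      fix \<theta>
      define z where "z = of_real r * cis \<theta>"
      have z: "z \<in> ball 0 1" using circle_in_disc[OF r] by (simp add: z_def)
      have "cmod (on_disc f z) powr p \<le> (C * W d z) powr p" using le[OF z] z p by (intro powr_mono2) auto
      also have "\<dots> = C powr p * W d z powr p" using C W_pos[OF z] by (simp add: powr_mult)
      also have "W d z powr p \<le> 2 powr p * ((cmod (u z) powr d) powr p + (cmod (u z) powr (-d)) powr p)"
        unfolding W_def by (rule powr_add_le) (use p in auto)
      also have "\<dots> = 2 powr p * (cmod (u z) powr x + cmod (u z) powr (-x))" by (simp add: powr_powr x_def)
      also have "\<dots> \<le> 2 powr p * (E x z + E (-x) z)" using E[OF z] by (intro mult_left_mono add_mono) auto
      finally show "cmod (on_disc f (of_real r * cis \<theta>)) powr p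
          \<le> C powr p * (2 powr p * (E x (of_real r * cis \<theta>) + E (-x) (of_real r * cis \<theta>)))"
        by (simp add: z_def mult_left_mono)
    qed
    also have "\<dots> = (C * K) powr p" using C K0 by (simp add: powr_mult Kp)
    finally show ?thesis .
  qed
  show ?thesis
  proof (rule that[OF K0])
    fix f C assume f: "f holomorphic_on ball 0 1" and C: "(0::real) \<le> C" and le: "\<And>z. z \<in> ball 0 1 \<Longrightarrow> cmod (f z) \<le> C * W d z"
    show "on_disc f \<in> hardy p \<and> hp_norm p (on_disc f) \<le> C * K"
      using main[OF f C le] K0 C p by (auto intro!: hardyI[OF holomorphic_on_disc[OF f], of p "(C * K) powr p"] hp_norm_le)
  qed
qed

text \<open>Local domination by one weight makes the remainder of the difference quotient at most a
  constant times |w - s0| times that weight, and therefore small in norm.\<close>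

lemma vanalytic_hardyI:
  assumes p: "0 < p" and d: "0 \<le> d" "d * p < 1" and S: "open S"
    and F: "\<And>s. s \<in> S \<Longrightarrow> F s holomorphic_on ball 0 1"
    and G: "\<And>s. s \<in> S \<Longrightarrow> G s holomorphic_on ball 0 1"
    and der: "\<And>s z. s \<in> S \<Longrightarrow> z \<in> ball 0 1 \<Longrightarrow> ((\<lambda>s. F s z) has_field_derivative G s z) (at s)"
    and dom: "\<And>s0. s0 \<in> S \<Longrightarrow> \<exists>r>0. \<exists>C. ball s0 r \<subseteq> S \<and> (\<forall>s\<in>ball s0 r. \<forall>z\<in>ball 0 1. cmod (F s z) \<le> C * W d z)"
  shows "vanalytic (hp_norm p) (hardy p) S (\<lambda>s. on_disc (F s))"
proof -
  obtain K where K: "0 \<le> K" "\<And>f C. f holomorphic_on ball 0 1 \<Longrightarrow> 0 \<le> C \<Longrightarrow> (\<And>z. z \<in> ball 0 1 \<Longrightarrow> cmod (f z) \<le> C * W d z)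
      \<Longrightarrow> on_disc f \<in> hardy p \<and> hp_norm p (on_disc f) \<le> C * K"
    using dominated_hardy[OF p d] by metis
  have "on_disc (F s0) \<in> hardy p \<and> (\<exists>G\<in>hardy p. ((\<lambda>w. hp_norm p (\<lambda>t. (on_disc (F w) t - on_disc (F s0) t) / (w - s0) - G t)) \<longlongrightarrow> 0) (at s0))"
    if s0: "s0 \<in> S" for s0
  proof -
    obtain r C where r: "r > 0" "ball s0 r \<subseteq> S" and C: "\<And>s z. s \<in> ball s0 r \<Longrightarrow> z \<in> ball 0 1 \<Longrightarrow> cmod (F s z) \<le> C * W d z"
      using dom[OF s0] by blast
    have "0 \<le> C * W d 0" using order_trans[OF norm_ge_zero C[of s0 0]] r by simp
    then have C0: "0 \<le> C" using W_pos[of 0 d] by (simp add: zero_le_mult_iff)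
    define Q where "Q = (\<lambda>w z. (F w z - F s0 z) / (w - s0) - G s0 z)"
    have Q: "cmod (Q w z) \<le> 32 * C / r\<^sup>2 * dist s0 w * W d z" if w: "dist s0 w < r/2" "w \<noteq> s0" and z: "z \<in> ball 0 1" for w z
    proof -
      have "(\<lambda>s. F s z) holomorphic_on ball s0 r"
        using der[OF _ z] r(2) by (auto simp: holomorphic_on_open)
      from holomorphic_difference_quotient_bound[OF this r(1) C[OF _ z] der[OF s0 z] w]
      show ?thesis by (simp add: Q_def mult_ac)
    qed
    have QH: "on_disc (Q w) \<in> hardy p \<and> hp_norm p (on_disc (Q w)) \<le> 32 * C / r\<^sup>2 * dist s0 w * K"
      if w: "dist s0 w < r/2" "w \<noteq> s0" for w
    proof (rule K(2))
      have "w \<in> ball s0 r" using w r by auto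
      then have "w \<in> S" using r by auto
      then show "Q w holomorphic_on ball 0 1"
        unfolding Q_def using w s0 by (intro holomorphic_intros F G) auto
    qed (use C0 Q[OF w] in auto)
    have FH: "on_disc (F s) \<in> hardy p" if "s \<in> ball s0 r" for s
      using K(2)[OF F C0 C[OF that]] that r(2) by blast
    \<comment> \<open>The derivative \<open>G s0\<close> is the difference quotient at this one
      point minus its remainder; both are in H^p, hence so is \<open>G s0\<close>.\<close>
    define w1 where "w1 = s0 + of_real (r/4)"
    have w1: "dist s0 w1 < r/2" "w1 \<noteq> s0" "w1 \<in> ball s0 r" "w1 - s0 \<noteq> 0" using r by (auto simp: w1_def dist_norm)
    have s0r: "s0 \<in> ball s0 r" using r by simp
    have "on_disc (G s0) = (\<lambda>t. 1 / (w1 - s0) * (on_disc (F w1) t - on_disc (F s0) t) - on_disc (Q w1) t)"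
      using w1(4) by (auto simp: on_disc_def Q_def)
    also have "\<dots> \<in> hardy p"
      using QH[OF w1(1,2)] by (intro hardy_diff[OF p] hardy_cmult[OF p] FH w1 s0r) auto
    finally have GH: "on_disc (G s0) \<in> hardy p" .
    have eq: "(\<lambda>t. (on_disc (F w) t - on_disc (F s0) t) / (w - s0) - on_disc (G s0) t) = on_disc (Q w)" for w
      by (auto simp: on_disc_def Q_def)
    have "((\<lambda>w. hp_norm p (on_disc (Q w))) \<longlongrightarrow> 0) (at s0)"
    proof (rule Lim_null_comparison)
      have "\<forall>\<^sub>F w in at s0. w \<in> ball s0 (r/2) - {s0}"
        using r by (intro eventually_at_in_open) auto
      then show "\<forall>\<^sub>F w in at s0. norm (hp_norm p (on_disc (Q w))) \<le> 32 * C / r\<^sup>2 * dist s0 w * K"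
        by eventually_elim (use QH in \<open>auto simp: hp_norm_nonneg\<close>)
      have "((\<lambda>w. 32 * C / r\<^sup>2 * dist s0 w * K) \<longlongrightarrow> 32 * C / r\<^sup>2 * dist s0 s0 * K) (at s0)"
        by (intro tendsto_intros)
      then show "((\<lambda>w. 32 * C / r\<^sup>2 * dist s0 w * K) \<longlongrightarrow> 0) (at s0)" by simp
    qed
    then show ?thesis using GH FH[OF s0r] unfolding eq[symmetric] by blast
  qed
  then show ?thesis using S unfolding vanalytic_def by blast
qed

text \<open>This is u^s q^n, with the principal logarithm, which is holomorphic on the right
  half-plane. Integer powers of \<open>q\<close> keep the dependence on \<open>s\<close> purely
  exponential.\<close>

definition pw :: "nat \<Rightarrow> complex \<Rightarrow> complex \<Rightarrow> complex" where
  "pw n s z = exp (s * Ln (u z)) * q z ^ n"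

lemma holomorphic_pw: "pw n s holomorphic_on ball 0 1"
  unfolding pw_def by (intro holomorphic_intros holomorphic_Ln_u holomorphic_q)

text \<open>Where |u| <= 1, the lower bound on Re s suffices. Where |u| > 1, the n factors of
  \<open>q\<close> absorb |u|^n and leave |u|^d. The exponential in Im s comes from |arg u| <
  pi/2.\<close>

lemma pw_bound:
  assumes z: "z \<in> ball 0 1" and d: "0 \<le> d" and s: "- d \<le> Re s" "Re s \<le> n + d"
  shows "cmod (pw n s z) \<le> exp (pi / 2 * \<bar>Im s\<bar>) * (2 + 2 * cmod a) ^ n * W d z"
proof -
  let ?y = "cmod (u z)"
  have y: "?y > 0" using u_nz[OF z] by simp
  have "cmod (exp (s * Ln (u z))) = exp (Re s * ln ?y - Im s * Im (Ln (u z)))"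
    using Re_Ln_u[OF z] by simp
  also have "\<dots> \<le> exp (Re s * ln ?y + pi / 2 * \<bar>Im s\<bar>)"
  proof -
    have "- (Im s * Im (Ln (u z))) \<le> \<bar>Im s\<bar> * \<bar>Im (Ln (u z))\<bar>" by (metis abs_ge_minus_self abs_mult)
    also have "\<dots> \<le> \<bar>Im s\<bar> * (pi / 2)" using Im_Ln_u[OF z] by (intro mult_left_mono) auto
    finally show ?thesis by (simp add: mult.commute)
  qed
  also have "\<dots> = exp (pi / 2 * \<bar>Im s\<bar>) * ?y powr Re s" using y by (simp add: exp_add powr_def)
  finally have e: "cmod (exp (s * Ln (u z))) \<le> exp (pi / 2 * \<bar>Im s\<bar>) * ?y powr Re s" .
  \<comment> \<open>One constant for both cases: |q| <= 2, and |u q| <= 1 + 2 |a|.\<close>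
  have q2: "cmod (q z) \<le> 2 + 2 * cmod a" using norm_q_le[OF z] by (simp add: add_increasing2)
  have "?y powr Re s * cmod (q z) ^ n \<le> (2 + 2 * cmod a) ^ n * W d z"
  proof (cases "?y \<le> 1")
    case True
    have "?y powr Re s \<le> ?y powr (-d)" using True y s by (intro powr_mono') auto
    also have "\<dots> \<le> W d z" by (simp add: W_def)
    finally have "cmod (q z) ^ n * ?y powr Re s \<le> (2 + 2 * cmod a) ^ n * W d z"
      using q2 by (intro mult_mono power_mono) auto
    then show ?thesis by (simp add: mult.commute)
  next
    case False
    have "cmod (u z * q z) \<le> 1 + cmod a * cmod (q z)"
      unfolding u_q[OF z] using norm_triangle_ineq4[of 1 "a * q z"] by (simp add: norm_mult)
    also have "\<dots> \<le> 2 + 2 * cmod a" using mult_left_mono[OF norm_q_le[OF z], of "cmod a"] by simp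
    finally have uq: "?y * cmod (q z) \<le> 2 + 2 * cmod a" by (simp add: norm_mult)
    have "?y powr Re s \<le> ?y powr (n + d)" using False s by (intro powr_mono) auto
    also have "\<dots> = ?y ^ n * ?y powr d" using y by (simp add: powr_add powr_realpow)
    finally have "?y powr Re s * cmod (q z) ^ n \<le> ?y ^ n * ?y powr d * cmod (q z) ^ n"
      by (intro mult_right_mono) auto
    also have "\<dots> = (?y * cmod (q z)) ^ n * ?y powr d" by (simp add: power_mult_distrib)
    also have "\<dots> \<le> (2 + 2 * cmod a) ^ n * W d z"
      using uq by (intro mult_mono power_mono) (auto simp: W_def)
    finally show ?thesis .
  qed
  then have "exp (pi / 2 * \<bar>Im s\<bar>) * (?y powr Re s * cmod (q z) ^ n) \<le> exp (pi / 2 * \<bar>Im s\<bar>) * ((2 + 2 * cmod a) ^ n * W d z)"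
    by (intro mult_left_mono) auto
  moreover have "cmod (pw n s z) \<le> exp (pi / 2 * \<bar>Im s\<bar>) * ?y powr Re s * cmod (q z) ^ n"
    unfolding pw_def norm_mult norm_power using e by (intro mult_right_mono) auto
  ultimately show ?thesis unfolding mult.assoc by linarith
qed

lemma vanalytic_pw:
  assumes p: "0 < p" and d: "0 \<le> d" "d * p < 1"
  shows "vanalytic (hp_norm p) (hardy p) {s. - d < Re s \<and> Re s < n + d} (\<lambda>s. on_disc (pw n s))"
proof (rule vanalytic_hardyI[OF p d])
  let ?S = "{s. - d < Re s \<and> Re s < n + d}"
  show S: "open ?S" by (intro open_Collect_conj open_Collect_less continuous_intros)
  show "pw n s holomorphic_on ball 0 1" for s by (rule holomorphic_pw)
  show "(\<lambda>z. Ln (u z) * pw n s z) holomorphic_on ball 0 1" for s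
    by (intro holomorphic_intros holomorphic_pw holomorphic_Ln_u)
  show "((\<lambda>s. pw n s z) has_field_derivative Ln (u z) * pw n s z) (at s)" for s z
    unfolding pw_def by (auto intro!: derivative_eq_intros)
  fix s0 assume "s0 \<in> ?S"
  then obtain r where r: "r > 0" "ball s0 r \<subseteq> ?S" using S open_contains_ball by blast
  show "\<exists>r>0. \<exists>C. ball s0 r \<subseteq> ?S \<and> (\<forall>s\<in>ball s0 r. \<forall>z\<in>ball 0 1. cmod (pw n s z) \<le> C * W d z)"
  proof (intro exI conjI ballI)
    fix s z :: complex assume s: "s \<in> ball s0 r" and z: "z \<in> ball 0 1"
    have "\<bar>Im s\<bar> \<le> \<bar>Im s0\<bar> + r" using abs_Im_le_cmod[of "s0 - s"] s by (auto simp: dist_norm)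
    then have e: "exp (pi / 2 * \<bar>Im s\<bar>) \<le> exp (pi / 2 * (\<bar>Im s0\<bar> + r))" by simp
    have "s \<in> ?S" using s r by blast
    then have "cmod (pw n s z) \<le> exp (pi / 2 * \<bar>Im s\<bar>) * (2 + 2 * cmod a) ^ n * W d z"
      using pw_bound[OF z d(1), of s n] by simp
    also have "\<dots> \<le> exp (pi / 2 * (\<bar>Im s0\<bar> + r)) * (2 + 2 * cmod a) ^ n * W d z"
      using e W_pos[OF z, of d] by (intro mult_right_mono) auto
    finally show "cmod (pw n s z) \<le> exp (pi / 2 * (\<bar>Im s0\<bar> + r)) * (2 + 2 * cmod a) ^ n * W d z" .
  qed (use r in auto)
qed

lemma pw_0_nz: "on_disc (pw 0 s) \<noteq> (\<lambda>t. 0)"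
  by (metis (no_types) centre_in_ball exp_not_eq_zero mult_1_right on_disc_simps(1) power_0 pw_def zero_less_one)

end

section \<open>Functionals annihilating the eigenfunctions\<close>

text \<open>After multiplication by an exponential the function becomes 1-periodic, hence a function of
  \<open>\<omega> = exp (2 \<pi> \<i> s)\<close>; the growth bound makes the singularity at \<open>0\<close> removable with value \<open>0\<close> and
  leaves growth \<open>|\<omega>|^\<gamma>\<close> with \<open>\<gamma> < 1\<close> at infinity.\<close>

lemma quasiperiodic_strip_zero:
  fixes E :: "complex \<Rightarrow> complex"
  assumes d: "0 < d" "d < 1" and hol: "E holomorphic_on {s. - d < Re s \<and> Re s < 1 + d}"
    and a: "Re a > 0"
    and per: "\<And>s. \<bar>Re s\<bar> < d \<Longrightarrow> E (s + 1) = - a * E s"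
    and bound: "\<And>s. - d < Re s \<Longrightarrow> Re s < 1 + d \<Longrightarrow> cmod (E s) \<le> C * exp (pi / 2 * \<bar>Im s\<bar>)"
    and s: "- d < Re s" "Re s < 1 + d"
  shows "E s = 0"
proof -
  define S where "S = {s. - d < Re s \<and> Re s < 1 + d}"
  have oS: "open S" unfolding S_def by (intro open_Collect_conj open_Collect_less continuous_intros)
  \<comment> \<open>The argument of \<open>a\<close>; Re a > 0 confines it to less than pi/2 in
    modulus.\<close>
  define \<alpha> where "\<alpha> = Im (Ln a)"
  have anz: "a \<noteq> 0" using a by auto
  have alpha: "\<bar>\<alpha>\<bar> < pi / 2" unfolding \<alpha>_def using a anz Re_Ln_pos_lt by blast
  \<comment> \<open>A step of length 1 multiplies this exponential by e^(i pi) / a = -1/a, which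
    cancels the multiplier -a of \<open>E\<close>.\<close>
  define G where "G = (\<lambda>s. exp (s * (\<i> * pi - Ln a)) * E s)"
  have holG: "G holomorphic_on S" unfolding G_def S_def by (intro holomorphic_intros hol)
  have "cmod (E 0) \<le> C" using bound[of 0] d by simp
  then have C0: "C \<ge> 0" by (rule order_trans[OF norm_ge_zero])
  have perG: "G (s + 1) = G s" if "\<bar>Re s\<bar> < d" for s
  proof -
    have "exp ((s + 1) * (\<i> * pi - Ln a)) = exp (s * (\<i> * pi - Ln a)) * (exp (\<i> * pi) / exp (Ln a))"
      by (simp only: distrib_right exp_add exp_diff mult_1_left)
    also have "\<dots> = exp (s * (\<i> * pi - Ln a)) * (- 1 / a)" using anz by simp
    finally show ?thesis using per[OF that] anz by (simp add: G_def)
  qed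
  define C1 where "C1 = C * exp (2 * \<bar>ln (cmod a)\<bar>)"
  have C10: "C1 \<ge> 0" using C0 by (simp add: C1_def)
  have boundG: "cmod (G s) \<le> C1 * exp (pi / 2 * \<bar>Im s\<bar> - (pi - \<alpha>) * Im s)" if "s \<in> S" for s
  proof -
    have "cmod (exp (s * (\<i> * pi - Ln a))) = exp (- Re s * ln (cmod a) - (pi - \<alpha>) * Im s)"
      using anz by (simp add: \<alpha>_def algebra_simps)
    also have "- Re s * ln (cmod a) \<le> \<bar>Re s\<bar> * \<bar>ln (cmod a)\<bar>"
      by (metis abs_ge_self abs_minus_cancel abs_mult)
    also have "\<dots> \<le> 2 * \<bar>ln (cmod a)\<bar>" using that d by (intro mult_right_mono) (auto simp: S_def)
    finally have "cmod (exp (s * (\<i> * pi - Ln a))) \<le> exp (2 * \<bar>ln (cmod a)\<bar> - (pi - \<alpha>) * Im s)" by simp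
    moreover have "cmod (E s) \<le> C * exp (pi / 2 * \<bar>Im s\<bar>)" using that bound by (auto simp: S_def)
    ultimately have "cmod (G s) \<le> exp (2 * \<bar>ln (cmod a)\<bar> - (pi - \<alpha>) * Im s) * (C * exp (pi / 2 * \<bar>Im s\<bar>))"
      unfolding G_def norm_mult by (intro mult_mono) auto
    also have "\<dots> = C1 * exp (pi / 2 * \<bar>Im s\<bar> - (pi - \<alpha>) * Im s)"
      by (simp add: C1_def exp_add[symmetric] exp_diff field_simps)
    finally show ?thesis .
  qed
  \<comment> \<open>The inverse of exp(2 pi i s) cut along the positive axis: this puts the real
    part in (0, 1], inside the strip.\<close>
  define l where "l = (\<lambda>\<omega>. (Ln (- \<omega>) + \<i> * pi) / (2 * pi * \<i>))"
  have l: "Re (l \<omega>) = (Im (Ln (- \<omega>)) + pi) / (2 * pi)" "Im (l \<omega>) = - ln (cmod \<omega>) / (2 * pi)"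
    "exp (2 * pi * \<i> * l \<omega>) = \<omega>" if "\<omega> \<noteq> 0" for \<omega>
  proof -
    show "Re (l \<omega>) = (Im (Ln (- \<omega>)) + pi) / (2 * pi)" "Im (l \<omega>) = - ln (cmod \<omega>) / (2 * pi)"
      using that by (simp_all add: l_def Re_divide Im_divide power2_eq_square field_simps)
    have "2 * pi * \<i> * l \<omega> = Ln (- \<omega>) + \<i> * pi" by (simp add: l_def)
    then show "exp (2 * pi * \<i> * l \<omega>) = \<omega>" using that by (simp add: exp_add)
  qed
  have Rel: "0 < Re (l \<omega>)" "Re (l \<omega>) \<le> 1" if "\<omega> \<noteq> 0" for \<omega>
    unfolding l(1)[OF that] using mpi_less_Im_Ln[of "- \<omega>"] Im_Ln_le_pi[of "- \<omega>"] that
    by (auto intro!: divide_pos_pos simp: divide_le_eq)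
  have lS: "l \<omega> \<in> S" if "\<omega> \<noteq> 0" for \<omega> using Rel[OF that] d by (simp add: S_def)
  define B where "B = (\<lambda>\<omega>. if \<omega> = 0 then 0 else G (l \<omega>))"
  \<comment> \<open>The two logarithms differ by an integer of modulus at most 1. If it is not 0,
    the one with the smaller real part lies in |Re| < d, where periodicity is known.\<close>
  have BG: "B (exp (2 * pi * \<i> * s)) = G s" if s: "s \<in> S" for s
  proof -
    let ?w = "exp (2 * pi * \<i> * s)"
    have w: "?w \<noteq> 0" by simp
    obtain k :: int where k: "2 * pi * \<i> * l ?w = 2 * pi * \<i> * s + of_int (2 * k) * of_real pi * \<i>"
      using l(3)[OF w] unfolding exp_eq by (auto simp: mult_ac)
    have "2 * pi * \<i> * l ?w = 2 * pi * \<i> * (s + of_int k)" unfolding k by (simp add: algebra_simps)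
    then have lk: "l ?w = s + of_int k" by simp
    then have "Re (l ?w) = Re s + of_int k" by simp
    then have "of_int k < (2::real)" "of_int k > (-2::real)"
      using Rel[OF w] s d unfolding S_def by auto
    then consider "k = 0" | "k = 1" | "k = -1" by linarith
    then show ?thesis
    proof cases
      case 1
      then show ?thesis using lk by (simp add: B_def)
    next
      case 2
      then have "\<bar>Re s\<bar> < d" using lk Rel[OF w] s d by (auto simp: S_def)
      then show ?thesis using perG[of s] lk 2 by (simp add: B_def)
    next
      case 3
      then have "\<bar>Re (l ?w)\<bar> < d" using lk Rel[OF w] s d by (auto simp: S_def)
      then show ?thesis using perG[of "l ?w"] lk 3 by (simp add: B_def)
    qed
  qed
  have holB: "B holomorphic_on UNIV - {0}"
  proof (rule holomorphic_onI)
    fix \<omega>0 :: complex assume "\<omega>0 \<in> UNIV - {0}"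
    then have w0: "\<omega>0 \<noteq> 0" by simp
    \<comment> \<open>\<open>l\<close> jumps across its cut; \<open>h\<close> is a branch that is
      continuous at this point, and \<open>BG\<close> shows that the value of \<open>B\<close> is
      the same for both.\<close>
    define h where "h = (\<lambda>\<omega>. l \<omega>0 + Ln (\<omega> / \<omega>0) / (2 * pi * \<i>))"
    have h0: "h \<omega>0 = l \<omega>0" using w0 by (simp add: h_def)
    have "(h has_field_derivative 1 / \<omega>0 / (2 * pi * \<i>)) (at \<omega>0)"
      unfolding h_def using w0 by (auto intro!: derivative_eq_intros)
    then have dh: "h field_differentiable (at \<omega>0)" by (auto simp: field_differentiable_def)
    have "G field_differentiable (at (h \<omega>0))"
      using holG oS lS[OF w0] h0 holomorphic_on_imp_differentiable_at by metis
    then have "(G \<circ> h) field_differentiable (at \<omega>0)" by (rule field_differentiable_compose[OF dh])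
    then obtain D where D: "(G \<circ> h has_field_derivative D) (at \<omega>0)" by (auto simp: field_differentiable_def)
    have "isCont h \<omega>0" using dh by (rule field_differentiable_imp_continuous_at)
    then have "(h \<longlongrightarrow> h \<omega>0) (nhds \<omega>0)" unfolding isCont_def tendsto_at_iff_tendsto_nhds .
    then have "\<forall>\<^sub>F \<omega> in nhds \<omega>0. h \<omega> \<in> S"
      by (rule topological_tendstoD[OF _ oS]) (simp only: h0 lS[OF w0])
    moreover have "\<forall>\<^sub>F \<omega> in nhds \<omega>0. \<omega> \<noteq> 0" using w0 by (intro t1_space_nhds) auto
    ultimately have "\<forall>\<^sub>F \<omega> in nhds \<omega>0. (G \<circ> h) \<omega> = B \<omega>"
    proof eventually_elim
      case (elim \<omega>)
      have "2 * pi * \<i> * h \<omega> = 2 * pi * \<i> * l \<omega>0 + Ln (\<omega> / \<omega>0)" by (simp add: h_def field_simps)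
      then have "exp (2 * pi * \<i> * h \<omega>) = \<omega>" using l(3)[OF w0] w0 elim by (simp add: exp_add)
      then show ?case using BG[OF elim(1)] by simp
    qed
    then have "(B has_field_derivative D) (at \<omega>0)" using D DERIV_cong_ev by blast
    then show "B field_differentiable (at \<omega>0 within UNIV - {0})"
      using field_differentiable_at_within field_differentiable_def by blast
  qed
  \<comment> \<open>Since |omega| = e^(-2 pi Im s), exponential type becomes a power of |omega|:
    beta for Im s >= 0, gamma for Im s <= 0. The bound on alpha is exactly what yields beta > 0 and
    gamma < 1.\<close>
  define \<beta> where "\<beta> = (pi / 2 - \<alpha>) / (2 * pi)"
  define \<gamma> where "\<gamma> = (3 * pi / 2 - \<alpha>) / (2 * pi)"
  have beta: "\<beta> > 0" using alpha by (simp add: \<beta>_def)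
  have gamma: "\<gamma> < 1" using alpha by (simp add: \<gamma>_def)
  have small: "cmod (B \<omega>) \<le> C1 * cmod \<omega> powr \<beta>" if "cmod \<omega> \<le> 1" for \<omega>
  proof (cases "\<omega> = 0")
    case False
    have ln0: "ln (cmod \<omega>) \<le> 0" using that False by simp
    define y where "y = Im (l \<omega>)"
    have y: "y = - ln (cmod \<omega>) / (2 * pi)" unfolding y_def by (rule l(2)[OF False])
    have "y \<ge> 0" unfolding y using ln0 by (intro divide_nonneg_pos) auto
    then have "\<bar>y\<bar> = y" by simp
    then have "pi / 2 * \<bar>y\<bar> - (pi - \<alpha>) * y = (pi / 2 - \<alpha>) * (- y)" by (simp add: algebra_simps)
    also have "\<dots> = \<beta> * ln (cmod \<omega>)" unfolding y \<beta>_def by simp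
    finally have "pi / 2 * \<bar>Im (l \<omega>)\<bar> - (pi - \<alpha>) * Im (l \<omega>) = \<beta> * ln (cmod \<omega>)" unfolding y_def .
    then show ?thesis using boundG[OF lS[OF False]] False by (simp add: B_def powr_def)
  qed (use C10 in \<open>simp add: B_def\<close>)
  have large: "cmod (B \<omega>) \<le> C1 * cmod \<omega> powr \<gamma>" if "1 \<le> cmod \<omega>" for \<omega>
  proof -
    have nz: "\<omega> \<noteq> 0" using that by auto
    have ln0: "ln (cmod \<omega>) \<ge> 0" using that by simp
    define y where "y = Im (l \<omega>)"
    have y: "y = - ln (cmod \<omega>) / (2 * pi)" unfolding y_def by (rule l(2)[OF nz])
    have "y \<le> 0" unfolding y using ln0 by (intro divide_nonpos_pos) auto
    then have "\<bar>y\<bar> = - y" by simp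
    then have "pi / 2 * \<bar>y\<bar> - (pi - \<alpha>) * y = (3 * pi / 2 - \<alpha>) * (- y)" by (simp add: algebra_simps)
    also have "\<dots> = \<gamma> * ln (cmod \<omega>)" unfolding y \<gamma>_def by simp
    finally have "pi / 2 * \<bar>Im (l \<omega>)\<bar> - (pi - \<alpha>) * Im (l \<omega>) = \<gamma> * ln (cmod \<omega>)" unfolding y_def .
    then show ?thesis using boundG[OF lS[OF nz]] nz by (simp add: B_def powr_def)
  qed
  have "(B \<longlongrightarrow> 0) (at 0)"
  proof (rule Lim_null_comparison)
    have "\<forall>\<^sub>F \<omega> in at (0::complex). \<omega> \<in> ball 0 1 - {0}" by (intro eventually_at_in_open) auto
    then show "\<forall>\<^sub>F \<omega> in at 0. cmod (B \<omega>) \<le> C1 * cmod \<omega> powr \<beta>"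
      by eventually_elim (use small in auto)
    have "((\<lambda>\<omega>::complex. C1 * cmod \<omega> powr \<beta>) \<longlongrightarrow> C1 * 0) (at 0)"
      using beta by (intro tendsto_mult tendsto_const tendsto_zero_powrI[where b = \<beta>] tendsto_norm_zero tendsto_ident_at) auto
    then show "((\<lambda>\<omega>::complex. C1 * cmod \<omega> powr \<beta>) \<longlongrightarrow> 0) (at 0)" by simp
  qed
  then have holB': "B holomorphic_on UNIV"
    using no_isolated_singularity'[of "{0}" B UNIV] holB by (simp add: B_def)
  \<comment> \<open>Growth of degree at most 1 with B(0) = 0 leaves a linear function; the sharper
    exponent gamma < 1 then forces its slope to vanish.\<close>
  have "cmod (B \<omega>) \<le> C1 * cmod \<omega> ^ 1" if "1 \<le> cmod \<omega>" for \<omega>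
  proof -
    have "cmod \<omega> powr \<gamma> \<le> cmod \<omega> powr 1" using that gamma by (intro powr_mono) auto
    then have "C1 * cmod \<omega> powr \<gamma> \<le> C1 * cmod \<omega> ^ 1" using C10 that by (intro mult_left_mono) auto
    then show ?thesis using large[OF that] by linarith
  qed
  note bdB = this
  have "B 0 = 0" by (simp add: B_def)
  then have lin: "B \<omega> = deriv B 0 * \<omega>" for \<omega>
    using Liouville_polynomial[where \<xi> = \<omega>, OF holB' bdB] by simp
  have small_deriv: "cmod (deriv B 0) \<le> C1 * t powr (\<gamma> - 1)" if "t \<ge> 1" for t :: real
  proof -
    have "cmod (deriv B 0) * t \<le> C1 * t powr \<gamma>"
      using large[of "of_real t"] that lin[of "of_real t"] by (simp add: norm_mult)
    then show ?thesis using that by (simp add: powr_diff field_simps)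
  qed
  have "\<forall>\<^sub>F t in at_top. cmod (deriv B 0) \<le> C1 * t powr (\<gamma> - 1)"
    using eventually_ge_at_top[of "1::real"] by eventually_elim (rule small_deriv)
  moreover have "((\<lambda>t. C1 * t powr (\<gamma> - 1)) \<longlongrightarrow> C1 * 0) at_top"
    using gamma by (intro tendsto_mult tendsto_const tendsto_neg_powr filterlim_ident) auto
  ultimately have "cmod (deriv B 0) \<le> C1 * 0"
    by (intro tendsto_lowerbound[of "\<lambda>t. C1 * t powr (\<gamma> - 1)" _ at_top]) auto
  then have "B \<omega> = 0" for \<omega> using lin[of \<omega>] by simp
  then have "G s = 0" using BG[of s] s by (simp add: S_def)
  then show ?thesis by (simp add: G_def)
qed

context two_circle_points begin

lemma pw_hardy:
  assumes "0 < p" "0 \<le> d" "d * p < 1" "- d < Re s" "Re s < n + d"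
  shows "on_disc (pw n s) \<in> hardy p"
  using vanalytic_pw[OF assms(1-3), of n] assms(4,5) by (auto simp: vanalytic_def)

lemma pw_shift:
  "on_disc (pw (Suc n) (s + 1)) = (\<lambda>t. on_disc (pw n s) t - a * on_disc (pw (Suc n) s) t)"
proof
  fix t show "on_disc (pw (Suc n) (s + 1)) t = on_disc (pw n s) t - a * on_disc (pw (Suc n) s) t"
  proof (cases "t \<in> ball 0 1")
    case True
    have "exp ((s + 1) * Ln (u t)) = exp (s * Ln (u t)) * u t"
      by (simp only: distrib_right exp_add mult_1_left exp_Ln[OF u_nz[OF True]])
    then have "pw (Suc n) (s + 1) t = exp (s * Ln (u t)) * (u t * q t) * q t ^ n"
      unfolding pw_def by (simp only: power_Suc mult_ac)
    also have "\<dots> = pw n s t - a * pw (Suc n) s t"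
      unfolding u_q[OF True] by (simp add: pw_def algebra_simps)
    finally show ?thesis using True by simp
  qed simp
qed

lemma hp_dual_pw_zero:
  assumes p: "0 < p" and L: "\<Lambda> \<in> hp_dual p" and d: "0 < d" "d < 1" "d * p < 1"
    and z: "\<And>s. \<bar>Re s\<bar> < d \<Longrightarrow> \<Lambda> (on_disc (pw 0 s)) = 0"
  shows "\<bar>Re s\<bar> < d \<Longrightarrow> \<Lambda> (on_disc (pw n s)) = 0"
proof (induction n arbitrary: s)
  case (Suc n)
  have d0: "0 \<le> d" using d by simp
  define E where "E = (\<lambda>s. \<Lambda> (on_disc (pw (Suc n) s)))"
  obtain M where M: "0 \<le> M" "\<And>f. f \<in> hardy p \<Longrightarrow> cmod (\<Lambda> f) \<le> M * hp_norm p f"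
    using hp_dual_bounded[OF L] by blast
  obtain K where K: "0 \<le> K" "\<And>f C. f holomorphic_on ball 0 1 \<Longrightarrow> 0 \<le> C \<Longrightarrow> (\<And>z. z \<in> ball 0 1 \<Longrightarrow> cmod (f z) \<le> C * W d z)
      \<Longrightarrow> on_disc f \<in> hardy p \<and> hp_norm p (on_disc f) \<le> C * K"
    using dominated_hardy[OF p d0 d(3)] by metis
  have "E s = 0"
  proof (rule quasiperiodic_strip_zero[of d E a])
    \<comment> \<open>For \<open>Suc n\<close> the admissible strip reaches Re s < n + 1 + d, so it
      contains the strip of width 1 + 2d needed here.\<close>
    show "E holomorphic_on {s. - d < Re s \<and> Re s < 1 + d}"
      unfolding E_def
      by (rule holomorphic_on_subset[OF hp_dual_holomorphic[OF p L vanalytic_pw[OF p d0 d(3), of "Suc n"]]]) auto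
    show "Re a > 0" using Re_a by simp
    show "E (s + 1) = - a * E s" if s: "\<bar>Re s\<bar> < d" for s
    proof -
      have h: "on_disc (pw n s) \<in> hardy p" "on_disc (pw (Suc n) s) \<in> hardy p"
        using s by (auto intro!: pw_hardy[OF p d0 d(3)])
      have "E (s + 1) = \<Lambda> (on_disc (pw n s)) - a * E s"
        unfolding E_def pw_shift
        by (simp only: hp_dual_diff[OF p L h(1) hardy_cmult[OF p h(2)]] hp_dual_cmult[OF L h(2)])
      then show ?thesis using Suc.IH[OF s] by simp
    qed
    show "cmod (E s) \<le> M * K * (2 + 2 * cmod a) ^ Suc n * exp (pi / 2 * \<bar>Im s\<bar>)"
      if s: "- d < Re s" "Re s < 1 + d" for s
    proof -
      let ?C = "exp (pi / 2 * \<bar>Im s\<bar>) * (2 + 2 * cmod a) ^ Suc n"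
      have "on_disc (pw (Suc n) s) \<in> hardy p \<and> hp_norm p (on_disc (pw (Suc n) s)) \<le> ?C * K"
        using s d0 by (intro K(2) holomorphic_pw pw_bound) auto
      then have "cmod (E s) \<le> M * (?C * K)"
        unfolding E_def by (intro order_trans[OF M(2) mult_left_mono[OF _ M(1)]]) simp_all
      then show ?thesis by (simp add: mult_ac)
    qed
  qed (use d Suc.prems in auto)
  then show ?case by (simp add: E_def)
qed (use z in auto)

text \<open>The parameter s = 0 yields the powers of \<open>q\<close>, and z = zeta2 (1 - q) trades
  each factor z for a difference of two powers of \<open>q\<close>. The extra factor q^n keeps the
  induction on k closed.\<close>

lemma hp_dual_zero_of_pw:
  assumes p: "1 < p" and L: "\<Lambda> \<in> hp_dual p" and d: "0 < d" "d < 1" "d * p < 1"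
    and z: "\<And>s. \<bar>Re s\<bar> < d \<Longrightarrow> \<Lambda> (on_disc (pw 0 s)) = 0"
  shows "\<Lambda> = (\<lambda>f. 0)"
proof
  fix f
  have p0: "0 < p" using p by simp
  have "on_disc (\<lambda>z. z ^ k * q z ^ n) \<in> hardy p \<and> \<Lambda> (on_disc (\<lambda>z. z ^ k * q z ^ n)) = 0" for k n
  proof (induction k arbitrary: n)
    case 0
    have "on_disc (\<lambda>z. z ^ 0 * q z ^ n) = on_disc (pw n 0)" by (auto simp: on_disc_def pw_def)
    moreover have "on_disc (pw n 0) \<in> hardy p"
      using d by (intro pw_hardy[OF p0 less_imp_le[OF d(1)] d(3)]) auto
    moreover have "\<Lambda> (on_disc (pw n 0)) = 0"
      by (rule hp_dual_pw_zero[OF p0 L d z]) (use d in auto)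
    ultimately show ?case by (simp only: simp_thms)
  next
    case (Suc k)
    have e: "on_disc (\<lambda>z. z ^ Suc k * q z ^ n)
        = (\<lambda>t. \<zeta>2 * (on_disc (\<lambda>z. z ^ k * q z ^ n) t - on_disc (\<lambda>z. z ^ k * q z ^ Suc n) t))"
    proof
      fix t
      have t: "\<zeta>2 * (1 - q t) = t" using zeta_nz by (simp add: q_def)
      have "\<zeta>2 * (t ^ k * q t ^ n - t ^ k * q t ^ Suc n) = \<zeta>2 * (1 - q t) * (t ^ k * q t ^ n)"
        by (simp add: algebra_simps)
      then have "t ^ Suc k * q t ^ n = \<zeta>2 * (t ^ k * q t ^ n - t ^ k * q t ^ Suc n)"
        unfolding t by simp
      then show "on_disc (\<lambda>z. z ^ Suc k * q z ^ n) t
          = \<zeta>2 * (on_disc (\<lambda>z. z ^ k * q z ^ n) t - on_disc (\<lambda>z. z ^ k * q z ^ Suc n) t)"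
        unfolding on_disc_def by simp
    qed
    define A B where "A = on_disc (\<lambda>z. z ^ k * q z ^ n)" and "B = on_disc (\<lambda>z. z ^ k * q z ^ Suc n)"
    have AB: "A \<in> hardy p" "B \<in> hardy p" "\<Lambda> A = 0" "\<Lambda> B = 0"
      using Suc.IH[of n] Suc.IH[of "Suc n"] unfolding A_def B_def by blast+
    have AB': "(\<lambda>t. A t - B t) \<in> hardy p" by (rule hardy_diff[OF p0 AB(1,2)])
    have "\<Lambda> (\<lambda>t. \<zeta>2 * (A t - B t)) = 0"
      using hp_dual_cmult[OF L AB', of \<zeta>2] hp_dual_diff[OF p0 L AB(1,2)] AB(3,4) by simp
    then show ?case
      unfolding e using hardy_cmult[OF p0 AB', of \<zeta>2] by (simp only: A_def B_def simp_thms)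
  qed
  note all = this
  have "\<Lambda> (on_disc (\<lambda>z. z ^ k)) = 0" for k
    using all[of k 0] by (simp only: power_0 mult_1_right simp_thms)
  then show "\<Lambda> f = 0" by (rule hp_dual_eq_zero[OF p L])
qed

end

section \<open>Analyticity in the dual and iterates of the automorphism\<close>

lemma hardy_zero:
  assumes "0 < p"
  shows "(\<lambda>t. 0) \<in> hardy p" "hp_norm p (\<lambda>t. 0) = 0"
proof -
  have "on_disc (\<lambda>t. 0) = (\<lambda>t. 0)" by (auto simp: on_disc_def)
  then show "(\<lambda>t. 0) \<in> hardy p" "hp_norm p (\<lambda>t. 0) = 0"
    using hardy_bounded[OF assms, of "\<lambda>t. 0" 0] hp_norm_nonneg[of p "\<lambda>t. 0"] by auto
qed

lemma hp_dualI:
  assumes "\<And>f g. f \<in> hardy p \<Longrightarrow> g \<in> hardy p \<Longrightarrow> \<Lambda> (\<lambda>t. f t + g t) = \<Lambda> f + \<Lambda> g"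
    and "\<And>c f. f \<in> hardy p \<Longrightarrow> \<Lambda> (\<lambda>t. c * f t) = c * \<Lambda> f"
    and "\<And>f. f \<in> hardy p \<Longrightarrow> cmod (\<Lambda> f) \<le> C * hp_norm p f"
    and "\<And>f. f \<notin> hardy p \<Longrightarrow> \<Lambda> f = 0"
  shows "\<Lambda> \<in> hp_dual p"
  using assms unfolding hp_dual_def by blast

text \<open>Stated for any function with a linear bound, so that remainders of difference quotients
  are covered directly; the bound keeps the supremum finite.\<close>

lemma dual_norm_bounds:
  assumes p: "0 < p" and B: "0 \<le> B" "\<And>f. f \<in> hardy p \<Longrightarrow> cmod (\<Lambda> f) \<le> B * hp_norm p f"
  shows "0 \<le> dual_norm p \<Lambda>" "dual_norm p \<Lambda> \<le> B" "\<And>f. f \<in> hardy p \<Longrightarrow> hp_norm p f \<le> 1 \<Longrightarrow> cmod (\<Lambda> f) \<le> dual_norm p \<Lambda>"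
proof -
  let ?U = "{f \<in> hardy p. hp_norm p f \<le> 1}"
  have zero: "(\<lambda>t. 0) \<in> ?U" using hardy_zero[OF p] by simp
  have le: "cmod (\<Lambda> f) \<le> B" if "f \<in> ?U" for f
    using B(2)[of f] that mult_left_mono[of "hp_norm p f" 1 B] B(1) by simp
  show "dual_norm p \<Lambda> \<le> B"
    unfolding dual_norm_def using zero le by (intro cSUP_least) auto
  show up: "cmod (\<Lambda> f) \<le> dual_norm p \<Lambda>" if "f \<in> hardy p" "hp_norm p f \<le> 1" for f
    unfolding dual_norm_def using that le by (intro cSUP_upper bdd_aboveI2[of _ _ B]) auto
  show "0 \<le> dual_norm p \<Lambda>"
    using up[of "\<lambda>t. 0"] zero norm_ge_zero order_trans by blast
qed

lemma dual_norm_diff_zero: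
  assumes p: "0 < p" and L: "\<Lambda> \<in> hp_dual p" and z: "dual_norm p (\<lambda>f. 0 - \<Lambda> f) = 0"
  shows "\<Lambda> = (\<lambda>f. 0)"
proof
  fix f
  obtain C where C: "0 \<le> C" "\<And>f. f \<in> hardy p \<Longrightarrow> cmod (\<Lambda> f) \<le> C * hp_norm p f"
    using hp_dual_bounded[OF L] by blast
  show "\<Lambda> f = 0"
  proof (cases "f \<in> hardy p")
    case True
    \<comment> \<open>The 1 in the denominator moves \<open>f\<close> into the unit ball even if its
      norm is 0.\<close>
    define c where "c = 1 / (hp_norm p f + 1)"
    have c: "c > 0" "c * hp_norm p f \<le> 1"
      using hp_norm_nonneg[of p f] by (auto simp: c_def divide_le_eq add_nonneg_pos)
    let ?g = "\<lambda>t. of_real c * f t"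
    have "?g \<in> hardy p" "hp_norm p ?g \<le> 1"
      using hardy_cmult_le[OF p True, of "of_real c"] c by auto
    then have "cmod (0 - \<Lambda> ?g) \<le> 0"
      using dual_norm_bounds(3)[OF p C(1), of "\<lambda>f. 0 - \<Lambda> f" ?g] C(2) z by simp
    then show ?thesis using hp_dual_cmult[OF L True, of "of_real c"] c by simp
  qed (rule hp_dual_outside[OF L])
qed

text \<open>Weak holomorphy plus local boundedness gives norm differentiability, because Cauchy's estimate for
  the difference quotient is uniform over the unit ball.\<close>

lemma vanalytic_hp_dualI:
  assumes p: "0 < p" and S: "open S" and F: "\<And>z. z \<in> S \<Longrightarrow> F z \<in> hp_dual p"
    and hol: "\<And>g. g \<in> hardy p \<Longrightarrow> (\<lambda>z. F z g) holomorphic_on S"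
    and dom: "\<And>z0. z0 \<in> S \<Longrightarrow> \<exists>r>0. \<exists>C\<ge>0. ball z0 r \<subseteq> S \<and> (\<forall>z\<in>ball z0 r. \<forall>g\<in>hardy p. cmod (F z g) \<le> C * hp_norm p g)"
  shows "vanalytic (dual_norm p) (hp_dual p) S F"
proof -
  have "\<exists>G\<in>hp_dual p. ((\<lambda>w. dual_norm p (\<lambda>t. (F w t - F z0 t) / (w - z0) - G t)) \<longlongrightarrow> 0) (at z0)"
    if z0: "z0 \<in> S" for z0
  proof -
    obtain r C where r: "r > 0" "ball z0 r \<subseteq> S" and C0: "C \<ge> 0"
      and C: "\<And>z g. z \<in> ball z0 r \<Longrightarrow> g \<in> hardy p \<Longrightarrow> cmod (F z g) \<le> C * hp_norm p g"
      using dom[OF z0] by blast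
    define G where "G = (\<lambda>g. if g \<in> hardy p then deriv (\<lambda>z. F z g) z0 else 0)"
    have der: "((\<lambda>z. F z g) has_field_derivative G g) (at z0)" if "g \<in> hardy p" for g
      using holomorphic_derivI[OF hol[OF that] S z0] that by (simp add: G_def)
    define Q where "Q = (\<lambda>w g. (F w g - F z0 g) / (w - z0) - G g)"
    have Q: "cmod (Q w g) \<le> 32 * C / r\<^sup>2 * dist z0 w * hp_norm p g"
      if w: "dist z0 w < r/2" "w \<noteq> z0" and g: "g \<in> hardy p" for w g
    proof -
      have "(\<lambda>z. F z g) holomorphic_on ball z0 r" using hol[OF g] r(2) by (rule holomorphic_on_subset)
      from holomorphic_difference_quotient_bound[OF this r(1) C[OF _ g] der[OF g] w]
      show ?thesis by (simp add: Q_def mult_ac)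
    qed
    define w1 where "w1 = z0 + of_real (r/4)"
    have w1: "dist z0 w1 < r/2" "w1 \<noteq> z0" "w1 \<in> ball z0 r" "cmod (w1 - z0) = r/4" "dist z0 w1 = r/4"
      using r by (auto simp: w1_def dist_norm)
    have "G \<in> hp_dual p"
    proof (rule hp_dualI)
      fix f g assume f: "f \<in> hardy p" and g: "g \<in> hardy p"
      have "((\<lambda>z. F z (\<lambda>t. f t + g t)) has_field_derivative G f + G g) (at z0)"
        by (rule has_field_derivative_transform_within_open[OF DERIV_add[OF der[OF f] der[OF g]] S z0])
           (simp add: hp_dual_add[OF F f g])
      then show "G (\<lambda>t. f t + g t) = G f + G g" using der[OF hardy_add[OF p f g]] DERIV_unique by blast
    next
      fix c f assume f: "f \<in> hardy p"
      have "((\<lambda>z. F z (\<lambda>t. c * f t)) has_field_derivative c * G f) (at z0)"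
        by (rule has_field_derivative_transform_within_open[OF DERIV_cmult[OF der[OF f]] S z0])
           (simp add: hp_dual_cmult[OF F f])
      then show "G (\<lambda>t. c * f t) = c * G f" using der[OF hardy_cmult[OF p f]] DERIV_unique by blast
      \<comment> \<open>Boundedness of the weak derivative is read off a single difference quotient,
        at distance r/4: (C + C) / (r/4) = 8 C / r.\<close>
      have "G f = (F w1 f - F z0 f) / (w1 - z0) - Q w1 f" by (simp add: Q_def)
      also have "cmod \<dots> \<le> cmod ((F w1 f - F z0 f) / (w1 - z0)) + cmod (Q w1 f)" by (rule norm_triangle_ineq4)
      also have "cmod ((F w1 f - F z0 f) / (w1 - z0)) \<le> (C * hp_norm p f + C * hp_norm p f) / (r/4)"
        unfolding norm_divide w1(4) using r w1(3)
        by (intro divide_right_mono norm_triangle_le_diff add_mono C f) auto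
      also have "cmod (Q w1 f) \<le> 32 * C / r\<^sup>2 * (r/4) * hp_norm p f" using Q[OF w1(1,2) f] w1(5) by simp
      finally show "cmod (G f) \<le> (8 * C / r + 32 * C / r\<^sup>2 * (r/4)) * hp_norm p f" by (simp add: algebra_simps)
    qed (simp add: G_def)
    moreover have "((\<lambda>w. dual_norm p (Q w)) \<longlongrightarrow> 0) (at z0)"
    proof (rule Lim_null_comparison)
      have "\<forall>\<^sub>F w in at z0. w \<in> ball z0 (r/2) - {z0}" using r by (intro eventually_at_in_open) auto
      then show "\<forall>\<^sub>F w in at z0. norm (dual_norm p (Q w)) \<le> 32 * C / r\<^sup>2 * dist z0 w"
      proof eventually_elim
        case (elim w)
        then show ?case
          using dual_norm_bounds(1,2)[OF p, of "32 * C / r\<^sup>2 * dist z0 w" "Q w"] Q C0 by simp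
      qed
      have "((\<lambda>w. 32 * C / r\<^sup>2 * dist z0 w) \<longlongrightarrow> 32 * C / r\<^sup>2 * dist z0 z0) (at z0)"
        by (intro tendsto_intros)
      then show "((\<lambda>w. 32 * C / r\<^sup>2 * dist z0 w) \<longlongrightarrow> 0) (at z0)" by simp
    qed
    ultimately show ?thesis unfolding Q_def by blast
  qed
  then show ?thesis using S F unfolding vanalytic_def by blast
qed

lemma comp_op_add: "comp_op \<psi> (\<lambda>t. f t + g t) = (\<lambda>t. comp_op \<psi> f t + comp_op \<psi> g t)"
  and comp_op_cmult: "comp_op \<psi> (\<lambda>t. c * f t) = (\<lambda>t. c * comp_op \<psi> f t)"
  by (auto simp: comp_op_def)

text \<open>Both Neumann series are instances: coefficients of size R^n against powers of w are
  dominated by a geometric series of ratio R |w|.\<close>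

lemma hp_dual_power_series:
  assumes p: "0 < p" and R: "0 < R" and M: "0 \<le> M"
    and c: "\<And>n. c n \<in> hp_dual p" "\<And>n g. g \<in> hardy p \<Longrightarrow> cmod (c n g) \<le> M * R ^ n * hp_norm p g"
  shows "\<And>w g. cmod w < 1 / R \<Longrightarrow> g \<in> hardy p \<Longrightarrow> summable (\<lambda>n. c n g * w ^ n)"
    and "\<And>w g. cmod w < 1 / R \<Longrightarrow> g \<in> hardy p \<Longrightarrow> cmod (\<Sum>n. c n g * w ^ n) \<le> M / (1 - R * cmod w) * hp_norm p g"
    and "\<And>w. cmod w < 1 / R \<Longrightarrow> (\<lambda>g. \<Sum>n. c n g * w ^ n) \<in> hp_dual p"
    and "\<And>g. g \<in> hardy p \<Longrightarrow> (\<lambda>w. \<Sum>n. c n g * w ^ n) holomorphic_on ball 0 (1 / R)"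
proof -
  have geo: "(\<lambda>n. M * hp_norm p g * (R * cmod w) ^ n) sums (M / (1 - R * cmod w) * hp_norm p g)"
    if "cmod w < 1 / R" for w g
  proof -
    have "norm (R * cmod w) < 1" using that R by (simp add: abs_mult field_simps)
    from sums_mult[OF geometric_sums[OF this], of "M * hp_norm p g"] show ?thesis by simp
  qed
  have le: "cmod (c n g * w ^ n) \<le> M * hp_norm p g * (R * cmod w) ^ n" if "g \<in> hardy p" for n g w
    using mult_right_mono[OF c(2)[OF that, of n], of "cmod w ^ n"]
    by (simp add: norm_mult norm_power power_mult_distrib mult_ac)
  show sm: "summable (\<lambda>n. c n g * w ^ n)" if "cmod w < 1 / R" "g \<in> hardy p" for w g
    by (rule summable_comparison_test'[OF sums_summable[OF geo[OF that(1), of g]] le[OF that(2)]])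
  show bd: "cmod (\<Sum>n. c n g * w ^ n) \<le> M / (1 - R * cmod w) * hp_norm p g" if "cmod w < 1 / R" "g \<in> hardy p" for w g
    using norm_suminf_le[OF le[OF that(2)] sums_summable[OF geo[OF that(1), of g]]]
      sums_unique[OF geo[OF that(1), of g]] by simp
  show "(\<lambda>g. \<Sum>n. c n g * w ^ n) \<in> hp_dual p" if w: "cmod w < 1 / R" for w
  proof (rule hp_dualI[OF _ _ bd[OF w]])
    fix f g assume f: "f \<in> hardy p" and g: "g \<in> hardy p"
    show "(\<Sum>n. c n (\<lambda>t. f t + g t) * w ^ n) = (\<Sum>n. c n f * w ^ n) + (\<Sum>n. c n g * w ^ n)"
      unfolding hp_dual_add[OF c(1) f g] distrib_right
      by (rule suminf_add[symmetric]) (auto intro: sm w f g)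
  next
    fix b f assume f: "f \<in> hardy p"
    show "(\<Sum>n. c n (\<lambda>t. b * f t) * w ^ n) = b * (\<Sum>n. c n f * w ^ n)"
      unfolding hp_dual_cmult[OF c(1) f] mult.assoc by (rule suminf_mult) (auto intro: sm w f)
  next
    fix f assume "f \<notin> hardy p"
    then have "c n f = 0" for n by (rule hp_dual_outside[OF c(1)])
    then show "(\<Sum>n. c n f * w ^ n) = 0" by simp
  qed
  show "(\<lambda>w. \<Sum>n. c n g * w ^ n) holomorphic_on ball 0 (1 / R)" if g: "g \<in> hardy p" for g
    by (rule power_series_holomorphic[where a = "\<lambda>n. c n g"])
       (use sm[OF _ g] in \<open>auto simp: summable_sums\<close>)
qed

section \<open>The dilation flow of the half-plane and its action on H^p and the dual\<close>

context two_circle_points begin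

text \<open>The one-parameter group of dilations carried back to the disc. Real time treats positive
  and negative iterates of the automorphism alike, as times n tau and -n tau.\<close>

definition psi :: "real \<Rightarrow> complex \<Rightarrow> complex" where
  "psi x z = u_inv (of_real (exp x) * u z)"

lemma psi:
  assumes "z \<in> ball 0 1"
  shows "psi x z \<in> ball 0 1" "u (psi x z) = of_real (exp x) * u z"
  using u_inv[of "of_real (exp x) * u z"] Re_u_pos[OF assms] by (simp_all add: psi_def del: mem_ball_0)

lemma psi_psi: "z \<in> ball 0 1 \<Longrightarrow> psi x (psi y z) = psi (x + y) z"
  by (simp add: psi_def[of x] psi(2)) (simp add: psi_def exp_add mult_ac)

lemma psi_0: "z \<in> ball 0 1 \<Longrightarrow> psi 0 z = z"
  by (simp add: psi_def u_inv_u)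

lemma holomorphic_psi: "psi x holomorphic_on ball 0 1"
proof -
  have "u_inv \<circ> (\<lambda>z. of_real (exp x) * u z) holomorphic_on ball 0 1"
    using Re_u_pos by (intro holomorphic_on_compose_gen[OF _ holomorphic_u_inv] holomorphic_intros holomorphic_u) auto
  then show ?thesis by (simp add: psi_def[abs_def] o_def)
qed

text \<open>By \<open>u_inv\<close>, 1 - |psi x 0|^2 equals e^x / |e^x u(0) + a|^2, because Re u(0)
  = 1/2. One factor 4 comes from (1 + t)^2, the other from \<open>kk\<close>.\<close>

lemma psi_at_0_le: "(1 + cmod (psi x 0)) / (1 - cmod (psi x 0)) \<le> 16 * (1 + cmod a)\<^sup>2 * exp \<bar>x\<bar>"
proof -
  define k where "k = exp x"
  define t where "t = cmod (psi x 0)"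
  have k: "k > 0" by (simp add: k_def)
  have t: "0 \<le> t" "t < 1" using psi(1)[of 0 x] by (auto simp: t_def)
  have Rv: "Re (of_real k * u 0) = k / 2" using Re_a by (simp add: u_0)
  have e: "1 - t\<^sup>2 = k / (cmod (of_real k * u 0 + a))\<^sup>2"
    using u_inv(3)[of "of_real k * u 0"] k unfolding Rv by (simp add: t_def psi_def k_def)
  have "cmod (of_real k * u 0 + a) \<le> k * cmod (u 0) + cmod a"
    using norm_triangle_ineq[of "of_real k * u 0" a] k by (simp add: norm_mult)
  also have "\<dots> \<le> k * (1 + cmod a) + (1 + cmod a)"
    using norm_triangle_ineq4[of 1 a] k by (intro add_mono mult_left_mono) (auto simp: u_0)
  finally have "cmod (of_real k * u 0 + a) \<le> (k + 1) * (1 + cmod a)" by (simp add: algebra_simps)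
  then have le: "(cmod (of_real k * u 0 + a))\<^sup>2 \<le> (k + 1)\<^sup>2 * (1 + cmod a)\<^sup>2"
    unfolding power_mult_distrib[symmetric] by (intro power_mono) auto
  \<comment> \<open>The left side is unchanged under k -> 1/k, which is why |x| appears.\<close>
  have kk: "(k + 1)\<^sup>2 / k \<le> 4 * exp \<bar>x\<bar>"
  proof (cases "x \<ge> 0")
    case True
    then have "1 \<le> k" by (simp add: k_def)
    then have "(k + 1)\<^sup>2 \<le> (2 * k)\<^sup>2" by (intro power_mono) auto
    then show ?thesis using True k by (simp add: k_def[symmetric] field_simps power2_eq_square)
  next
    case False
    then have "k \<le> 1" "exp \<bar>x\<bar> = 1 / k" by (auto simp: k_def exp_minus divide_inverse)
    moreover from this have "(k + 1)\<^sup>2 \<le> 2\<^sup>2" using k by (intro power_mono) auto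
    ultimately show ?thesis using k by (simp add: field_simps)
  qed
  have pos: "0 < 1 - t\<^sup>2" using t by (simp add: abs_square_less_1)
  have "(1 + t) / (1 - t) = (1 + t)\<^sup>2 / (1 - t\<^sup>2)"
    using t pos by (simp add: field_simps power2_eq_square)
  also have "\<dots> \<le> 2\<^sup>2 / (1 - t\<^sup>2)" using t pos by (intro divide_right_mono power_mono) auto
  also have "\<dots> = 4 * ((cmod (of_real k * u 0 + a))\<^sup>2 / k)" unfolding e by simp
  also have "\<dots> \<le> 4 * ((k + 1)\<^sup>2 * (1 + cmod a)\<^sup>2 / k)"
    using le k by (intro mult_left_mono divide_right_mono) auto
  also have "\<dots> = 4 * (1 + cmod a)\<^sup>2 * ((k + 1)\<^sup>2 / k)" by simp
  also have "\<dots> \<le> 4 * (1 + cmod a)\<^sup>2 * (4 * exp \<bar>x\<bar>)" using kk by (intro mult_left_mono) auto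
  finally show ?thesis by (simp add: t_def)
qed

lemma comp_psi_hardy:
  assumes p: "1 \<le> p" and f: "f \<in> hardy p"
  shows "comp_op (psi x) f \<in> hardy p"
    "hp_norm p (comp_op (psi x) f) \<le> (16 * (1 + cmod a)\<^sup>2) powr (1 / p) * exp (\<bar>x\<bar> / p) * hp_norm p f"
proof -
  have c: "comp_op (psi x) f \<in> hardy p \<and>
    hp_norm p (comp_op (psi x) f) \<le> ((1 + cmod (psi x 0)) / (1 - cmod (psi x 0))) powr (1 / p) * hp_norm p f"
    by (rule hardy_compose[OF p f holomorphic_psi psi(1)])
  then show "comp_op (psi x) f \<in> hardy p" by simp
  have "cmod (psi x 0) < 1" using psi(1)[of 0 x] by simp
  then have "((1 + cmod (psi x 0)) / (1 - cmod (psi x 0))) powr (1 / p) \<le> (16 * (1 + cmod a)\<^sup>2 * exp \<bar>x\<bar>) powr (1 / p)"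
    using psi_at_0_le p by (intro powr_mono2) auto
  also have "\<dots> = (16 * (1 + cmod a)\<^sup>2) powr (1 / p) * exp (\<bar>x\<bar> / p)"
    by (simp add: powr_mult powr_def[of "exp \<bar>x\<bar>"])
  finally have "((1 + cmod (psi x 0)) / (1 - cmod (psi x 0))) powr (1 / p) * hp_norm p f
      \<le> (16 * (1 + cmod a)\<^sup>2) powr (1 / p) * exp (\<bar>x\<bar> / p) * hp_norm p f"
    by (rule mult_right_mono) (rule hp_norm_nonneg)
  then show "hp_norm p (comp_op (psi x) f) \<le> (16 * (1 + cmod a)\<^sup>2) powr (1 / p) * exp (\<bar>x\<bar> / p) * hp_norm p f"
    using c by linarith
qed

lemma adjoint_psi:
  assumes p: "1 \<le> p" and L: "\<Lambda> \<in> hp_dual p"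
  obtains M where "0 \<le> M" "\<And>x. adjoint_comp_op p (psi x) \<Lambda> \<in> hp_dual p"
    "\<And>x g. g \<in> hardy p \<Longrightarrow> cmod (adjoint_comp_op p (psi x) \<Lambda> g) \<le> M * exp (\<bar>x\<bar> / p) * hp_norm p g"
proof -
  have p0: "0 < p" using p by simp
  obtain C where C: "0 \<le> C" "\<And>f. f \<in> hardy p \<Longrightarrow> cmod (\<Lambda> f) \<le> C * hp_norm p f"
    using hp_dual_bounded[OF L] by blast
  define M where "M = C * (16 * (1 + cmod a)\<^sup>2) powr (1 / p)"
  have M0: "0 \<le> M" using C by (simp add: M_def)
  have bd: "cmod (adjoint_comp_op p (psi x) \<Lambda> g) \<le> M * exp (\<bar>x\<bar> / p) * hp_norm p g" if "g \<in> hardy p" for x g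
    using order_trans[OF C(2)[OF comp_psi_hardy(1)[OF p that]] mult_left_mono[OF comp_psi_hardy(2)[OF p that, of x] C(1)]] that
    by (simp add: adjoint_comp_op_def M_def mult_ac)
  have "adjoint_comp_op p (psi x) \<Lambda> \<in> hp_dual p" for x
  proof (rule hp_dualI[OF _ _ bd])
    fix f g assume f: "f \<in> hardy p" and g: "g \<in> hardy p"
    then show "adjoint_comp_op p (psi x) \<Lambda> (\<lambda>t. f t + g t) = adjoint_comp_op p (psi x) \<Lambda> f + adjoint_comp_op p (psi x) \<Lambda> g"
      using hp_dual_add[OF L comp_psi_hardy(1)[OF p f] comp_psi_hardy(1)[OF p g]] hardy_add[OF p0 f g]
      by (simp add: adjoint_comp_op_def comp_op_add)
  next
    fix c f assume f: "f \<in> hardy p"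
    then show "adjoint_comp_op p (psi x) \<Lambda> (\<lambda>t. c * f t) = c * adjoint_comp_op p (psi x) \<Lambda> f"
      using hp_dual_cmult[OF L comp_psi_hardy(1)[OF p f]] hardy_cmult[OF p0 f]
      by (simp add: adjoint_comp_op_def comp_op_cmult)
  qed (simp_all add: adjoint_comp_op_def)
  then show ?thesis using that M0 bd by blast
qed

end

section \<open>Local spectra\<close>

lemma half_plane_multiplier:
  assumes "\<And>v. Re v > 0 \<Longrightarrow> Re (\<kappa> * v) > 0"
  shows "Im \<kappa> = 0" "Re \<kappa> > 0"
proof -
  show "Re \<kappa> > 0" using assms[of 1] by simp
  show "Im \<kappa> = 0"
  proof (rule ccontr)
    assume "Im \<kappa> \<noteq> 0"
    \<comment> \<open>The test point makes the real part of the product equal to -1.\<close>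
    then show False using assms[of "Complex 1 ((Re \<kappa> + 1) / Im \<kappa>)"] by simp
  qed
qed

lemma not_in_local_spectrumI:
  assumes "vanalytic N X U F" "\<And>z. z \<in> U \<Longrightarrow> (\<lambda>t. T (F z) t - z * F z t) = x" "z \<in> U"
  shows "z \<notin> local_spectrum X N T x"
proof -
  have "U \<in> {U. \<exists>F. vanalytic N X U F \<and> (\<forall>z\<in>U. (\<lambda>t. T (F z) t - z * F z t) = x)}"
    using assms(1,2) by (intro CollectI exI[of _ F] conjI ballI)
  then show ?thesis unfolding local_spectrum_def using assms(3) by blast
qed

text \<open>The sign of \<open>\<tau>\<close> stays open: positive if zeta2 is the attracting fixed
  point, negative if zeta1 is. The estimates therefore involve |tau|.\<close>

locale hyperbolic_automorphism_coordinates = two_circle_points +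
  fixes \<phi> :: "complex \<Rightarrow> complex" and \<tau> :: real
  assumes tau_nz: "\<tau> \<noteq> 0" and phi: "z \<in> ball 0 1 \<Longrightarrow> \<phi> z = psi \<tau> z"

lemma hyperbolic_automorphism_coordinates_exist:
  assumes "hyperbolic_automorphism \<phi>"
  obtains \<zeta>1 \<zeta>2 \<tau> where "hyperbolic_automorphism_coordinates \<zeta>1 \<zeta>2 \<phi> \<tau>"
proof -
  obtain A B C D where coeffs: "A * D - B * C \<noteq> 0 \<and> (\<forall>z. \<phi> z = (A * z + B) / (C * z + D)) \<and>
        (\<forall>z\<in>ball 0 1. C * z + D \<noteq> 0) \<and> \<phi> ` ball 0 1 = ball 0 1 \<and>
        (\<exists>\<zeta>1 \<zeta>2. \<zeta>1 \<noteq> \<zeta>2 \<and> cmod \<zeta>1 = 1 \<and> cmod \<zeta>2 = 1 \<and>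
           {\<zeta>. C * \<zeta> + D \<noteq> 0 \<and> (A * \<zeta> + B) / (C * \<zeta> + D) = \<zeta>} = {\<zeta>1, \<zeta>2})"
    using assms unfolding hyperbolic_automorphism_def by (elim exE) (rule that)
  note det = coeffs[THEN conjunct1]
    and phi = coeffs[THEN conjunct2, THEN conjunct1, THEN spec]
    and nz = coeffs[THEN conjunct2, THEN conjunct2, THEN conjunct1, THEN bspec]
    and im = coeffs[THEN conjunct2, THEN conjunct2, THEN conjunct2, THEN conjunct1]
    and ex = coeffs[THEN conjunct2, THEN conjunct2, THEN conjunct2, THEN conjunct2]
  from ex obtain \<zeta>1 \<zeta>2 where zeta: "\<zeta>1 \<noteq> \<zeta>2" "cmod \<zeta>1 = 1" "cmod \<zeta>2 = 1"
    and fixset: "{\<zeta>. C * \<zeta> + D \<noteq> 0 \<and> (A * \<zeta> + B) / (C * \<zeta> + D) = \<zeta>} = {\<zeta>1, \<zeta>2}"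
    by (elim exE conjE) (rule that)
  interpret two_circle_points \<zeta>1 \<zeta>2 by unfold_locales (use zeta in auto)
  have fp: "C * \<zeta> + D \<noteq> 0" "A * \<zeta> + B = \<zeta> * (C * \<zeta> + D)" if "\<zeta> \<in> {\<zeta>1, \<zeta>2}" for \<zeta>
    using that unfolding fixset[symmetric] by (auto simp: divide_eq_eq)
  \<comment> \<open>The multiplier: a linear fractional map fixing both points multiplies (zeta1 -
    z) / (zeta2 - z) by this constant. Preserving the half-plane makes it real and positive.\<close>
  define \<kappa> where "\<kappa> = (C * \<zeta>2 + D) / (C * \<zeta>1 + D)"
  have mult: "u (\<phi> z) = \<kappa> * u z" and into: "\<phi> z \<in> ball 0 1" if z: "z \<in> ball 0 1" for z
  proof -
    show "\<phi> z \<in> ball 0 1" using im z by blast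
    have diff: "\<zeta> - \<phi> z = (A * D - B * C) * (\<zeta> - z) / ((C * \<zeta> + D) * (C * z + D))" if "\<zeta> \<in> {\<zeta>1, \<zeta>2}" for \<zeta>
    proof -
      have "(A * \<zeta> + B) / (C * \<zeta> + D) = \<zeta>" using fp[OF that] by simp
      then have "\<zeta> - \<phi> z = (A * \<zeta> + B) / (C * \<zeta> + D) - (A * z + B) / (C * z + D)" by (simp only: phi)
      also have "\<dots> = ((A * \<zeta> + B) * (C * z + D) - (A * z + B) * (C * \<zeta> + D)) / ((C * \<zeta> + D) * (C * z + D))"
        by (rule diff_frac_eq[OF fp(1)[OF that] nz[OF z]])
      also have "(A * \<zeta> + B) * (C * z + D) - (A * z + B) * (C * \<zeta> + D) = (A * D - B * C) * (\<zeta> - z)"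
        by (simp add: algebra_simps)
      finally show ?thesis .
    qed
    have ne: "\<zeta>2 - z \<noteq> 0" using z zeta by auto
    have "(\<zeta>1 - \<phi> z) / (\<zeta>2 - \<phi> z) = \<kappa> * ((\<zeta>1 - z) / (\<zeta>2 - z))"
    proof -
      have "k * x / (l * m) / (k * y / (n * m)) = n / l * (x / y)"
        if "k \<noteq> 0" "m \<noteq> 0" "l \<noteq> 0" "n \<noteq> 0" "y \<noteq> 0" for k l m n x y :: complex
        using that by (simp add: field_simps)
      from this[OF det nz[OF z] fp(1) fp(1) ne, of \<zeta>1 \<zeta>2 "\<zeta>1 - z"] show ?thesis
        unfolding \<kappa>_def by (simp only: diff insertI1 insertI2 insert_iff simp_thms)
    qed
    then have "\<zeta>2 / (\<zeta>1 - \<zeta>2) * ((\<zeta>1 - \<phi> z) / (\<zeta>2 - \<phi> z)) = \<kappa> * (\<zeta>2 / (\<zeta>1 - \<zeta>2) * ((\<zeta>1 - z) / (\<zeta>2 - z)))"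
      by simp
    then show "u (\<phi> z) = \<kappa> * u z" by (simp add: u_def)
  qed
  have "Re (\<kappa> * v) > 0" if "Re v > 0" for v
    using Re_u_pos[OF into[OF u_inv(1)[OF that]]] mult[OF u_inv(1)[OF that]] u_inv(2)[OF that] by simp
  note kappa = half_plane_multiplier[OF this]
  \<comment> \<open>Otherwise the map is the identity and fixes 0, although all fixed points lie on
    the circle.\<close>
  have "\<kappa> \<noteq> 1"
  proof
    assume "\<kappa> = 1"
    then have "C * \<zeta>1 = C * \<zeta>2" using fp(1)[of \<zeta>1] by (auto simp: \<kappa>_def)
    then have C: "C = 0" using zeta by simp
    then have e: "A * \<zeta>1 + B = D * \<zeta>1" "A * \<zeta>2 + B = D * \<zeta>2" and D: "D \<noteq> 0" using fp[of \<zeta>1] fp[of \<zeta>2] by (auto simp: mult.commute)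
    have "(A - D) * (\<zeta>1 - \<zeta>2) = (A * \<zeta>1 + B - D * \<zeta>1) - (A * \<zeta>2 + B - D * \<zeta>2)" by (simp add: algebra_simps)
    also have "\<dots> = 0" using e by simp
    finally have "A = D" using zeta by simp
    then have "B = 0" using e by simp
    then have "0 \<in> {\<zeta>. C * \<zeta> + D \<noteq> 0 \<and> (A * \<zeta> + B) / (C * \<zeta> + D) = \<zeta>}" using D by simp
    then show False unfolding fixset using zeta by auto
  qed
  have kr: "\<kappa> = of_real (Re \<kappa>)" using kappa by (simp add: complex_eq_iff)
  have "hyperbolic_automorphism_coordinates \<zeta>1 \<zeta>2 \<phi> (ln (Re \<kappa>))"
  proof
    have "Re \<kappa> \<noteq> 1" using kappa(1) \<open>\<kappa> \<noteq> 1\<close> by (simp add: complex_eq_iff)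
    then show "ln (Re \<kappa>) \<noteq> 0" using kappa(2) by simp
    fix z :: complex assume z: "z \<in> ball 0 1"
    have "\<phi> z = u_inv (u (\<phi> z))" using u_inv_u[OF into[OF z]] by simp
    also have "\<dots> = psi (ln (Re \<kappa>)) z" using mult[OF z] kr kappa by (simp add: psi_def)
    finally show "\<phi> z = psi (ln (Re \<kappa>)) z" .
  qed
  then show ?thesis using that by blast
qed

section \<open>Eigenvalues, local resolvents and property (C)\<close>

context hyperbolic_automorphism_coordinates begin

lemma comp_op_phi: "comp_op \<phi> f = comp_op (psi \<tau>) f"
  using phi by (auto simp: comp_op_def)

text \<open>A positive multiplier shifts the principal logarithm by exactly tau, with no multiple of
  2 pi i.\<close>

lemma comp_op_pw: "comp_op \<phi> (on_disc (pw 0 s)) = (\<lambda>t. exp (s * \<tau>) * on_disc (pw 0 s) t)"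
proof
  fix t show "comp_op \<phi> (on_disc (pw 0 s)) t = exp (s * \<tau>) * on_disc (pw 0 s) t"
  proof (cases "t \<in> ball 0 1")
    case True
    have "Ln (u (psi \<tau> t)) = \<tau> + Ln (u t)"
      unfolding psi(2)[OF True] using Ln_times_of_real[OF exp_gt_zero u_nz[OF True], of \<tau>]
      by (simp add: Ln_of_real del: of_real_exp)
    then have "pw 0 s (psi \<tau> t) = exp (s * \<tau>) * pw 0 s t"
      by (simp add: pw_def distrib_left exp_add)
    then show ?thesis using True psi(1)[OF True, of \<tau>] by (simp add: phi[OF True] comp_op_def)
  qed (simp add: comp_op_def)
qed

lemma not_svep:
  assumes p: "1 \<le> p"
  shows "\<not> svep (hardy p) (hp_norm p) (comp_op \<phi>)"
proof
  assume sv: "svep (hardy p) (hp_norm p) (comp_op \<phi>)"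
  define d where "d = 1 / (2 * p)"
  have p0: "0 < p" and d: "0 < d" "d * p < 1" using p by (auto simp: d_def)
  \<comment> \<open>Reparametrizes the eigenfunctions by their eigenvalue z = e^(s tau), on the slit
    plane near 1; there |Im (h z)| <= pi/|tau|, which makes the domination uniform.\<close>
  define h where "h = (\<lambda>z. Ln z / of_real \<tau>)"
  define U where "U = {z. z \<notin> \<real>\<^sub>\<le>\<^sub>0 \<and> h z \<in> {s. - d < Re s \<and> Re s < d}}"
  have oS: "open {s. - d < Re s \<and> Re s < d}" by (intro open_Collect_conj open_Collect_less continuous_intros)
  have "U = (- \<real>\<^sub>\<le>\<^sub>0) \<inter> h -` {s. - d < Re s \<and> Re s < d}" by (auto simp: U_def)
  moreover have "continuous_on (- \<real>\<^sub>\<le>\<^sub>0) h" unfolding h_def using tau_nz by (intro continuous_intros) auto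
  ultimately have U: "open U"
    using continuous_open_preimage[OF _ open_Compl[OF closed_nonpos_Reals_complex] oS] by metis
  have "vanalytic (hp_norm p) (hardy p) U (\<lambda>z. on_disc (pw 0 (h z)))"
  proof (rule vanalytic_hardyI[OF p0 _ d(2) U])
    show "(\<lambda>w. 1 / (z * of_real \<tau>) * (Ln (u w) * pw 0 (h z) w)) holomorphic_on ball 0 1" for z
      by (rule holomorphic_on_mult[OF holomorphic_on_const holomorphic_on_mult[OF holomorphic_Ln_u holomorphic_pw]])
    show "((\<lambda>z. pw 0 (h z) w) has_field_derivative 1 / (z * of_real \<tau>) * (Ln (u w) * pw 0 (h z) w)) (at z)"
      if "z \<in> U" for z w
      unfolding pw_def h_def using that tau_nz
      by (auto simp: U_def intro!: derivative_eq_intros simp: field_simps)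
    fix z0 assume "z0 \<in> U"
    then obtain r where r: "r > 0" "ball z0 r \<subseteq> U" using U open_contains_ball by blast
    show "\<exists>r>0. \<exists>C. ball z0 r \<subseteq> U \<and> (\<forall>z\<in>ball z0 r. \<forall>w\<in>ball 0 1. cmod (pw 0 (h z) w) \<le> C * W d w)"
    proof (intro exI conjI ballI)
      fix z w :: complex assume z: "z \<in> ball z0 r" and w: "w \<in> ball 0 1"
      have zU: "z \<in> U" using z r by blast
      then have "z \<noteq> 0" by (auto simp: U_def)
      then have "\<bar>Im (Ln z)\<bar> \<le> pi" using mpi_less_Im_Ln[of z] Im_Ln_le_pi[of z] by auto
      then have "\<bar>Im (h z)\<bar> \<le> pi / \<bar>\<tau>\<bar>" by (simp add: h_def abs_divide divide_right_mono)
      then have e: "exp (pi / 2 * \<bar>Im (h z)\<bar>) \<le> exp (pi / 2 * (pi / \<bar>\<tau>\<bar>))"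
        unfolding exp_le_cancel_iff by (rule mult_left_mono) simp
      have "cmod (pw 0 (h z) w) \<le> exp (pi / 2 * \<bar>Im (h z)\<bar>) * (2 + 2 * cmod a) ^ 0 * W d w"
        using zU d by (intro pw_bound[OF w]) (auto simp: U_def)
      also have "\<dots> \<le> exp (pi / 2 * (pi / \<bar>\<tau>\<bar>)) * W d w"
        using e W_pos[OF w, of d] by simp
      finally show "cmod (pw 0 (h z) w) \<le> exp (pi / 2 * (pi / \<bar>\<tau>\<bar>)) * W d w" .
    qed (use r in auto)
  qed (use d holomorphic_pw in auto)
  moreover have "\<forall>z\<in>U. (\<lambda>t. comp_op \<phi> (on_disc (pw 0 (h z))) t - z * on_disc (pw 0 (h z)) t) = (\<lambda>t. 0)"
  proof
    fix z assume "z \<in> U"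
    then have "z \<noteq> 0" by (auto simp: U_def)
    then have "exp (h z * \<tau>) = z" using tau_nz by (simp add: h_def)
    then show "(\<lambda>t. comp_op \<phi> (on_disc (pw 0 (h z))) t - z * on_disc (pw 0 (h z)) t) = (\<lambda>t. 0)"
      by (simp add: comp_op_pw)
  qed
  ultimately have "\<forall>z\<in>U. on_disc (pw 0 (h z)) = (\<lambda>t. 0)" using sv unfolding svep_def by blast
  moreover have "1 \<in> U" using d by (simp add: U_def h_def)
  ultimately show False using pw_0_nz by blast
qed

lemma comp_op_psi_phi:
  "comp_op (psi x) (comp_op \<phi> f) = comp_op (psi (x + \<tau>)) f"
proof
  fix z show "comp_op (psi x) (comp_op \<phi> f) z = comp_op (psi (x + \<tau>)) f z"
    using psi(1)[of z x] psi_psi[of z \<tau> x] phi[of "psi x z"]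
    by (cases "z \<in> ball 0 1") (auto simp: comp_op_def add.commute)
qed

lemma comp_op_psi_0: "f \<in> hardy p \<Longrightarrow> comp_op (psi 0) f = f"
  using psi_0 hardy_outside[of f p] by (auto simp: comp_op_def)

lemma adjoint_phi_psi:
  assumes p: "1 \<le> p" and g: "g \<in> hardy p"
  shows "comp_op \<phi> g \<in> hardy p"
    "adjoint_comp_op p (psi x) \<Lambda> (comp_op \<phi> g) = adjoint_comp_op p (psi (x + \<tau>)) \<Lambda> g"
    "adjoint_comp_op p (psi 0) \<Lambda> g = \<Lambda> g"
proof -
  show c: "comp_op \<phi> g \<in> hardy p" unfolding comp_op_phi by (rule comp_psi_hardy(1)[OF p g])
  show "adjoint_comp_op p (psi x) \<Lambda> (comp_op \<phi> g) = adjoint_comp_op p (psi (x + \<tau>)) \<Lambda> g"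
    using c g by (simp add: adjoint_comp_op_def comp_op_psi_phi)
  show "adjoint_comp_op p (psi 0) \<Lambda> g = \<Lambda> g"
    using g by (simp add: adjoint_comp_op_def comp_op_psi_0)
qed

text \<open>The local resolvent is a series of backward iterates inside the inner circle and of
  forward iterates outside the outer one. Applying the adjoint shifts the coefficients by one place,
  so the equation telescopes to the functional.\<close>

lemma local_spectrum_subset:
  assumes p: "1 \<le> p" and L: "\<Lambda> \<in> hp_dual p"
  shows "local_spectrum (hp_dual p) (dual_norm p) (adjoint_comp_op p \<phi>) \<Lambda>
    \<subseteq> {z. exp (- \<bar>\<tau>\<bar> / p) \<le> cmod z \<and> cmod z \<le> exp (\<bar>\<tau>\<bar> / p)}"
proof -
  have p0: "0 < p" using p by simp
  define R where "R = exp (\<bar>\<tau>\<bar> / p)"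
  have R: "0 < R" "1 \<le> R" using p by (auto simp: R_def)
  have iR: "exp (- \<bar>\<tau>\<bar> / p) = 1 / R" by (simp add: R_def exp_minus divide_inverse)
  let ?A = "\<lambda>x. adjoint_comp_op p (psi x) \<Lambda>"
  obtain M where M: "0 \<le> M" and AX: "\<And>x. ?A x \<in> hp_dual p"
    and Ab: "\<And>x g. g \<in> hardy p \<Longrightarrow> cmod (?A x g) \<le> M * exp (\<bar>x\<bar> / p) * hp_norm p g"
    using adjoint_psi[OF p L] by blast
  have expR: "exp (\<bar>real n * \<tau>\<bar> / p) = R ^ n" for n
    by (simp add: R_def exp_of_nat_mult[symmetric] abs_mult)
  define c where "c = (\<lambda>n. ?A (real n * \<tau>))"
  \<comment> \<open>Starts at the first inverse iterate, so that applying the adjoint to the leading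
    coefficient returns the functional itself. The shift costs the additional factor R in the
    bound.\<close>
  define c' where "c' = (\<lambda>n. ?A (- (real (Suc n) * \<tau>)))"
  have c: "c n \<in> hp_dual p" "g \<in> hardy p \<Longrightarrow> cmod (c n g) \<le> M * R ^ n * hp_norm p g" for n g
    using AX Ab[of g "real n * \<tau>"] by (auto simp: c_def expR)
  have c': "c' n \<in> hp_dual p" "g \<in> hardy p \<Longrightarrow> cmod (c' n g) \<le> (M * R) * R ^ n * hp_norm p g" for n g
    using AX Ab[of g "- (real (Suc n) * \<tau>)"] unfolding c'_def abs_minus_cancel expR by (auto simp: mult_ac)
  have MR: "0 \<le> M * R" using M R by simp
  define H where "H = (\<lambda>w g. \<Sum>n. c n g * w ^ n)"
  define H' where "H' = (\<lambda>w g. \<Sum>n. c' n g * w ^ n)"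
  have H: "\<And>w g. cmod w < 1 / R \<Longrightarrow> g \<in> hardy p \<Longrightarrow> summable (\<lambda>n. c n g * w ^ n)"
    "\<And>w g. cmod w < 1 / R \<Longrightarrow> g \<in> hardy p \<Longrightarrow> cmod (H w g) \<le> M / (1 - R * cmod w) * hp_norm p g"
    "\<And>w. cmod w < 1 / R \<Longrightarrow> H w \<in> hp_dual p"
    "\<And>g. g \<in> hardy p \<Longrightarrow> (\<lambda>w. H w g) holomorphic_on ball 0 (1 / R)"
    unfolding H_def by (rule hp_dual_power_series[OF p0 R(1) M c]; assumption)+
  have H': "\<And>w g. cmod w < 1 / R \<Longrightarrow> g \<in> hardy p \<Longrightarrow> summable (\<lambda>n. c' n g * w ^ n)"
    "\<And>w g. cmod w < 1 / R \<Longrightarrow> g \<in> hardy p \<Longrightarrow> cmod (H' w g) \<le> (M * R) / (1 - R * cmod w) * hp_norm p g"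
    "\<And>w. cmod w < 1 / R \<Longrightarrow> H' w \<in> hp_dual p"
    "\<And>g. g \<in> hardy p \<Longrightarrow> (\<lambda>w. H' w g) holomorphic_on ball 0 (1 / R)"
    unfolding H'_def by (rule hp_dual_power_series[OF p0 R(1) MR c']; assumption)+
  \<comment> \<open>The Neumann bound blows up at the circle of convergence; on a ball reaching only
    half way to it the denominator stays above a positive \<open>\<delta>\<close>.\<close>
  have locb: "\<exists>r>0. \<exists>C\<ge>0. ball z0 r \<subseteq> {z. cmod z < 1 / R} \<and> (\<forall>z\<in>ball z0 r. M' / (1 - R * cmod z) \<le> C)"
    if z0: "cmod z0 < 1 / R" and M': "0 \<le> M'" for z0 M'
  proof -
    define r where "r = (1 / R - cmod z0) / 2"
    define \<delta> where "\<delta> = 1 - R * (cmod z0 + r)"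
    have r: "r > 0" using z0 by (simp add: r_def)
    have "cmod z0 + r < 1 / R" using z0 unfolding r_def by argo
    then have "R * (cmod z0 + r) < R * (1 / R)" using R by (intro mult_strict_left_mono)
    then have del: "\<delta> > 0" using R by (simp add: \<delta>_def)
    have nz: "cmod z \<le> cmod z0 + r" if "z \<in> ball z0 r" for z
      using that norm_triangle_ineq2[of z z0] by (simp add: dist_norm norm_minus_commute)
    have le: "M' / (1 - R * cmod z) \<le> M' / \<delta>" if "z \<in> ball z0 r" for z
    proof -
      have "R * cmod z \<le> R * (cmod z0 + r)" using nz[OF that] R by (intro mult_left_mono) auto
      then show ?thesis using del M' by (intro divide_left_mono mult_pos_pos) (auto simp: \<delta>_def)
    qed
    have sub: "ball z0 r \<subseteq> {z. cmod z < 1 / R}"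
    proof
      fix z assume "z \<in> ball z0 r"
      then show "z \<in> {z. cmod z < 1 / R}" using nz[of z] z0 unfolding r_def mem_Collect_eq by argo
    qed
    show ?thesis using r le sub del M' by (intro exI[of _ r] conjI exI[of _ "M' / \<delta>"]) auto
  qed
  have inner: "z \<notin> local_spectrum (hp_dual p) (dual_norm p) (adjoint_comp_op p \<phi>) \<Lambda>" if z: "cmod z < 1 / R" for z
  proof -
    let ?U = "ball (0::complex) (1 / R)"
    have "vanalytic (dual_norm p) (hp_dual p) ?U H'"
    proof (rule vanalytic_hp_dualI[OF p0 open_ball])
      show "H' z \<in> hp_dual p" if "z \<in> ?U" for z using H'(3) that by simp
      show "(\<lambda>z. H' z g) holomorphic_on ?U" if "g \<in> hardy p" for g using H'(4)[OF that] .
      fix z0 assume "z0 \<in> ?U"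
      then obtain r C where rC: "r > 0" "C \<ge> 0" "ball z0 r \<subseteq> {z. cmod z < 1 / R}"
        "\<And>z. z \<in> ball z0 r \<Longrightarrow> (M * R) / (1 - R * cmod z) \<le> C"
        using locb[of z0 "M * R"] MR by auto
      have "cmod (H' z g) \<le> C * hp_norm p g" if "z \<in> ball z0 r" "g \<in> hardy p" for z g
      proof -
        have "cmod z < 1 / R" using that(1) rC(3) by blast
        from H'(2)[OF this that(2)] show ?thesis
          using mult_right_mono[OF rC(4)[OF that(1)] hp_norm_nonneg[of p g]] by linarith
      qed
      then show "\<exists>r>0. \<exists>C\<ge>0. ball z0 r \<subseteq> ?U \<and> (\<forall>z\<in>ball z0 r. \<forall>g\<in>hardy p. cmod (H' z g) \<le> C * hp_norm p g)"
        using rC(1-3) by (intro exI[of _ r] conjI exI[of _ C]) auto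
    qed
    moreover have "(\<lambda>t. adjoint_comp_op p \<phi> (H' z) t - z * H' z t) = \<Lambda>" if "z \<in> ?U" for z
    proof
      fix g
      have zR: "cmod z < 1 / R" using that by simp
      show "adjoint_comp_op p \<phi> (H' z) g - z * H' z g = \<Lambda> g"
      proof (cases "g \<in> hardy p")
        case True
        note a3 = adjoint_phi_psi[OF p True]
        have c0: "c' 0 (comp_op \<phi> g) = \<Lambda> g" by (simp add: c'_def a3)
        have cS: "c' (Suc n) (comp_op \<phi> g) = c' n g" for n
          by (simp add: c'_def a3 algebra_simps)
        have "H' z (comp_op \<phi> g) = \<Lambda> g + (\<Sum>n. z * (c' n g * z ^ n))"
          unfolding H'_def using suminf_split_head[OF H'(1)[OF zR a3(1)]] by (simp add: c0 cS mult_ac)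
        also have "\<dots> = \<Lambda> g + z * H' z g"
          unfolding H'_def by (subst suminf_mult[OF H'(1)[OF zR True]]) simp
        finally show ?thesis using True by (simp add: adjoint_comp_op_def)
      next
        case False
        then show ?thesis using hp_dual_outside[OF H'(3)[OF zR]] hp_dual_outside[OF L]
          by (simp add: adjoint_comp_op_def)
      qed
    qed
    moreover have "z \<in> ?U" using z by simp
    ultimately show ?thesis by (rule not_in_local_spectrumI)
  qed
  have outer: "z \<notin> local_spectrum (hp_dual p) (dual_norm p) (adjoint_comp_op p \<phi>) \<Lambda>" if z: "R < cmod z" for z
  proof -
    let ?U = "{z::complex. R < cmod z}"
    \<comment> \<open>The expansion of the resolvent at infinity, with terms of the form -(iterate
      n) / z^(n+1).\<close>
    define F where "F = (\<lambda>z g. - (1 / z) * H (1 / z) g)"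
    have oU: "open ?U" by (intro open_Collect_less continuous_intros)
    have inv: "cmod (1 / z) < 1 / R" "z \<noteq> 0" if "z \<in> ?U" for z
    proof -
      have z: "R < cmod z" using that by simp
      then show "z \<noteq> 0" using R by auto
      then show "cmod (1 / z) < 1 / R"
        unfolding norm_divide norm_one using z R by (intro divide_strict_left_mono mult_pos_pos) auto
    qed
    have hol_inv: "(\<lambda>z. 1 / z) holomorphic_on ?U"
      by (intro holomorphic_intros) (use inv(2) in blast)
    have HX: "H (1 / z) \<in> hp_dual p" if "z \<in> ?U" for z using H(3) inv that by blast
    have "vanalytic (dual_norm p) (hp_dual p) ?U F"
    proof (rule vanalytic_hp_dualI[OF p0 oU])
      show "F z \<in> hp_dual p" if z: "z \<in> ?U" for z
      proof (rule hp_dualI)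
        show "cmod (F z f) \<le> cmod (1 / z) * (M / (1 - R * cmod (1 / z))) * hp_norm p f" if "f \<in> hardy p" for f
          unfolding F_def norm_mult norm_minus_cancel mult.assoc
          using mult_left_mono[OF H(2)[OF inv(1)[OF z] that], of "cmod (1/z)"] by (simp add: mult.assoc)
      qed (use HX[OF z] in \<open>auto simp: F_def hp_dual_add hp_dual_cmult hp_dual_outside algebra_simps add_divide_distrib\<close>)
      show "(\<lambda>z. F z g) holomorphic_on ?U" if g: "g \<in> hardy p" for g
      proof -
        have "((\<lambda>w. H w g) \<circ> (\<lambda>z. 1 / z)) holomorphic_on ?U"
        proof (rule holomorphic_on_compose_gen[OF hol_inv H(4)[OF g]])
          show "(\<lambda>z. 1 / z) ` ?U \<subseteq> ball 0 (1 / R)"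
            using inv(1) by (auto simp del: norm_divide)
        qed
        then have h: "(\<lambda>z. H (1 / z) g) holomorphic_on ?U" by (simp only: o_def)
        show ?thesis unfolding F_def by (intro holomorphic_on_mult holomorphic_on_minus hol_inv h)
      qed
      fix z0 assume z0: "z0 \<in> ?U"
      then obtain r C where rC: "r > 0" "C \<ge> 0" "ball (1 / z0) r \<subseteq> {z. cmod z < 1 / R}"
        "\<And>z. z \<in> ball (1 / z0) r \<Longrightarrow> M / (1 - R * cmod z) \<le> C"
        using locb[OF inv(1)[OF z0] M] by blast
      have "open (?U \<inter> (\<lambda>z. 1 / z) -` ball (1 / z0) r)"
        by (rule continuous_open_preimage[OF holomorphic_on_imp_continuous_on[OF hol_inv] oU open_ball])
      moreover have "z0 \<in> ?U \<inter> (\<lambda>z. 1 / z) -` ball (1 / z0) r" using z0 rC by simp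
      ultimately obtain e where e: "e > 0" "ball z0 e \<subseteq> ?U \<inter> (\<lambda>z. 1 / z) -` ball (1 / z0) r"
        using open_contains_ball by blast
      have "cmod (F z g) \<le> C * hp_norm p g" if "z \<in> ball z0 e" "g \<in> hardy p" for z g
      proof -
        have z: "z \<in> ?U" "1 / z \<in> ball (1 / z0) r" using subsetD[OF e(2) that(1)] by auto
        have "cmod (H (1 / z) g) \<le> C * hp_norm p g"
          using H(2)[OF inv(1)[OF z(1)] that(2)] mult_right_mono[OF rC(4)[OF z(2)] hp_norm_nonneg[of p g]] by linarith
        moreover have "1 / R \<le> 1" using R by simp
        then have "cmod (1 / z) \<le> 1" using inv(1)[OF z(1)] by linarith
        ultimately have "cmod (1 / z) * cmod (H (1 / z) g) \<le> 1 * (C * hp_norm p g)" by (intro mult_mono) auto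
        then show ?thesis unfolding F_def norm_mult norm_minus_cancel by linarith
      qed
      then show "\<exists>r>0. \<exists>C\<ge>0. ball z0 r \<subseteq> ?U \<and> (\<forall>z\<in>ball z0 r. \<forall>g\<in>hardy p. cmod (F z g) \<le> C * hp_norm p g)"
        using e rC(2) by (intro exI[of _ e] conjI exI[of _ C] ballI) blast+
    qed
    moreover have "(\<lambda>t. adjoint_comp_op p \<phi> (F z) t - z * F z t) = \<Lambda>" if zU: "z \<in> ?U" for z
    proof
      fix g
      note zR = inv[OF zU]
      show "adjoint_comp_op p \<phi> (F z) g - z * F z g = \<Lambda> g"
      proof (cases "g \<in> hardy p")
        case True
        note a3 = adjoint_phi_psi[OF p True]
        have c0: "c 0 g = \<Lambda> g" by (simp add: c_def a3)
        have cS: "c n (comp_op \<phi> g) = c (Suc n) g" for n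
          by (simp add: c_def a3 algebra_simps)
        have "H (1 / z) g = \<Lambda> g + (\<Sum>n. (1 / z) * (c n (comp_op \<phi> g) * (1 / z) ^ n))"
          unfolding H_def using suminf_split_head[OF H(1)[OF zR(1) True]] by (simp add: c0 cS mult_ac)
        also have "\<dots> = \<Lambda> g + (1 / z) * H (1 / z) (comp_op \<phi> g)"
          unfolding H_def by (subst suminf_mult[OF H(1)[OF zR(1) a3(1)]]) simp
        finally show ?thesis using True zR(2) by (simp add: adjoint_comp_op_def F_def)
      next
        case False
        then show ?thesis using hp_dual_outside[OF HX[OF zU]] hp_dual_outside[OF L]
          by (simp add: adjoint_comp_op_def F_def)
      qed
    qed
    moreover have "z \<in> ?U" using z by simp
    ultimately show ?thesis by (rule not_in_local_spectrumI)
  qed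
  show ?thesis unfolding iR R_def[symmetric]
  proof (intro subsetI CollectI conjI)
    fix z assume z: "z \<in> local_spectrum (hp_dual p) (dual_norm p) (adjoint_comp_op p \<phi>) \<Lambda>"
    show "1 / R \<le> cmod z" using inner[of z] z by argo
    show "cmod z \<le> R" using outer[of z] z by argo
  qed
qed

lemma annulus_subset_local_spectrum:
  assumes p: "1 < p" and L: "\<Lambda> \<in> hp_dual p" "\<Lambda> \<noteq> (\<lambda>f. 0)" and z0: "z0 \<noteq> 0" "\<bar>ln (cmod z0)\<bar> < \<bar>\<tau>\<bar> / p"
  shows "z0 \<in> local_spectrum (hp_dual p) (dual_norm p) (adjoint_comp_op p \<phi>) \<Lambda>"
proof (rule ccontr)
  assume "z0 \<notin> local_spectrum (hp_dual p) (dual_norm p) (adjoint_comp_op p \<phi>) \<Lambda>"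
  then obtain U F where zU: "z0 \<in> U" and F: "vanalytic (dual_norm p) (hp_dual p) U F"
    and eq: "\<And>z. z \<in> U \<Longrightarrow> (\<lambda>t. adjoint_comp_op p \<phi> (F z) t - z * F z t) = \<Lambda>"
    unfolding local_spectrum_def by auto
  have p0: "0 < p" using p by simp
  have U: "open U" and FX: "\<And>z. z \<in> U \<Longrightarrow> F z \<in> hp_dual p" using F by (auto simp: vanalytic_def)
  define s0 where "s0 = Ln z0 / of_real \<tau>"
  have "\<bar>Re s0\<bar> = \<bar>ln (cmod z0)\<bar> / \<bar>\<tau>\<bar>" using z0 by (simp add: s0_def abs_divide)
  also have "\<dots> < 1 / p" using z0 tau_nz p by (simp add: field_simps)
  \<comment> \<open>A width strictly between |Re s0| and 1/p: the strip contains the parameter of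
    \<open>z0\<close> and its eigenfunctions are in H^p.\<close>
  finally obtain d where d1: "\<bar>Re s0\<bar> < d" "d < 1 / p" using dense by blast
  have "1 / p < 1" using p by simp
  with d1 have "0 < d" "d < 1" by linarith+
  moreover have "d * p < 1" using d1(2) p by (simp add: field_simps)
  ultimately have d: "0 < d" "d < 1" "d * p < 1" .
  define S where "S = {s. - d < Re s \<and> Re s < d}"
  define h where "h = (\<lambda>s. \<Lambda> (on_disc (pw 0 s)))"
  have oS: "open S" unfolding S_def by (intro open_Collect_conj open_Collect_less continuous_intros)
  have "S = {s. Re s < d} \<inter> {s. - d < Re s}" by (auto simp: S_def)
  then have "convex S" using convex_halfspace_Re_lt convex_halfspace_Re_gt by (simp add: convex_Int)
  then have cS: "connected S" by (rule convex_connected)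
  have hh: "h holomorphic_on S"
    unfolding h_def S_def using hp_dual_holomorphic[OF p0 L(1) vanalytic_pw[OF p0 less_imp_le[OF d(1)] d(3), of 0]] by simp
  define V where "V = S \<inter> (\<lambda>s. exp (s * \<tau>)) -` U"
  have oV: "open V" unfolding V_def by (intro continuous_open_preimage oS U continuous_intros)
  have "exp (s0 * \<tau>) = z0" using tau_nz z0 by (simp add: s0_def)
  then have V: "s0 \<in> V" using d1 zU by (auto simp: V_def S_def)
  have hV: "h s = 0" if "s \<in> V" for s
  proof -
    let ?e = "on_disc (pw 0 s)" and ?z = "exp (s * \<tau>)"
    have sS: "- d < Re s" "Re s < d" and zU: "?z \<in> U" using that by (auto simp: V_def S_def)
    then have e: "?e \<in> hardy p" using pw_hardy[OF p0 less_imp_le[OF d(1)] d(3), of s 0] by simp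
    have "\<Lambda> ?e = adjoint_comp_op p \<phi> (F ?z) ?e - ?z * F ?z ?e" using fun_cong[OF eq[OF zU], of ?e] by simp
    also have "\<dots> = 0" using e hp_dual_cmult[OF FX[OF zU] e, of ?z] by (simp add: adjoint_comp_op_def comp_op_pw)
    finally show ?thesis by (simp add: h_def)
  qed
  \<comment> \<open>Identity theorem: \<open>V\<close> is a nonempty open part of the connected
    strip.\<close>
  have "h s = 0" if "s \<in> S" for s
    by (rule analytic_continuation_open[of V S h "\<lambda>_. 0"])
      (use oV oS cS V hh hV that in \<open>auto simp: V_def\<close>)
  moreover have "s \<in> S" if "\<bar>Re s\<bar> < d" for s using that by (auto simp: S_def abs_less_iff)
  ultimately have "\<And>s. \<bar>Re s\<bar> < d \<Longrightarrow> \<Lambda> (on_disc (pw 0 s)) = 0" by (simp add: h_def)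
  from hp_dual_zero_of_pw[OF p L(1) d this] show False using L(2) by simp
qed

lemma dunford_C_adjoint:
  assumes p: "1 < p"
  shows "dunford_C (hp_dual p) (dual_norm p) (adjoint_comp_op p \<phi>)"
  unfolding dunford_C_def
proof (intro allI impI)
  fix S xs x
  let ?sp = "local_spectrum (hp_dual p) (dual_norm p) (adjoint_comp_op p \<phi>)"
  assume S: "closed S" and xs: "\<forall>n. xs n \<in> local_spectral_subspace (hp_dual p) (dual_norm p) (adjoint_comp_op p \<phi>) S"
    and x: "x \<in> hp_dual p" and lim: "(\<lambda>n. dual_norm p (\<lambda>t. xs n t - x t)) \<longlonglongrightarrow> 0"
  have p0: "0 < p" and p1: "1 \<le> p" using p by auto
  have zero: "(\<lambda>f. 0) \<in> hp_dual p" by (rule hp_dualI[where C = 0]) simp_all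
  have "?sp x \<subseteq> S"
  proof (cases "x = (\<lambda>f. 0)")
    case True
    \<comment> \<open>The zero functional has empty local spectrum: the zero function is a global
      local resolvent.\<close>
    have "vanalytic (dual_norm p) (hp_dual p) UNIV (\<lambda>z f. 0)"
    proof (rule vanalytic_hp_dualI[OF p0 open_UNIV zero])
      show "\<exists>r>0. \<exists>C\<ge>0. ball z0 r \<subseteq> UNIV \<and> (\<forall>z\<in>ball z0 r. \<forall>g\<in>hardy p. cmod 0 \<le> C * hp_norm p g)" for z0 :: complex
        by (intro exI[of _ 1] conjI exI[of _ 0]) simp_all
    qed simp_all
    moreover have "(\<lambda>t. adjoint_comp_op p \<phi> (\<lambda>f. 0) t - z * 0) = x" for z
      using True by (auto simp: adjoint_comp_op_def)
    ultimately have "z \<notin> ?sp x" for z by (rule not_in_local_spectrumI) (rule UNIV_I)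
    then show ?thesis by blast
  next
    case False
    \<comment> \<open>A single nonzero member of the sequence forces the closed set to contain the
      open annulus, and then its closure, which contains the local spectrum of every
      functional.\<close>
    have "\<exists>n. xs n \<noteq> (\<lambda>f. 0)"
    proof (rule ccontr)
      assume "\<not> ?thesis"
      then have "(\<lambda>n. dual_norm p (\<lambda>t. 0 - x t)) \<longlonglongrightarrow> 0" using lim by simp
      then have "dual_norm p (\<lambda>t. 0 - x t) = 0" by (simp only: LIMSEQ_const_iff)
      then show False using dual_norm_diff_zero[OF p0 x] False by simp
    qed
    then obtain n where n: "xs n \<noteq> (\<lambda>f. 0)" by blast
    have "xs n \<in> hp_dual p" "?sp (xs n) \<subseteq> S" using spec[OF xs, of n] by (simp_all add: local_spectral_subspace_def)
    then have ann: "z \<in> S" if "z \<noteq> 0" "\<bar>ln (cmod z)\<bar> < \<bar>\<tau>\<bar> / p" for z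
      using annulus_subset_local_spectrum[OF p _ n that] by blast
    show ?thesis
    proof
      fix z assume "z \<in> ?sp x"
      then have "exp (- \<bar>\<tau>\<bar> / p) \<le> cmod z" "cmod z \<le> exp (\<bar>\<tau>\<bar> / p)"
        using local_spectrum_subset[OF p1 x] by auto
      moreover from this have z0: "z \<noteq> 0" using exp_gt_zero[of "- \<bar>\<tau>\<bar> / p"] by auto
      ultimately have "ln (exp (- \<bar>\<tau>\<bar> / p)) \<le> ln (cmod z)" "ln (cmod z) \<le> ln (exp (\<bar>\<tau>\<bar> / p))"
        by (simp_all only: zero_less_norm_iff ln_le_cancel_iff exp_gt_zero simp_thms)
      then have le: "\<bar>ln (cmod z)\<bar> \<le> \<bar>\<tau>\<bar> / p" by (simp add: abs_le_iff)
      \<comment> \<open>Replaces |z| by |z|^(1 - 1/(n+1)): even boundary points of the annulus are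
        limits of points strictly inside.\<close>
      define w where "w = (\<lambda>n. z * of_real (exp (- inverse (real (Suc n)) * ln (cmod z))))"
      have "w n \<in> S" for n
      proof (rule ann)
        show "w n \<noteq> 0" using z0 by (simp add: w_def)
        have "ln (cmod (w n)) = (1 - inverse (real (Suc n))) * ln (cmod z)"
          using z0 by (simp add: w_def norm_mult ln_mult algebra_simps)
        then have "\<bar>ln (cmod (w n))\<bar> = (1 - inverse (real (Suc n))) * \<bar>ln (cmod z)\<bar>"
          by (simp add: abs_mult inverse_le_1_iff)
        also have "\<dots> \<le> (1 - inverse (real (Suc n))) * (\<bar>\<tau>\<bar> / p)"
          using le by (intro mult_left_mono) (auto simp: inverse_le_1_iff)
        also have "\<dots> < 1 * (\<bar>\<tau>\<bar> / p)"
          using tau_nz p0 by (intro mult_strict_right_mono) auto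
        finally show "\<bar>ln (cmod (w n))\<bar> < \<bar>\<tau>\<bar> / p" by simp
      qed
      moreover have "w \<longlonglongrightarrow> z * of_real (exp (- 0 * ln (cmod z)))"
        unfolding w_def by (intro tendsto_intros LIMSEQ_inverse_real_of_nat)
      then have "w \<longlonglongrightarrow> z" by simp
      ultimately show "z \<in> S" by (rule closed_sequentially[OF S])
    qed
  qed
  then show "x \<in> local_spectral_subspace (hp_dual p) (dual_norm p) (adjoint_comp_op p \<phi>) S"
    using x by (simp add: local_spectral_subspace_def)
qed

end

theorem theorem3p1:
  fixes \<phi> :: "complex \<Rightarrow> complex"
  assumes "hyperbolic_automorphism \<phi>"
  shows "(\<forall>p::real. 1 \<le> p \<longrightarrow> \<not> svep (hardy p) (hp_norm p) (comp_op \<phi>)) \<and>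
         (\<forall>p::real. 1 < p \<longrightarrow> dunford_C (hp_dual p) (dual_norm p) (adjoint_comp_op p \<phi>))"
proof -
  obtain \<zeta>1 \<zeta>2 \<tau> where "hyperbolic_automorphism_coordinates \<zeta>1 \<zeta>2 \<phi> \<tau>"
    using hyperbolic_automorphism_coordinates_exist[OF assms] by blast
  then interpret hyperbolic_automorphism_coordinates \<zeta>1 \<zeta>2 \<phi> \<tau> .
  show ?thesis by (intro conjI allI impI not_svep dunford_C_adjoint)
qed

end
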